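(* Fix a compact metric space $(X,\mathcal{D})$. (a) The Lipschitz MAB problem on $(X,\mathcal{D})$ is either $f(t)$-tractable for every $f\in\omega(\log t)$, or it is not $g(t)$-tractable for any $g\in o(\sqrt t)$. (b) The Lipschitz experts problem on $(X,\mathcal{D})$ is either $1$-tractable, even with double feedback, or it is not $g(t)$-tractable for any $g\in o(\sqrt t)$, even with full feedback and uniformly Lipschitz payoffs. In both cases, the first alternative occurs if and only if $X$ is countable.
   Context: Lipschitz MAB problem on $(X,\mathcal{D})$ (diameter at most 1, known): unknown $\mu:X\to[0,1]$ with $|\mu(x)-\mu(y)|\le\mathcal{D}(x,y)$ and for each arm a reward distribution on $[0,1]$ with mean $\mu(x)$; each round the algorithm picks $x_t$ and gets an independent reward from that distribution. Lipschitz experts problem: an instance is an unknown Borel probability measure $\mathbb{P}$ on $[0,1]^X$ with $\mu(x)=\mathbb{E}_{f\sim\mathbb{P}}[f(x)]$ $1$-Lipschitz; each round the algorithm picks $x_t$, $f_t\sim\mathbb{P}$ independently, the algorithm receives $f_t(x_t)$; with full feedback it may query $f_t$ at any finitely many points; with double feedback it picks one extra point $y_t$ and observes only $f_t(x_t)$ and $f_t(y_t)$. Uniformly Lipschitz payoffs: every $f$ in the support of $\mathbb{P}$ is $1$-Lipschitz. Regret $R(t)=t\sup\mu-\mathbb{E}[\sum_{s\le t}\mu(x_s)]$. $f(t)$-tractable: some algorithm has, for every instance, $R(t)\le Cf(t)$ for all $t$ with $C$ depending on the instance; $1$-tractable means $f\equiv1$. $f\in\omega(\log t)$: $f(t)/\log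 t\to\infty$; $g\in o(\sqrt t)$: $g(t)/\sqrt t\to0$.
   Formalization: In (a) the rates f in ω(log t) are also required to be positive for all t ≥ 1, since R(t) ≤ C f(t) for all t is impossible where f(t) ≤ 0 (e.g. f(t) = (log t)² at t = 1 on a two-point space). *)

theory Defs
  imports "HOL-Probability.Probability"
begin

abbreviation arms :: "'a::metric_space set \<Rightarrow> 'a measure" where
  "arms X \<equiv> restrict_space borel X"

text \<open>
  Randomized algorithms draw one private seed \<open>\<omega>\<close> from a law \<open>Q\<close> on the reals; every later decision
  is a measurable function of the seed and of the feedback observed so far. As compact metric
  spaces are standard Borel, this is as general as letting the algorithm draw every
  decision from a history-dependent distribution. Rounds are numbered from 0.
\<close>

definition seed_law :: "real measure \<Rightarrow> bool" where
  "seed_law Q \<longleftrightarrow> prob_space Q \<and> sets Q = sets borel"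


subsection \<open>The Lipschitz MAB problem\<close>

text \<open>
  The reward distributions form a Markov kernel, so that a reward drawn from the distribution
  of a random arm makes sense. For countable \<open>X\<close> this is no restriction, see
  \<open>reward_kernel_countable\<close> below.
\<close>

definition mab_instance ::
    "'a::metric_space set \<Rightarrow> ('a \<Rightarrow> real) \<Rightarrow> ('a \<Rightarrow> real measure) \<Rightarrow> bool" where
  "mab_instance X \<mu> \<nu> \<longleftrightarrow>
     \<mu> ` X \<subseteq> {0..1} \<and> 1-lipschitz_on X \<mu> \<and>
     \<nu> \<in> arms X \<rightarrow>\<^sub>M prob_algebra borel \<and>
     (\<forall>x\<in>X. (AE y in \<nu> x. y \<in> {0..1}) \<and> (\<integral>y. y \<partial>\<nu> x) = \<mu> x)"

definition mab_algorithm ::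
    "'a::metric_space set \<Rightarrow> real measure \<Rightarrow> (nat \<Rightarrow> real \<Rightarrow> (nat \<Rightarrow> real) \<Rightarrow> 'a) \<Rightarrow> bool" where
  "mab_algorithm X Q a \<longleftrightarrow> seed_law Q \<and>
     (\<forall>t. (\<lambda>(\<omega>, r). a t \<omega> r) \<in> Q \<Otimes>\<^sub>M (\<Pi>\<^sub>M s\<in>{..<t}. borel) \<rightarrow>\<^sub>M arms X)"

text \<open>The joint law of the seed and of the rewards of the rounds \<open>s < t\<close>.\<close>

primrec mab_law ::
    "real measure \<Rightarrow> (nat \<Rightarrow> real \<Rightarrow> (nat \<Rightarrow> real) \<Rightarrow> 'a) \<Rightarrow> ('a \<Rightarrow> real measure) \<Rightarrow>
     nat \<Rightarrow> (real \<times> (nat \<Rightarrow> real)) measure" where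
  "mab_law Q a \<nu> 0 = distr Q (Q \<Otimes>\<^sub>M (\<Pi>\<^sub>M s\<in>{..<0}. borel)) (\<lambda>\<omega>. (\<omega>, \<lambda>_. undefined))"
| "mab_law Q a \<nu> (Suc t) = mab_law Q a \<nu> t \<bind>
     (\<lambda>(\<omega>, r). distr (\<nu> (a t \<omega> r)) (Q \<Otimes>\<^sub>M (\<Pi>\<^sub>M s\<in>{..<Suc t}. borel)) (\<lambda>y. (\<omega>, r(t := y))))"

definition mab_regret ::
    "'a::metric_space set \<Rightarrow> real measure \<Rightarrow> (nat \<Rightarrow> real \<Rightarrow> (nat \<Rightarrow> real) \<Rightarrow> 'a) \<Rightarrow>
     ('a \<Rightarrow> real) \<Rightarrow> ('a \<Rightarrow> real measure) \<Rightarrow> nat \<Rightarrow> real" where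
  "mab_regret X Q a \<mu> \<nu> t = real t * (SUP x\<in>X. \<mu> x) -
     (\<integral>(\<omega>, r). (\<Sum>s<t. \<mu> (a s \<omega> (restrict r {..<s}))) \<partial>mab_law Q a \<nu> t)"

definition mab_tractable :: "'a::metric_space set \<Rightarrow> (nat \<Rightarrow> real) \<Rightarrow> bool" where
  "mab_tractable X f \<longleftrightarrow>
     (\<exists>Q a. mab_algorithm X Q a \<and>
       (\<forall>\<mu> \<nu>. mab_instance X \<mu> \<nu> \<longrightarrow> (\<exists>C. \<forall>t\<ge>1. mab_regret X Q a \<mu> \<nu> t \<le> C * f t)))"


subsection \<open>The Lipschitz experts problem\<close>

definition payoff_topology :: "'a set \<Rightarrow> ('a \<Rightarrow> real) topology" where
  "payoff_topology X = product_topology (\<lambda>_. top_of_set {0..1}) X"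

definition payoff_borel :: "'a set \<Rightarrow> ('a \<Rightarrow> real) measure" where
  "payoff_borel X = sigma (topspace (payoff_topology X)) {U. openin (payoff_topology X) U}"

definition expert_mean :: "('a \<Rightarrow> real) measure \<Rightarrow> 'a \<Rightarrow> real" where
  "expert_mean P x = (\<integral>f. f x \<partial>P)"

text \<open>
  Evaluating a random payoff function at a random point is not measurable for every Borel measure
  on the product space, so the payoff functions have to form a measurable process,
  up to a null set. This is no restriction for countable \<open>X\<close>, nor for measures
  that are concentrated on Lipschitz functions, see \<open>measurable_evaluation_countable\<close> and
  \<open>measurable_evaluation_lipschitz\<close> below.
\<close>

definition measurable_evaluation :: "'a::metric_space set \<Rightarrow> ('a \<Rightarrow> real) measure \<Rightarrow> bool" where
  "measurable_evaluation X P \<longleftrightarrow>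
     (\<exists>S\<in>sets P. emeasure P S = 1 \<and>
       (\<lambda>(f, x). f x) \<in> borel_measurable (restrict_space P S \<Otimes>\<^sub>M arms X))"

definition expert_instance :: "'a::metric_space set \<Rightarrow> ('a \<Rightarrow> real) measure \<Rightarrow> bool" where
  "expert_instance X P \<longleftrightarrow>
     prob_space P \<and> sets P = sets (payoff_borel X) \<and> measurable_evaluation X P \<and>
     1-lipschitz_on X (expert_mean P)"

definition payoff_support :: "'a set \<Rightarrow> ('a \<Rightarrow> real) measure \<Rightarrow> ('a \<Rightarrow> real) set" where
  "payoff_support X P =
     {f \<in> topspace (payoff_topology X).
        \<forall>U. openin (payoff_topology X) U \<and> f \<in> U \<longrightarrow> emeasure P U > 0}"

definition uniformly_lipschitz :: "'a::metric_space set \<Rightarrow> ('a \<Rightarrow> real) measure \<Rightarrow> bool" where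
  "uniformly_lipschitz X P \<longleftrightarrow> (\<forall>f\<in>payoff_support X P. 1-lipschitz_on X f)"

text \<open>
  The seed together with the independent payoff functions \<open>f\<^sub>0, f\<^sub>1, \<dots>\<close>. The completion
  takes care of the null set in \<open>measurable_evaluation\<close>.
\<close>

definition expert_space :: "real measure \<Rightarrow> ('a \<Rightarrow> real) measure \<Rightarrow>
    (real \<times> (nat \<Rightarrow> 'a \<Rightarrow> real)) measure" where
  "expert_space Q P = completion (Q \<Otimes>\<^sub>M (\<Pi>\<^sub>M t\<in>UNIV. P))"

definition expert_regret :: "'a set \<Rightarrow> real measure \<Rightarrow>
    (nat \<Rightarrow> real \<Rightarrow> (nat \<Rightarrow> 'a \<Rightarrow> real) \<Rightarrow> 'a) \<Rightarrow> ('a \<Rightarrow> real) measure \<Rightarrow> nat \<Rightarrow> real" where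
  "expert_regret X Q pick P t = real t * (SUP x\<in>X. expert_mean P x) -
     (\<integral>(\<omega>, \<phi>). (\<Sum>s<t. expert_mean P (pick s \<omega> \<phi>)) \<partial>expert_space Q P)"


paragraph \<open>Double feedback.\<close>

text \<open>In round \<open>t\<close> the algorithm chooses the pair \<open>a t \<omega> v = (x\<^sub>t, y\<^sub>t)\<close>, where \<open>v\<close> lists the pairs of
  values observed in the rounds \<open>s < t\<close>.\<close>

type_synonym 'a double_rule = "nat \<Rightarrow> real \<Rightarrow> (nat \<Rightarrow> real \<times> real) \<Rightarrow> 'a \<times> 'a"

definition double_algorithm ::
    "'a::metric_space set \<Rightarrow> real measure \<Rightarrow> 'a double_rule \<Rightarrow> bool" where
  "double_algorithm X Q a \<longleftrightarrow> seed_law Q \<and>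
     (\<forall>t. (\<lambda>(\<omega>, v). a t \<omega> v) \<in>
        Q \<Otimes>\<^sub>M (\<Pi>\<^sub>M s\<in>{..<t}. borel \<Otimes>\<^sub>M borel) \<rightarrow>\<^sub>M arms X \<Otimes>\<^sub>M arms X)"

primrec double_run :: "'a double_rule \<Rightarrow> real \<Rightarrow> (nat \<Rightarrow> 'a \<Rightarrow> real) \<Rightarrow>
    nat \<Rightarrow> (nat \<Rightarrow> real \<times> real)" where
  "double_run a \<omega> \<phi> 0 = (\<lambda>_. undefined)"
| "double_run a \<omega> \<phi> (Suc t) =
     (let v = double_run a \<omega> \<phi> t; (x, y) = a t \<omega> v in v(t := (\<phi> t x, \<phi> t y)))"

definition double_pick :: "'a double_rule \<Rightarrow> nat \<Rightarrow> real \<Rightarrow> (nat \<Rightarrow> 'a \<Rightarrow> real) \<Rightarrow> 'a" where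
  "double_pick a t \<omega> \<phi> = fst (a t \<omega> (double_run a \<omega> \<phi> t))"

definition double_tractable :: "'a::metric_space set \<Rightarrow> (nat \<Rightarrow> real) \<Rightarrow> bool" where
  "double_tractable X f \<longleftrightarrow>
     (\<exists>Q a. double_algorithm X Q a \<and>
       (\<forall>P. expert_instance X P \<longrightarrow>
         (\<exists>C. \<forall>t\<ge>1. expert_regret X Q (double_pick a) P t \<le> C * f t)))"


paragraph \<open>Full feedback.\<close>

text \<open>
  The algorithm acts in steps and observes one value per step: \<open>a i \<omega> v = (True, x)\<close> starts the
  next round by picking \<open>x\<close>, and \<open>a i \<omega> v = (False, z)\<close> queries the payoff function of the
  current round at \<open>z\<close>, where \<open>v\<close> lists the values observed in the steps before \<open>i\<close>. So the
  queries of a round may depend on each other's answers. As infinitely many steps start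
  a round, each round has finitely many queries.
\<close>

type_synonym 'a full_rule = "nat \<Rightarrow> real \<Rightarrow> (nat \<Rightarrow> real) \<Rightarrow> bool \<times> 'a"

definition full_algorithm ::
    "'a::metric_space set \<Rightarrow> real measure \<Rightarrow> 'a full_rule \<Rightarrow> bool" where
  "full_algorithm X Q a \<longleftrightarrow> seed_law Q \<and>
     (\<forall>i. (\<lambda>(\<omega>, v). a i \<omega> v) \<in>
        Q \<Otimes>\<^sub>M (\<Pi>\<^sub>M j\<in>{..<i}. borel) \<rightarrow>\<^sub>M count_space UNIV \<Otimes>\<^sub>M arms X) \<and>
     (\<forall>\<omega> v. fst (a 0 \<omega> (restrict v {..<0}))) \<and>
     (\<forall>\<omega> v. \<exists>\<^sub>\<infinity>i. fst (a i \<omega> (restrict v {..<i})))"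

text \<open>The number of rounds started before step \<open>i\<close>, and the values observed before step \<open>i\<close>.\<close>

primrec full_run :: "'a full_rule \<Rightarrow> real \<Rightarrow> (nat \<Rightarrow> 'a \<Rightarrow> real) \<Rightarrow>
    nat \<Rightarrow> nat \<times> (nat \<Rightarrow> real)" where
  "full_run a \<omega> \<phi> 0 = (0, \<lambda>_. undefined)"
| "full_run a \<omega> \<phi> (Suc i) =
     (let (k, v) = full_run a \<omega> \<phi> i; (b, x) = a i \<omega> v; k' = (if b then Suc k else k)
      in (k', v(i := \<phi> (k' - 1) x)))"

definition full_pick :: "'a full_rule \<Rightarrow> nat \<Rightarrow> real \<Rightarrow> (nat \<Rightarrow> 'a \<Rightarrow> real) \<Rightarrow> 'a" where
  "full_pick a t \<omega> \<phi> =
     (let i = (LEAST i. fst (full_run a \<omega> \<phi> (Suc i)) = Suc t)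
      in snd (a i \<omega> (snd (full_run a \<omega> \<phi> i))))"

definition full_tractable_uniform :: "'a::metric_space set \<Rightarrow> (nat \<Rightarrow> real) \<Rightarrow> bool" where
  "full_tractable_uniform X f \<longleftrightarrow>
     (\<exists>Q a. full_algorithm X Q a \<and>
       (\<forall>P. expert_instance X P \<and> uniformly_lipschitz X P \<longrightarrow>
         (\<exists>C. \<forall>t\<ge>1. expert_regret X Q (full_pick a) P t \<le> C * f t)))"


subsection \<open>The measurability conditions\<close>

lemma sets_arms_countable:
  fixes X :: "'a::metric_space set"
  assumes "countable X"
  shows "sets (arms X) = Pow X"
proof -
  have "A \<in> (\<inter>) X ` sets borel" if "A \<subseteq> X" for A
  proof -
    have "countable A" using that assms countable_subset by blast
    then have "A \<in> sets borel"
      using sets.countable[of A borel] by auto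
    then show ?thesis using that by (intro image_eqI[of _ _ A]) auto
  qed
  then show ?thesis by (auto simp: sets_restrict_space)
qed

lemma arms_countable:
  "countable X \<Longrightarrow> sets (arms X) = sets (count_space X)"
  by (simp add: sets_arms_countable)

lemma reward_kernel_countable:
  assumes "countable X" "\<And>x. x \<in> X \<Longrightarrow> prob_space (\<nu> x) \<and> sets (\<nu> x) = sets borel"
  shows "\<nu> \<in> arms X \<rightarrow>\<^sub>M prob_algebra borel"
  using assms(2) by (subst measurable_cong_sets[OF arms_countable[OF assms(1)] refl])
    (auto simp: space_prob_algebra)

lemma space_payoff_borel: "space (payoff_borel X) = (X \<rightarrow>\<^sub>E {0..1})"
proof -
  have "{U. openin (payoff_topology X) U} \<subseteq> Pow (topspace (payoff_topology X))"
    by (auto dest: openin_subset)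
  then have "space (payoff_borel X) = topspace (payoff_topology X)"
    unfolding payoff_borel_def by (rule space_measure_of)
  then show ?thesis by (simp add: payoff_topology_def)
qed

lemma openin_payoff_borel: "openin (payoff_topology X) U \<Longrightarrow> U \<in> sets (payoff_borel X)"
  unfolding payoff_borel_def
  by (subst sets_measure_of) (auto dest: openin_subset)

lemma closedin_payoff_borel:
  assumes "closedin (payoff_topology X) S" shows "S \<in> sets (payoff_borel X)"
proof -
  have "topspace (payoff_topology X) - S \<in> sets (payoff_borel X)"
    using assms by (intro openin_payoff_borel) (auto simp: closedin_def)
  from sets.compl_sets[OF this] show ?thesis
    using closedin_subset[OF assms]
    by (simp add: space_payoff_borel payoff_topology_def double_diff)
qed

lemma continuous_map_payoff_eval:
  assumes "x \<in> X" shows "continuous_map (payoff_topology X) euclidean (\<lambda>f. f x)"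
  using continuous_map_product_projection[OF assms, of "\<lambda>_. top_of_set {0..1::real}"]
  unfolding payoff_topology_def by (rule continuous_map_into_fulltopology)

lemma measurable_payoff_eval:
  assumes "x \<in> X" shows "(\<lambda>f. f x) \<in> borel_measurable (payoff_borel X)"
proof (rule borel_measurableI)
  fix S :: "real set" assume "open S"
  then have "openin (payoff_topology X) {f \<in> topspace (payoff_topology X). f x \<in> S}"
    using openin_continuous_map_preimage[OF continuous_map_payoff_eval[OF assms]] by simp
  then have "{f \<in> topspace (payoff_topology X). f x \<in> S} \<in> sets (payoff_borel X)"
    by (rule openin_payoff_borel)
  moreover have "(\<lambda>f. f x) -` S \<inter> space (payoff_borel X) =
      {f \<in> topspace (payoff_topology X). f x \<in> S}"
    by (auto simp: space_payoff_borel payoff_topology_def)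
  ultimately show "(\<lambda>f. f x) -` S \<inter> space (payoff_borel X) \<in> sets (payoff_borel X)"
    by simp
qed

lemma measurable_evaluation_countable:
  assumes "countable X" "prob_space P" "sets P = sets (payoff_borel X)"
  shows "measurable_evaluation X P"
proof -
  have *: "(\<lambda>f. f x) \<in> borel_measurable P" if "x \<in> X" for x
    using measurable_payoff_eval[OF that] assms(3) by (simp cong: measurable_cong_sets)
  have "(\<lambda>p. (fst p) (snd p)) \<in> borel_measurable (P \<Otimes>\<^sub>M count_space X)"
    by (rule measurable_compose_countable'[where f="\<lambda>x p. (fst p) x" and I=X])
      (use assms(1) * in \<open>auto intro: measurable_compose[OF measurable_fst]\<close>)
  then have "(\<lambda>(f, x). f x) \<in> borel_measurable (P \<Otimes>\<^sub>M arms X)"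
    using measurable_cong_sets[OF sets_pair_measure_cong[OF refl[of "sets P"]
          arms_countable[OF assms(1)]] refl[of "sets (borel :: real measure)"]]
    unfolding case_prod_beta' by (simp only:)
  moreover have sets_space: "sets (restrict_space P (space P)) = sets P"
    using sets.sets_into_space by (force simp: sets_restrict_space)
  ultimately have "(\<lambda>(f, x). f x) \<in> borel_measurable (restrict_space P (space P) \<Otimes>\<^sub>M arms X)"
    using measurable_cong_sets[OF sets_pair_measure_cong[OF sets_space
          refl[of "sets (arms X)"]] refl[of "sets (borel :: real measure)"]] by blast
  then show ?thesis
    unfolding measurable_evaluation_def
    using prob_space.emeasure_space_1[OF assms(2)] by (intro bexI[of _ "space P"]) auto
qed

lemma closedin_lipschitz:
  fixes X :: "'a::metric_space set"
  shows "closedin (payoff_topology X) {f \<in> topspace (payoff_topology X). 1-lipschitz_on X f}"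
proof (cases "X = {}")
  case True
  then show ?thesis by (simp add: lipschitz_on_def)
next
  case False
  let ?T = "payoff_topology X"
  let ?S = "\<lambda>x y. {f \<in> topspace ?T. dist (f x) (f y) \<in> {..dist x y}}"
  have cl: "closedin ?T (?S x y)" if "x \<in> X" "y \<in> X" for x y
  proof (rule closedin_continuous_map_preimage)
    show "continuous_map ?T euclideanreal (\<lambda>f. dist (f x) (f y))"
      unfolding dist_real_def
      by (intro continuous_map_real_abs continuous_map_diff continuous_map_payoff_eval that)
  qed simp
  have "{f \<in> topspace ?T. 1-lipschitz_on X f} = \<Inter> ((\<lambda>(x, y). ?S x y) ` (X \<times> X))"
    using False by (auto simp: lipschitz_on_def)
  moreover have "closedin ?T (\<Inter> ((\<lambda>(x, y). ?S x y) ` (X \<times> X)))"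
    using False cl by (intro closedin_Inter) auto
  ultimately show ?thesis by simp
qed

lemma measurable_evaluation_lipschitz:
  assumes "compact X" "prob_space P" "sets P = sets (payoff_borel X)"
    and "AE f in P. 1-lipschitz_on X f"
  shows "measurable_evaluation X P"
proof (cases "X = {}")
  case True
  then show ?thesis using measurable_evaluation_countable assms by blast
next
  case False
  define S where "S = {f \<in> topspace (payoff_topology X). 1-lipschitz_on X f}"
  have S: "S \<in> sets P"
    using closedin_payoff_borel[OF closedin_lipschitz] assms(3) by (simp add: S_def)
  have top: "topspace (payoff_topology X) = space P"
    using sets_eq_imp_space_eq[OF assms(3)] by (simp add: space_payoff_borel payoff_topology_def)
  have "AE f in P. f \<in> S"
    using assms(4) AE_space by eventually_elim (auto simp: S_def top)
  then have S1: "emeasure P S = 1"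
    using prob_space.emeasure_eq_1_AE[OF assms(2) S] by blast
  have "\<exists>K. finite K \<and> K \<subseteq> X \<and> X \<subseteq> (\<Union>x\<in>K. ball x (1 / real (Suc n)))" for n
    using seq_compact_imp_totally_bounded[OF compact_imp_seq_compact[OF assms(1)]] by simp
  then obtain K where K: "\<And>n. finite (K n)" "\<And>n. K n \<subseteq> X"
      "\<And>n. X \<subseteq> (\<Union>x\<in>K n. ball x (1 / real (Suc n)))"
    by metis
  define D where "D = (\<Union>n. K n)"
  have D: "countable D" "D \<subseteq> X"
    using K(1,2) by (auto simp: D_def intro: countable_finite)
  have dense: "\<exists>y\<in>D. dist y x < 1 / real (Suc n)" if "x \<in> X" for x n
    using K(3)[of n] that by (force simp: D_def)
  have "D \<noteq> {}" using dense False by blast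
  define e where "e = from_nat_into D"
  have e: "e k \<in> X" for k
    using from_nat_into[OF \<open>D \<noteq> {}\<close>] D(2) by (auto simp: e_def)
  define d where "d n x = (LEAST k. dist (e k) x < 1 / real (Suc n))" for n and x :: 'a
  have d: "dist (e (d n x)) x < 1 / real (Suc n)" if "x \<in> X" for n x
  proof -
    have "\<exists>k. dist (e k) x < 1 / real (Suc n)"
      unfolding e_def using dense[OF that] from_nat_into_surj[OF D(1)] by metis
    then show ?thesis unfolding d_def by (rule LeastI_ex)
  qed
  have [measurable]: "dist (e k) \<in> borel_measurable (arms X)" for k
    by (intro measurable_restrict_space1 borel_measurable_continuous_onI continuous_intros)
  have "Measurable.pred (arms X) (\<lambda>x. dist (e k) x < 1 / real (Suc n))" for n k
    by (rule borel_measurable_pred_less) auto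
  then have dm[measurable]: "d n \<in> arms X \<rightarrow>\<^sub>M count_space UNIV" for n
    unfolding d_def by (rule measurable_Least)
  let ?M = "restrict_space P S \<Otimes>\<^sub>M arms X"
  have ev: "(\<lambda>f. f (e k)) \<in> borel_measurable (restrict_space P S)" for k
    using measurable_payoff_eval[OF e] assms(3)
    by (intro measurable_restrict_space1) (subst measurable_cong_sets[OF assms(3) refl])
  have "(\<lambda>p. (fst p) (snd p)) \<in> borel_measurable ?M"
  proof (rule borel_measurable_LIMSEQ_real)
    show "(\<lambda>p. (fst p) (e (d n (snd p)))) \<in> borel_measurable ?M" for n
      by (rule measurable_compose_countable[where f="\<lambda>k p. (fst p) (e k)"])
        (auto intro: measurable_compose[OF measurable_fst ev])
    fix p assume "p \<in> space ?M"
    then have p: "1-lipschitz_on X (fst p)" "snd p \<in> X"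
      by (auto simp: space_pair_measure space_restrict_space S_def)
    show "(\<lambda>n. (fst p) (e (d n (snd p)))) \<longlonglongrightarrow> (fst p) (snd p)"
    proof (rule tendsto_dist_iff[THEN iffD2], rule tendsto_sandwich[OF _ _ tendsto_const])
      show "(\<lambda>n. 1 / real (Suc n)) \<longlonglongrightarrow> 0"
        using LIMSEQ_inverse_real_of_nat by (simp add: inverse_eq_divide)
      have "dist ((fst p) (e (d n (snd p)))) ((fst p) (snd p)) \<le> 1 / real (Suc n)" for n
        using lipschitz_onD[OF p(1) e[of "d n (snd p)"] p(2)] d[OF p(2), of n] by simp
      then show "\<forall>\<^sub>F n in sequentially.
          dist ((fst p) (e (d n (snd p)))) ((fst p) (snd p)) \<le> 1 / real (Suc n)"
        by simp
    qed simp
  qed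
  then show ?thesis
    unfolding measurable_evaluation_def using S S1
    by (intro bexI[of _ S]) (auto simp: case_prod_beta')
qed

lemma uniformly_lipschitz_AE:
  assumes "prob_space P" "sets P = sets (payoff_borel X)" "AE f in P. 1-lipschitz_on X f"
  shows "uniformly_lipschitz X P"
proof -
  define U where "U = topspace (payoff_topology X) - {f \<in> topspace (payoff_topology X). 1-lipschitz_on X f}"
  have U: "openin (payoff_topology X) U"
    unfolding U_def using closedin_lipschitz by blast
  have "emeasure P U = 0"
  proof (subst AE_iff_measurable[symmetric, where P="\<lambda>f. 1-lipschitz_on X f"])
    show "U \<in> sets P" using openin_payoff_borel[OF U] assms(2) by simp
    show "{f \<in> space P. \<not> 1-lipschitz_on X f} = U"
      using sets_eq_imp_space_eq[OF assms(2)]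
      by (auto simp: U_def space_payoff_borel payoff_topology_def)
  qed fact
  then show ?thesis
    using U unfolding uniformly_lipschitz_def payoff_support_def
    by (auto simp: U_def simp del: topspace_product_topology)
qed

end

theory Submission
  imports Defs "HOL-Library.Bourbaki_Witt_Fixpoint" "HOL-Real_Asymp.Real_Asymp"
begin

text \<open>
  If \<open>X\<close> is countable, removing isolated points transfinitely often gives a total order on \<open>X\<close> for
  which the mean payoff has a last maximizer \<open>x\<close>, and compactness separates \<open>\<mu> x\<close> from the values of \<open>\<mu>\<close>
  at all points after \<open>x\<close>. Hence the last point of a finite sample of arms whose estimated mean is nearly
  maximal is exactly \<open>x\<close>, up to an exponentially small error probability. With double feedback the
  exploration is free and the error probabilities are summable. In the bandit problem one explores at
  the start of the epochs \<open>[2 ^ 2 ^ j, 2 ^ 2 ^ (j + 1))\<close>, with slightly more than logarithmically many rounds.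

  If \<open>X\<close> is uncountable, condensation points yield Lipschitz functions \<open>h k\<close> with values in \<open>[- r k, r k]\<close>
  such that every pattern of signs is attained by some point with \<open>h k = \<plusminus> r k\<close> for all \<open>k\<close>. The
  payoff functions are \<open>1/2 \<plusminus> h K\<close> for a random level \<open>K\<close>, and at level \<open>k\<close> the sign has a bias of order
  \<open>1 / sqrt (T k)\<close>, which \<open>T k\<close> rounds do not reveal. Choosing the favoured signs
  recursively against the algorithm forces regret of order \<open>sqrt (T k)\<close> at time \<open>T k\<close> for all \<open>k\<close>, up to a factor
  that depends only on \<open>k\<close>; and \<open>T\<close> may be chosen as sparse as one likes.
\<close>


subsection \<open>The topology of compact metric spaces\<close>

text \<open>In the definition of tractability the constant may depend on the instance. Hence in the
  hard case one single instance has to be bad at infinitely many time scales: all levels sit in the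
  same mean payoff, and an arm with the favoured sign at all levels at once is the optimum. Making
  the level random, instead of adding the \<open>h k\<close> up, keeps every single payoff function
  1-Lipschitz with values in \<open>{0..1}\<close> and leaves full feedback nothing to see but a
  level and a sign. The biases decrease, so up to time \<open>T k\<close> the levels from
  \<open>k\<close> on are together no more visible than level \<open>k\<close> alone; this is why
  the signs can be decided one level after the other, even though an algorithm meets all levels from
  the start.

  In the easy case it is not enough to play nearly optimal arms: gaps may be arbitrarily small and
  their losses would add up. Playing exactly one fixed maximizer reduces the regret to a sum of
  error probabilities, plus the cost of exploration in the bandit problem.\<close>

lemma compact_condensation_point:
  fixes C :: "'a::metric_space set"
  assumes C: "compact C" "uncountable C" and "finite F"
  obtains p where "p \<in> C" "p \<notin> F" "\<And>e. e > 0 \<Longrightarrow> uncountable (C \<inter> cball p e)"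
proof -
  \<comment> \<open>The sets \<open>D n\<close> cover the part of \<open>C\<close> outside
    \<open>F\<close>, so one of them is uncountable. Each is compact, which \<open>C - F\<close>
    need not be; this gives the finite subcover below, and a point of \<open>D n\<close>
    automatically avoids \<open>F\<close>.\<close>
  define D where "D n = {x\<in>C. \<forall>p\<in>F. 1 / real (Suc n) \<le> dist p x}" for n
  have D_alt: "D n = C \<inter> (\<Inter>p\<in>F. {x. 1 / real (Suc n) \<le> dist p x})" for n
    by (auto simp: D_def)
  have "closed (\<Inter>p\<in>F. {x. 1 / real (Suc n) \<le> dist p x})" for n
    by (intro closed_INT ballI closed_Collect_le continuous_intros)
  then have D: "compact (D n)" for n
    unfolding D_alt using C(1) by blast
  have "C \<subseteq> F \<union> (\<Union>n. D n)"
  proof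
    fix x assume x: "x \<in> C"
    show "x \<in> F \<union> (\<Union>n. D n)"
    proof (cases "x \<in> F")
      case False
      have "\<forall>\<^sub>F n in sequentially. \<forall>p\<in>F. 1 / real (Suc n) \<le> dist p x"
        unfolding eventually_ball_finite_distrib[OF \<open>finite F\<close>]
      proof
        fix p assume "p \<in> F"
        then have "dist p x > 0" using False by auto
        with lim_1_over_n[where 'a=real] LIMSEQ_Suc
        have "\<forall>\<^sub>F n in sequentially. 1 / real (Suc n) < dist p x"
          by (fastforce intro: order_tendstoD)
        then show "\<forall>\<^sub>F n in sequentially. 1 / real (Suc n) \<le> dist p x"
          by eventually_elim simp
      qed
      then show ?thesis
        using x by (auto simp: D_def dest: eventually_happens)
    qed simp
  qed
  then have "uncountable (F \<union> (\<Union>n. D n))"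
    using C(2) countable_subset by blast
  then obtain n where n: "uncountable (D n)"
    using \<open>finite F\<close> by (auto simp: countable_finite)
  have "\<exists>p\<in>D n. \<forall>e>0. uncountable (D n \<inter> cball p e)"
  proof (rule ccontr)
    assume "\<not> ?thesis"
    then obtain e where e: "\<And>p. p \<in> D n \<Longrightarrow> e p > 0 \<and> countable (D n \<inter> cball p (e p))"
      by metis
    have "D n \<subseteq> (\<Union>p\<in>D n. ball p (e p))"
      using e by auto
    then obtain K where K: "K \<subseteq> D n" "finite K" "D n \<subseteq> (\<Union>p\<in>K. ball p (e p))"
      by (rule compactE_image[OF D[of n] open_ball])
    have "countable (\<Union>p\<in>K. D n \<inter> cball p (e p))"
    proof (rule countable_UN)
      show "countable K" using K(2) by (rule countable_finite)
      show "countable (D n \<inter> cball p (e p))" if "p \<in> K" for p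
        using e K(1) that by blast
    qed
    moreover have "D n \<subseteq> (\<Union>p\<in>K. D n \<inter> cball p (e p))"
      using K(3) by (force simp: subset_iff)
    ultimately show False
      using n countable_subset by blast
  qed
  then obtain p where p: "p \<in> D n" "\<And>e. e > 0 \<Longrightarrow> uncountable (D n \<inter> cball p e)"
    by blast
  show ?thesis
  proof (rule that)
    show "p \<in> C" using p(1) by (simp add: D_def)
    have "\<not> 1 / real (Suc n) \<le> dist p p" by simp
    then show "p \<notin> F" using p(1) unfolding D_def by blast
    have "D n \<inter> cball p e \<subseteq> C \<inter> cball p e" for e
      by (auto simp: D_def)
    then show "uncountable (C \<inter> cball p e)" if "e > 0" for e
      using p(2)[OF that] countable_subset[OF \<open>D n \<inter> cball p e \<subseteq> C \<inter> cball p e\<close>] by metis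
  qed
qed

text \<open>The sets \<open>C i\<close> may overlap or even coincide, so the points are chosen one
  after the other, each avoiding the finitely many earlier ones.\<close>

lemma distinct_condensation_points:
  fixes C :: "'i \<Rightarrow> 'a::metric_space set"
  assumes "finite I" "\<And>i. i \<in> I \<Longrightarrow> compact (C i) \<and> uncountable (C i)"
  shows "\<exists>g. inj_on g I \<and> (\<forall>i\<in>I. \<forall>e>0. uncountable (C i \<inter> cball (g i) e))"
  using assms
proof (induction I)
  case (insert i I)
  then obtain g where g: "inj_on g I" "\<forall>i\<in>I. \<forall>e>0. uncountable (C i \<inter> cball (g i) e)"
    by auto
  obtain p where p: "p \<notin> g ` I" "\<And>e. e > 0 \<Longrightarrow> uncountable (C i \<inter> cball p e)"
    using insert.prems insert.hyps compact_condensation_point[of "C i" "g ` I"]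
    by (metis finite_imageI insertI1)
  have "inj_on (g(i := p)) (insert i I)"
    using g(1) p(1) insert.hyps by (auto simp: inj_on_def)
  then show ?case
    using g p insert.hyps by (intro exI[of _ "g(i := p)"] conjI) (assumption, auto)
qed simp

text \<open>Each set receives two condensation points, one for \<open>A\<close> and one for
  \<open>B\<close>, all of them distinct. Balls whose radius is a third of the least distance
  between these points stay separated and meet the sets in uncountable parts. One pair has to serve
  all sets at once, so that the next sign is independent of all earlier ones.\<close>

lemma uncountable_split:
  fixes \<C> :: "'a::metric_space set set"
  assumes "finite \<C>" "\<And>C. C \<in> \<C> \<Longrightarrow> compact C \<and> uncountable C"
  shows "\<exists>A B \<eta>. closed A \<and> closed B \<and> \<eta> > (0::real) \<and> (\<forall>a\<in>A. \<forall>b\<in>B. \<eta> \<le> dist a b) \<and>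
    (\<forall>C\<in>\<C>. uncountable (C \<inter> A) \<and> uncountable (C \<inter> B))"
proof -
  let ?I = "\<C> \<times> (UNIV :: bool set)"
  obtain g where g: "inj_on g ?I" "\<And>i e. i \<in> ?I \<Longrightarrow> e > 0 \<Longrightarrow> uncountable (fst i \<inter> cball (g i) e)"
    proof -
    have "\<exists>g. inj_on g ?I \<and> (\<forall>i\<in>?I. \<forall>e>0. uncountable (fst i \<inter> cball (g i) e))"
      using assms by (intro distinct_condensation_points) auto
    then show ?thesis using that by blast
  qed
  \<comment> \<open>The entry 1 keeps \<open>D\<close> nonempty when \<open>\<C>\<close> is
    empty.\<close>
  define D where "D = insert 1 {dist (g i) (g j) |i j. i \<in> ?I \<and> j \<in> ?I \<and> i \<noteq> j}"
  have "finite {dist (g i) (g j) |i j. i \<in> ?I \<and> j \<in> ?I \<and> i \<noteq> j}"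
    by (rule finite_subset[of _ "(\<lambda>(i, j). dist (g i) (g j)) ` (?I \<times> ?I)"]) (use assms(1) in auto)
  then have "finite D"
    by (simp add: D_def)
  define d where "d = Min D"
  have "d > 0"
  proof -
    have "dist (g i) (g j) > 0" if "i \<in> ?I" "j \<in> ?I" "i \<noteq> j" for i j
      using inj_onD[OF g(1) _ that(1,2)] that(3) by auto
    then have "\<forall>u\<in>D. 0 < u"
      unfolding D_def using zero_less_one by blast
    moreover have "D \<noteq> {}" by (simp add: D_def)
    ultimately show ?thesis
      unfolding d_def using \<open>finite D\<close> by simp
  qed
  have d: "d \<le> dist (g i) (g j)" if "i \<in> ?I" "j \<in> ?I" "i \<noteq> j" for i j
    unfolding d_def by (rule Min_le[OF \<open>finite D\<close>]) (use that in \<open>unfold D_def, blast\<close>)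
  define A where "A b = (\<Union>C\<in>\<C>. cball (g (C, b)) (d / 3))" for b
  have "d / 3 \<le> dist x y" if "x \<in> A True" "y \<in> A False" for x y
  proof -
    from that obtain C C' where C: "C \<in> \<C>" "C' \<in> \<C>"
      "dist (g (C, True)) x \<le> d / 3" "dist (g (C', False)) y \<le> d / 3"
      by (auto simp: A_def)
    have "d \<le> dist (g (C, True)) (g (C', False))"
      using C by (intro d) auto
    also have "\<dots> \<le> dist (g (C, True)) x + dist x y + dist y (g (C', False))"
      by metric
    finally show ?thesis
      using C(3,4) by (simp add: dist_commute)
  qed
  moreover have "closed (A b)" for b
    unfolding A_def using assms(1) by auto
  moreover have "uncountable (C \<inter> A b)" if "C \<in> \<C>" for C b
    using g(2)[of "(C, b)" "d / 3"] that \<open>d > 0\<close> countable_subset[of "C \<inter> cball (g (C, b)) (d/3)" "C \<inter> A b"]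
    by (auto simp: A_def)
  ultimately show ?thesis
    using \<open>d > 0\<close> by (intro exI[of _ "A True"] exI[of _ "A False"] exI[of _ "d / 3"]) auto
qed

text \<open>The family \<open>\<C> k\<close> consists of all intersections of \<open>X\<close> with
  one member of each of the first \<open>k\<close> pairs. Splitting all of them by a common pair
  keeps them compact and uncountable. An infinite sign pattern then describes a decreasing sequence
  of nonempty compact sets, which has a common point.\<close>

lemma independent_closed_pairs:
  fixes X :: "'a::metric_space set"
  assumes "compact X" "uncountable X"
  obtains A B :: "nat \<Rightarrow> 'a set" and \<eta> :: "nat \<Rightarrow> real"
  where "\<And>k. \<eta> k > 0" "\<And>k a b. a \<in> A k \<Longrightarrow> b \<in> B k \<Longrightarrow> \<eta> k \<le> dist a b"
    "\<And>\<beta>. \<exists>x\<in>X. \<forall>k. x \<in> (if \<beta> k then A k else B k)"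
proof -
  define good where "good \<C> \<longleftrightarrow> finite \<C> \<and> (\<forall>C\<in>\<C>. compact C \<and> uncountable C)" for \<C> :: "'a set set"
  define step where "step = (\<lambda>(\<C> :: 'a set set) A B \<eta> \<D>. closed A \<and> closed B \<and> \<eta> > (0::real) \<and> (\<forall>a\<in>A. \<forall>b\<in>B. \<eta> \<le> dist a b) \<and>
      \<D> = (\<lambda>C. C \<inter> A) ` \<C> \<union> (\<lambda>C. C \<inter> B) ` \<C>)"
  have "\<exists>\<C>. (\<forall>k. good (\<C> k)) \<and> \<C> 0 = {X} \<and> (\<forall>k. \<exists>A B \<eta>. step (\<C> k) A B \<eta> (\<C> (Suc k)))"
  proof -
    have base: "\<exists>\<C>. good \<C> \<and> ((0::nat) = 0 \<longrightarrow> \<C> = {X})"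
      using assms by (intro exI[of _ "{X}"]) (simp add: good_def)
    have "\<exists>\<D>. (good \<D> \<and> (Suc k = 0 \<longrightarrow> \<D> = {X})) \<and> (\<exists>A B \<eta>. step \<C> A B \<eta> \<D>)"
      if \<C>: "good \<C> \<and> (k = 0 \<longrightarrow> \<C> = {X})" for \<C> k
    proof -
      obtain A B \<eta> where *: "closed A" "closed B" "\<eta> > (0::real)" "\<forall>a\<in>A. \<forall>b\<in>B. \<eta> \<le> dist a b"
        "\<forall>C\<in>\<C>. uncountable (C \<inter> A) \<and> uncountable (C \<inter> B)"
        proof -
        have "\<exists>A B \<eta>. closed A \<and> closed B \<and> \<eta> > (0::real) \<and> (\<forall>a\<in>A. \<forall>b\<in>B. \<eta> \<le> dist a b) \<and>
            (\<forall>C\<in>\<C>. uncountable (C \<inter> A) \<and> uncountable (C \<inter> B))"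
          using \<C> by (intro uncountable_split) (auto simp: good_def)
        then show thesis using that by (elim exE conjE)
      qed
      have "good ((\<lambda>C. C \<inter> A) ` \<C> \<union> (\<lambda>C. C \<inter> B) ` \<C>)"
        using \<C> * by (auto simp: good_def intro: compact_Int_closed)
      then show ?thesis
        using * by (auto simp: step_def)
    qed
    with base have "\<exists>\<C>. \<forall>k. (good (\<C> k) \<and> (k = 0 \<longrightarrow> \<C> k = {X})) \<and> (\<exists>A B \<eta>. step (\<C> k) A B \<eta> (\<C> (Suc k)))"
      by (rule dependent_nat_choice)
    then obtain \<C> where "\<forall>k. (good (\<C> k) \<and> (k = 0 \<longrightarrow> \<C> k = {X})) \<and> (\<exists>A B \<eta>. step (\<C> k) A B \<eta> (\<C> (Suc k)))"
      by (elim exE)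
    then show ?thesis by (intro exI[of _ \<C>]) simp
  qed
  then obtain \<C> where \<C>: "\<And>k. good (\<C> k)" "\<C> 0 = {X}" "\<And>k. \<exists>A B \<eta>. step (\<C> k) A B \<eta> (\<C> (Suc k))"
    by (elim exE conjE) (rule that; elim allE; assumption)
  from \<C>(3) obtain A B \<eta> where st: "\<And>k. step (\<C> k) (A k) (B k) (\<eta> k) (\<C> (Suc k))"
    by metis
  show ?thesis
  proof (rule that)
    show "\<eta> k > 0" "a \<in> A k \<Longrightarrow> b \<in> B k \<Longrightarrow> \<eta> k \<le> dist a b" for k a b
      using st[of k] by (auto simp: step_def)
    show "\<exists>x\<in>X. \<forall>k. x \<in> (if \<beta> k then A k else B k)" for \<beta>
    proof -
      define S where "S = rec_nat X (\<lambda>k C. C \<inter> (if \<beta> k then A k else B k))"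
      have S_simps: "S 0 = X" "S (Suc k) = S k \<inter> (if \<beta> k then A k else B k)" for k
        by (auto simp: S_def)
      have S: "S k \<in> \<C> k" for k
      proof (induction k)
        case (Suc k)
        then show ?case using st[of k] by (auto simp: S_simps step_def)
      qed (simp add: S_simps \<C>)
      have compact: "compact (S n)" and ne: "S n \<noteq> {}" for n
        using S[of n] \<C>(1)[of n] by (auto simp: good_def)
      have mono: "S n \<subseteq> S m" if "m \<le> n" for m n
        using that by (induction rule: dec_induct) (auto simp: S_simps)
      have "X \<inter> \<Inter>(S ` UNIV) \<noteq> {}"
      proof (rule compact_imp_fip_image[OF assms(1)])
        show "closed (S n)" for n
          using compact by (rule compact_imp_closed)
        show "X \<inter> \<Inter>(S ` I) \<noteq> {}" if "finite I" for I
        proof -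
          have "S (Max (insert 0 I)) \<subseteq> X \<inter> \<Inter>(S ` I)"
            using mono[OF Max_ge[of "insert 0 I"]] that S_simps(1) by blast
          then show ?thesis using ne by blast
        qed
      qed
      then obtain x where x: "\<And>k. x \<in> S k" by auto
      show ?thesis
      proof (intro bexI[of _ x] allI)
        show "x \<in> X" using x[of 0] by (simp add: S_simps)
        show "x \<in> (if \<beta> k then A k else B k)" for k
          using x[of "Suc k"] by (auto simp: S_simps)
      qed
    qed
  qed
qed

section \<open>Lipschitz functions that realize every sign pattern\<close>

lemma abs_clip_diff_le:
  fixes u v r :: real shows "\<bar>max (- r) (min r u) - max (- r) (min r v)\<bar> \<le> \<bar>u - v\<bar>"
  by (auto simp: max_def min_def)

text \<open>Half the difference of the distances to \<open>B k\<close> and \<open>A k\<close> is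
  1-Lipschitz, at least \<open>\<eta> k / 2\<close> on \<open>A k\<close> and at most
  \<open>- \<eta> k / 2\<close> on \<open>B k\<close>. Clipping at
  \<open>r k \<le> \<eta> k / 2\<close> turns these bounds into the exact values \<open>r k\<close>
  and \<open>- r k\<close>. The cap \<open>1 / 2\<close> keeps the later payoffs
  \<open>1/2 + h k x\<close> and \<open>1/2 - h k x\<close> in the unit interval.\<close>

lemma uncountable_compact_lipschitz_coordinates:
  fixes X :: "'a::metric_space set"
  assumes "compact X" "uncountable X"
  obtains h :: "nat \<Rightarrow> 'a \<Rightarrow> real" and r :: "nat \<Rightarrow> real"
  where "\<And>k. 0 < r k" "\<And>k. r k \<le> 1 / 2" "\<And>k x. \<bar>h k x\<bar> \<le> r k" "\<And>k. 1-lipschitz_on UNIV (h k)"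
    "\<And>\<beta>. \<exists>x\<in>X. \<forall>k. h k x = (if \<beta> k then r k else - r k)"
proof -
  obtain A B :: "nat \<Rightarrow> 'a set" and \<eta> where *: "\<And>k. \<eta> k > 0" "\<And>k a b. a \<in> A k \<Longrightarrow> b \<in> B k \<Longrightarrow> \<eta> k \<le> dist a b"
    "\<And>\<beta>. \<exists>x\<in>X. \<forall>k. x \<in> (if \<beta> k then A k else B k)"
    by (rule independent_closed_pairs[OF assms]) (rule that)
  have ne: "A k \<noteq> {}" "B k \<noteq> {}" for k
    using *(3)[of "\<lambda>_. True"] *(3)[of "\<lambda>_. False"] by auto
  define r where "r k = min (1 / 2) (\<eta> k / 2)" for k
  define h where "h k x = max (- r k) (min (r k) ((infdist x (B k) - infdist x (A k)) / 2))" for k x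
  show ?thesis
  proof (rule that)
    show r: "0 < r k" "r k \<le> 1 / 2" for k
      using *(1) by (auto simp: r_def)
    show "\<bar>h k x\<bar> \<le> r k" for k x
      using r(1)[of k] by (auto simp: h_def)
    show "1-lipschitz_on UNIV (h k)" for k
    proof (rule lipschitz_onI)
      fix x y
      have "\<bar>(infdist x (B k) - infdist x (A k)) / 2 - (infdist y (B k) - infdist y (A k)) / 2\<bar> \<le> dist x y"
        using infdist_triangle_abs[of x "A k" y] infdist_triangle_abs[of x "B k" y]
        unfolding abs_le_iff by argo
      then show "dist (h k x) (h k y) \<le> 1 * dist x y"
        unfolding dist_real_def h_def by (intro order_trans[OF abs_clip_diff_le]) auto
    qed simp
    show "\<exists>x\<in>X. \<forall>k. h k x = (if \<beta> k then r k else - r k)" for \<beta>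
    proof -
      obtain x where x: "x \<in> X" "\<And>k. x \<in> (if \<beta> k then A k else B k)"
        using *(3)[of \<beta>] by auto
      have "h k x = (if \<beta> k then r k else - r k)" for k
      proof (cases "\<beta> k")
        case True
        then have "x \<in> A k" using x(2)[of k] by simp
        moreover from this have "\<eta> k \<le> infdist x (B k)"
          using *(2) ne unfolding infdist_notempty[OF ne(2)] by (intro cINF_greatest) auto
        ultimately show ?thesis
          using True r(1)[of k] by (auto simp: h_def r_def)
      next
        case False
        then have "x \<in> B k" using x(2)[of k] by simp
        moreover from this have "\<eta> k \<le> infdist x (A k)"
          using *(2) ne unfolding infdist_notempty[OF ne(1)] by (intro cINF_greatest) (auto simp: dist_commute)
        ultimately show ?thesis
          using False r(1)[of k] by (auto simp: h_def r_def)
      qed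
      then show ?thesis using x(1) by blast
    qed
  qed
qed

section \<open>The removal order of a countable compact space and its last maximizers\<close>

text \<open>A nonempty compact set that equals its derived set is perfect and therefore at least as
  large as the reals. Closedness of \<open>C - {p}\<close> expresses that \<open>p\<close> is
  isolated, in the form in which the removal process keeps the remaining set compact.\<close>

lemma countable_compact_isolated_point:
  fixes C :: "'a::metric_space set"
  assumes "compact C" "countable C" "C \<noteq> {}"
  shows "\<exists>p\<in>C. closed (C - {p})"
proof -
  let ?T = "top_of_set C"
  have "\<not> ?T derived_set_of C = C"
  proof
    assume "?T derived_set_of C = C"
    moreover have "locally_compact_space ?T \<and> Hausdorff_space ?T"
      using assms(1) by (auto intro!: compact_imp_locally_compact_space simp: Hausdorff_space_subtopology compact_space_subtopology)
    ultimately have "(UNIV :: real set) \<lesssim> C"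
      using lepoll_perfect_set[of ?T C] assms(3) by blast
    then show False
      using assms(2) countable_lepoll uncountable_UNIV_real by blast
  qed
  moreover have "?T derived_set_of C \<subseteq> C"
    using derived_set_of_subset_topspace[of ?T] by auto
  ultimately obtain p where p: "p \<in> C" "p \<notin> ?T derived_set_of C"
    by blast
  then obtain U where U: "openin ?T U" "p \<in> U" "\<And>y. y \<in> C \<Longrightarrow> y \<in> U \<Longrightarrow> y = p"
    unfolding in_derived_set_of by auto
  then have "U = {p}"
    using openin_subset[OF U(1)] by auto
  then have "closedin ?T (C - {p})"
    using U(1) by auto
  then show ?thesis
    using p(1) closedin_compact[OF assms(1)] compact_imp_closed by blast
qed

text \<open>
  The order arises by removing isolated points one after the other, transfinitely often: \<open>lt x y\<close>
  means that \<open>x\<close> is removed before \<open>y\<close>. The sets removed by some stage are open in \<open>X\<close>, so by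
  compactness every nonempty compact set has a point that is removed last.
\<close>

lemma countable_compact_order:
  fixes X :: "'a::metric_space set"
  assumes "compact X" "countable X"
  obtains lt :: "'a \<Rightarrow> 'a \<Rightarrow> bool"
  where "\<And>x y. lt x y \<Longrightarrow> \<not> lt y x"
    "\<And>x y. x \<in> X \<Longrightarrow> y \<in> X \<Longrightarrow> x \<noteq> y \<Longrightarrow> lt x y \<or> lt y x"
    "\<And>S. compact S \<Longrightarrow> S \<noteq> {} \<Longrightarrow> S \<subseteq> X \<Longrightarrow> \<exists>x\<in>S. (\<forall>y\<in>S. \<not> lt x y) \<and> compact {y\<in>X. lt x y}"
proof -
  define p where "p C = (SOME p. p \<in> C \<and> closed (C - {p}))" for C :: "'a set"
  have p: "p C \<in> C" "closed (C - {p C})" if "compact C" "C \<subseteq> X" "C \<noteq> {}" for C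
  proof -
    have "\<exists>p. p \<in> C \<and> closed (C - {p})"
      using countable_compact_isolated_point[OF that(1) countable_subset[OF that(2) assms(2)] that(3)] by blast
    from someI_ex[OF this] show "p C \<in> C" "closed (C - {p C})"
      by (simp_all add: p_def)
  qed
  define f where "f U = (if X \<subseteq> U then U else insert (p (X - U)) U)" for U :: "'a set"
  \<comment> \<open>The iterates of \<open>f\<close> above the empty set, closed under unions of
    chains, take the place of a recursion over ordinals: \<open>\<T>\<close> is the chain of all
    sets of points removed by some stage.\<close>
  interpret bourbaki_witt_fixpoint Sup "{(x, y). x \<subseteq> y}" f
    by (rule bourbaki_witt_fixpoint_complete_latticeI) (auto simp: f_def)
  have Field: "{} \<in> Field {(x, y). x \<subseteq> (y :: 'a set)}"
    by (auto simp: Field_def)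
  define \<T> where "\<T> = iterates_above {}"
  have chain: "U \<subseteq> V \<or> V \<subseteq> U" if "U \<in> \<T>" "V \<in> \<T>" for U V
    using chain_iterates_above[OF Field] that unfolding \<T>_def Chains_def by auto
  have Union: "\<Union>\<M> \<in> \<T>" if "\<M> \<subseteq> \<T>" for \<M>
  proof (cases "\<M> = {}")
    case True
    then show ?thesis using base by (simp add: \<T>_def)
  next
    case False
    then show ?thesis
      using that chain unfolding \<T>_def by (intro Sup) (auto simp: Chains_def)
  qed
  have step: "f U \<in> \<T>" if "U \<in> \<T>" for U
    using that unfolding \<T>_def by (rule step)
  have closed: "closed (X - U)" if "U \<in> \<T>" for U
    using that unfolding \<T>_def
  proof (induction rule: iterates_above.induct)
    case base
    then show ?case using assms(1) by (simp add: compact_imp_closed)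
  next
    case (step U)
    show ?case
    proof (cases "X \<subseteq> U")
      case False
      then have "closed (X - U - {p (X - U)})"
        using compact_Int_closed[OF assms(1) step.IH] by (intro p(2)) (auto simp: Int_absorb1)
      moreover have "X - f U = X - U - {p (X - U)}"
        using False by (auto simp: f_def)
      ultimately show ?thesis by simp
    qed (use step in \<open>simp add: f_def\<close>)
  next
    case (Sup M)
    have "X - \<Union>M = (\<Inter>U\<in>M. X - U)"
      using Sup.hyps(2) by auto
    moreover have "closed (\<Inter>U\<in>M. X - U)"
      using Sup.IH by (intro closed_INT) auto
    ultimately show ?case by simp
  qed
  have compact: "compact (X - U)" if "U \<in> \<T>" for U
    using closed[OF that] assms(1) by (metis Diff_subset Int_absorb1 compact_Int_closed)
  \<comment> \<open>\<open>W S\<close> is the union of all stages that do not yet contain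
    \<open>S\<close>. By compactness it does not contain \<open>S\<close> either, so it is the last
    such stage; the next stage contains \<open>S\<close> and has only one more point, which is the
    point of \<open>S\<close> that is removed last.\<close>
  define W where "W S = \<Union>{U\<in>\<T>. \<not> S \<subseteq> U}" for S
  have WT: "W S \<in> \<T>" for S
    unfolding W_def by (rule Union) auto
  have W: "\<exists>x\<in>S. S - W S = {x} \<and> f (W S) = insert x (W S)" if "compact S" "S \<noteq> {}" "S \<subseteq> X" for S
  proof -
    have nW: "\<not> S \<subseteq> W S"
    proof
      assume sub: "S \<subseteq> W S"
      define \<U> where "\<U> = {U\<in>\<T>. \<not> S \<subseteq> U}"
      have "\<exists>\<F>\<subseteq>\<U>. finite \<F> \<and> S \<inter> \<Inter>((\<lambda>U. X - U) ` \<F>) = {}"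
      proof (rule ccontr)
        assume neg: "\<not> ?thesis"
        have "S \<inter> \<Inter>((\<lambda>U. X - U) ` \<U>) \<noteq> {}"
        proof (rule compact_imp_fip_image[OF that(1)])
          show "closed (X - U)" if "U \<in> \<U>" for U using that closed by (auto simp: \<U>_def)
          show "S \<inter> \<Inter>((\<lambda>U. X - U) ` \<F>) \<noteq> {}" if "finite \<F>" "\<F> \<subseteq> \<U>" for \<F>
            using neg that by blast
        qed
        then obtain x where "x \<in> S" "\<forall>U\<in>\<U>. x \<notin> U" by blast
        then show False using sub by (auto simp: W_def \<U>_def)
      qed
      then obtain \<F> where \<F>: "\<F> \<subseteq> \<U>" "finite \<F>" "S \<inter> \<Inter>((\<lambda>U. X - U) ` \<F>) = {}" by blast
      have "\<exists>V\<in>\<F>. \<forall>U\<in>\<F>. U \<subseteq> V"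
      proof -
        have "\<F> \<noteq> {}" using \<F>(3) that(2) by auto
        then obtain V where "V \<in> \<F>" "\<forall>U\<in>\<F>. V \<subseteq> U \<longrightarrow> V = U"
          using finite_has_maximal[OF \<F>(2)] by blast
        moreover have "U \<subseteq> V \<or> V \<subseteq> U" if "U \<in> \<F>" "V \<in> \<F>" for U V
          using chain \<F>(1) that by (auto simp: \<U>_def)
        ultimately show ?thesis by blast
      qed
      then obtain V where "V \<in> \<F>" "\<Union>\<F> \<subseteq> V" by blast
      moreover have "S \<subseteq> \<Union>\<F>" using \<F>(3) that(3) by blast
      ultimately have "S \<subseteq> V" "V \<in> \<U>" using \<F>(1) by auto
      then show False by (simp add: \<U>_def)
    qed
    then have "\<not> X \<subseteq> W S" using that(3) by blast
    let ?x = "p (X - W S)"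
    have f: "f (W S) = insert ?x (W S)" using \<open>\<not> X \<subseteq> W S\<close> by (simp add: f_def)
    have x: "?x \<notin> W S" using p(1)[OF compact[OF WT]] \<open>\<not> X \<subseteq> W S\<close> by blast
    have "S \<subseteq> f (W S)"
    proof (rule ccontr)
      assume "\<not> S \<subseteq> f (W S)"
      then have "f (W S) \<subseteq> W S" using step[OF WT] by (auto simp: W_def)
      then show False using f x by auto
    qed
    then have "S - W S = {?x}" using f nW by auto
    then show ?thesis using f by blast
  qed
  define lt where "lt x y \<longleftrightarrow> (\<exists>U\<in>\<T>. x \<in> U \<and> y \<notin> U)" for x y
  show ?thesis
  proof (rule that)
    show "\<not> lt y x" if "lt x y" for x y
      using that chain unfolding lt_def by blast
    show "lt x y \<or> lt y x" if "x \<in> X" "y \<in> X" "x \<noteq> y" for x y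
    proof -
      have "f (W {x}) = insert x (W {x})" "x \<notin> W {x}" using W[of "{x}"] that by auto
      then show ?thesis using step[OF WT, of "{x}"] WT[of "{x}"] that(3)
        unfolding lt_def by (metis insert_iff)
    qed
    show "\<exists>x\<in>S. (\<forall>y\<in>S. \<not> lt x y) \<and> compact {y\<in>X. lt x y}" if S: "compact S" "S \<noteq> {}" "S \<subseteq> X" for S
    proof -
      obtain x where x: "x \<in> S" "S - W S = {x}" "f (W S) = insert x (W S)"
        using W[OF S] by blast
      \<comment> \<open>A stage containing \<open>x\<close> cannot lie inside \<open>W S\<close>, so
        it contains \<open>W S\<close> and hence \<open>f (W S)\<close>. The points after
        \<open>x\<close> are thus the complement of a single stage, which is compact.\<close>
      have lt_x: "lt x y \<longleftrightarrow> y \<notin> f (W S)" if "y \<in> X" for y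
      proof
        assume "lt x y"
        then obtain U where U: "U \<in> \<T>" "x \<in> U" "y \<notin> U" by (auto simp: lt_def)
        have "W S \<subseteq> U" using chain[OF U(1) WT, of S] U(2) x(2) by blast
        then show "y \<notin> f (W S)" using U x(3) by auto
      next
        assume "y \<notin> f (W S)"
        then show "lt x y" unfolding lt_def using x(3) step[OF WT] by blast
      qed
      then have "{y\<in>X. lt x y} = X - f (W S)" by auto
      then have "compact {y\<in>X. lt x y}" using compact[OF step[OF WT]] by simp
      moreover have "\<forall>y\<in>S. \<not> lt x y" using lt_x x S(3) by blast
      ultimately show ?thesis using x(1) by blast
    qed
  qed
qed

text \<open>The maximizers form a compact set, so one of them is last. The points after it are again
  compact and contain no maximizer; the maximum of \<open>\<mu>\<close> over them is attained and
  hence strictly smaller, which yields a positive gap. No such gap exists in general for the points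
  before \<open>x\<close>.\<close>

lemma order_maximal_maximizer:
  fixes X :: "'a::metric_space set" and \<mu> :: "'a \<Rightarrow> real" and lt :: "'a \<Rightarrow> 'a \<Rightarrow> bool"
  assumes "compact X" "X \<noteq> {}" "continuous_on X \<mu>"
    and "\<And>S. compact S \<Longrightarrow> S \<noteq> {} \<Longrightarrow> S \<subseteq> X \<Longrightarrow> \<exists>x\<in>S. (\<forall>y\<in>S. \<not> lt x y) \<and> compact {y\<in>X. lt x y}"
  obtains x \<delta> where "x \<in> X" "\<delta> > 0" "\<And>y. y \<in> X \<Longrightarrow> \<mu> y \<le> \<mu> x"
    "\<And>y. y \<in> X \<Longrightarrow> lt x y \<Longrightarrow> \<mu> y \<le> \<mu> x - \<delta>"
proof -
  obtain z where z: "z \<in> X" "\<And>y. y \<in> X \<Longrightarrow> \<mu> y \<le> \<mu> z"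
    using continuous_attains_sup[OF assms(1-3)] by blast
  define S where "S = {y\<in>X. \<mu> y = \<mu> z}"
  have "S = X \<inter> \<mu> -` {\<mu> z}" by (auto simp: S_def)
  then have "compact S"
    using continuous_closedin_preimage[OF assms(3), of "{\<mu> z}"] closedin_compact[OF assms(1)] by auto
  then obtain x where x: "x \<in> S" "\<forall>y\<in>S. \<not> lt x y" "compact {y\<in>X. lt x y}"
    using assms(4)[of S] z(1) by (auto simp: S_def)
  have xX: "x \<in> X" "\<mu> x = \<mu> z" using x(1) by (auto simp: S_def)
  show ?thesis
  proof (cases "{y\<in>X. lt x y} = {}")
    case True
    show ?thesis
      by (rule that[of x 1]) (use True xX z in auto)
  next
    case False
    obtain w where w: "w \<in> X" "lt x w" "\<And>y. y \<in> X \<Longrightarrow> lt x y \<Longrightarrow> \<mu> y \<le> \<mu> w"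
      using continuous_attains_sup[OF x(3) False continuous_on_subset[OF assms(3)]] by auto
    have "\<mu> w < \<mu> z" using w x(2) z(2)[of w] by (force simp: S_def)
    show ?thesis
      by (rule that[of x "\<mu> z - \<mu> w"]) (use \<open>\<mu> w < \<mu> z\<close> xX z w in auto)
  qed
qed


subsection \<open>Bandit runs on a sequence of payoff functions\<close>

text \<open>\<open>\<kappa> t\<close> is the hidden outcome of round \<open>t\<close>, which
  \<open>F\<close> decodes into a payoff function. The outcome is the payoff function itself in the
  upper bound and a pair of level and sign in the lower bound.\<close>

primrec mab_run :: "(nat \<Rightarrow> real \<Rightarrow> (nat \<Rightarrow> real) \<Rightarrow> 'a) \<Rightarrow> ('z \<Rightarrow> 'a \<Rightarrow> real) \<Rightarrow>
    real \<Rightarrow> (nat \<Rightarrow> 'z) \<Rightarrow> nat \<Rightarrow> nat \<Rightarrow> real" where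
  "mab_run a F \<omega> \<kappa> 0 = (\<lambda>_. undefined)"
| "mab_run a F \<omega> \<kappa> (Suc t) =
     (mab_run a F \<omega> \<kappa> t)(t := F (\<kappa> t) (a t \<omega> (mab_run a F \<omega> \<kappa> t)))"

lemma mab_run_cong:
  "(\<And>s. s < t \<Longrightarrow> \<kappa> s = \<kappa>' s) \<Longrightarrow> mab_run a F \<omega> \<kappa> t = mab_run a F \<omega> \<kappa>' t"
  by (induction t) auto

text \<open>\<open>mab_regret\<close> feeds the rule with restrictions of the final history. These
  are literally the earlier histories, because a run holds \<open>undefined\<close> at the rounds
  not yet played.\<close>

lemma restrict_mab_run:
  assumes "s \<le> t" shows "restrict (mab_run a F \<omega> \<kappa> t) {..<s} = mab_run a F \<omega> \<kappa> s"
proof -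
  have ext: "mab_run a F \<omega> \<kappa> s i = undefined" if "\<not> i < s" for i
    using that by (induction s) auto
  have "mab_run a F \<omega> \<kappa> t i = mab_run a F \<omega> \<kappa> s i" if "i < s" for i
    using assms that by (induction t rule: dec_induct) auto
  then show ?thesis
    using ext by (auto simp: fun_eq_iff restrict_def)
qed

lemma measurable_PiM_insert_fun_upd:
  assumes f: "f \<in> N \<rightarrow>\<^sub>M PiM I (\<lambda>_. L)" and g: "g \<in> N \<rightarrow>\<^sub>M L"
  shows "(\<lambda>x. (f x)(t := g x)) \<in> N \<rightarrow>\<^sub>M PiM (insert t I) (\<lambda>_. L)"
proof (rule measurable_PiM_single')
  fix i assume "i \<in> insert t I"
  then show "(\<lambda>x. ((f x)(t := g x)) i) \<in> N \<rightarrow>\<^sub>M L"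
    using g measurable_compose[OF f measurable_component_singleton[of i]]
    by (cases "i = t") auto
next
  show "(\<lambda>x. (f x)(t := g x)) \<in> space N \<rightarrow> (insert t I \<rightarrow>\<^sub>E space L)"
  proof (rule funcsetI)
    fix x assume "x \<in> space N"
    then have "f x \<in> I \<rightarrow>\<^sub>E space L" "g x \<in> space L"
      using measurable_space[OF f, of x] measurable_space[OF g, of x] by (auto simp: space_PiM)
    then show "(f x)(t := g x) \<in> insert t I \<rightarrow>\<^sub>E space L"
      by (rule PiE_fun_upd[rotated])
  qed
qed

lemma measurable_PiM_fun_upd:
  assumes "f \<in> N \<rightarrow>\<^sub>M PiM {..<t} (\<lambda>_. L)" "g \<in> N \<rightarrow>\<^sub>M L"
  shows "(\<lambda>x. (f x)(t := g x)) \<in> N \<rightarrow>\<^sub>M PiM {..<Suc t} (\<lambda>_. L)"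
  unfolding lessThan_Suc using assms by (rule measurable_PiM_insert_fun_upd)

lemma measurable_PiM_UNIV_fun_upd:
  assumes "f \<in> N \<rightarrow>\<^sub>M PiM UNIV (\<lambda>_. L)" "g \<in> N \<rightarrow>\<^sub>M L"
  shows "(\<lambda>x. (f x)(t := g x)) \<in> N \<rightarrow>\<^sub>M PiM UNIV (\<lambda>_. L)"
  using measurable_PiM_insert_fun_upd[OF assms, of t] by simp

text \<open>
  A bandit run is the deterministic evaluation of the algorithm on an i.i.d. sequence of random payoff
  functions whose one-point marginals are the reward distributions.
\<close>

locale mab_tape = N: prob_space N
  for X :: "'a::metric_space set" and Q :: "real measure" and a and N :: "'z measure" and F :: "'z \<Rightarrow> 'a \<Rightarrow> real" +
  assumes algorithm: "mab_algorithm X Q a"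
    and F: "(\<lambda>(z, x). F z x) \<in> borel_measurable (N \<Otimes>\<^sub>M arms X)"
begin

abbreviation "tape \<equiv> Q \<Otimes>\<^sub>M (\<Pi>\<^sub>M t\<in>(UNIV :: nat set). N)"
abbreviation "pick s \<omega> \<kappa> \<equiv> a s \<omega> (mab_run a F \<omega> \<kappa> s)"

sublocale Q: prob_space Q
  using algorithm by (simp add: mab_algorithm_def seed_law_def)

sublocale seq: prob_space "\<Pi>\<^sub>M t\<in>(UNIV :: nat set). N"
  by (rule prob_space_PiM) (rule N.prob_space_axioms)

sublocale pair: pair_prob_space Q "\<Pi>\<^sub>M t\<in>(UNIV :: nat set). N" ..

lemma measurable_a: "(\<lambda>(\<omega>, r). a t \<omega> r) \<in> Q \<Otimes>\<^sub>M (\<Pi>\<^sub>M s\<in>{..<t}. borel) \<rightarrow>\<^sub>M arms X"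
  using algorithm by (simp add: mab_algorithm_def)

lemma measurable_run:
  "(\<lambda>p. (fst p, mab_run a F (fst p) (snd p) t)) \<in> tape \<rightarrow>\<^sub>M Q \<Otimes>\<^sub>M (\<Pi>\<^sub>M s\<in>{..<t}. borel)"
proof (induction t)
  case (Suc t)
  have a: "(\<lambda>p. pick t (fst p) (snd p)) \<in> tape \<rightarrow>\<^sub>M arms X"
    using measurable_compose[OF Suc measurable_a] by simp
  have "(\<lambda>p. (snd p t, pick t (fst p) (snd p))) \<in> tape \<rightarrow>\<^sub>M N \<Otimes>\<^sub>M arms X"
    by (intro measurable_Pair a measurable_compose[OF measurable_snd measurable_component_singleton]) simp
  from measurable_compose[OF this F]
  have "(\<lambda>p. F (snd p t) (pick t (fst p) (snd p))) \<in> borel_measurable tape"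
    by simp
  moreover have "(\<lambda>p. mab_run a F (fst p) (snd p) t) \<in> tape \<rightarrow>\<^sub>M (\<Pi>\<^sub>M s\<in>{..<t}. borel)"
    using measurable_compose[OF Suc measurable_snd] by simp
  ultimately show ?case
    unfolding mab_run.simps by (intro measurable_Pair measurable_PiM_fun_upd measurable_fst)
qed (auto intro!: measurable_Pair measurable_PiM_single' simp: PiE_iff extensional_def)

lemma measurable_pick: "(\<lambda>p. pick t (fst p) (snd p)) \<in> tape \<rightarrow>\<^sub>M arms X"
  using measurable_compose[OF measurable_run measurable_a] by simp

text \<open>Trades a fresh draw for the coordinate that is already on the tape.\<close>

lemma PiM_resample:
  "distr (N \<Otimes>\<^sub>M (\<Pi>\<^sub>M t\<in>(UNIV :: nat set). N)) (\<Pi>\<^sub>M t\<in>UNIV. N) (\<lambda>(z, \<kappa>). \<kappa>(t := z)) = (\<Pi>\<^sub>M t\<in>UNIV. N)"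
  using distr_pair_PiM_eq_PiM[of UNIV "\<lambda>_. N" t] N.prob_space_axioms by simp

text \<open>\<open>mab_law\<close> draws a reward once the arm is known, the tape draws all outcomes
  in advance. Both agree because the run up to round \<open>t\<close> does not read coordinate
  \<open>t\<close>, which may therefore be redrawn without changing the law. Only the one-point
  marginals of the payoff functions matter.\<close>

lemma mab_law_eq:
  assumes \<nu>: "\<nu> \<in> arms X \<rightarrow>\<^sub>M prob_algebra borel" "\<And>x. x \<in> X \<Longrightarrow> \<nu> x = distr N borel (\<lambda>z. F z x)"
  shows "mab_law Q a \<nu> t = distr tape (Q \<Otimes>\<^sub>M (\<Pi>\<^sub>M s\<in>{..<t}. borel))
    (\<lambda>p. (fst p, mab_run a F (fst p) (snd p) t))"
proof (induction t)
  case 0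
  have "(\<lambda>\<omega>. (\<omega>, \<lambda>_. undefined)) \<in> Q \<rightarrow>\<^sub>M Q \<Otimes>\<^sub>M (\<Pi>\<^sub>M s\<in>{..<0::nat}. (borel :: real measure))"
    by (rule measurable_Pair[OF measurable_ident measurable_const, unfolded id_def]) (simp add: space_PiM)
  then have "distr (distr tape Q fst) (Q \<Otimes>\<^sub>M (\<Pi>\<^sub>M s\<in>{..<0::nat}. (borel :: real measure))) (\<lambda>\<omega>. (\<omega>, \<lambda>_. undefined)) =
      distr tape (Q \<Otimes>\<^sub>M (\<Pi>\<^sub>M s\<in>{..<0}. borel)) (\<lambda>p. (fst p, \<lambda>_. undefined))"
    by (subst distr_distr) (auto simp: comp_def)
  moreover have "distr tape Q fst = Q"
    by (rule seq.distr_pair_fst)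
  ultimately show ?case by simp
next
  case (Suc t)
  let ?K = "\<lambda>t::nat. Q \<Otimes>\<^sub>M (\<Pi>\<^sub>M s\<in>{..<t}. (borel :: real measure))"
  let ?R = "\<lambda>t p. (fst p, mab_run a F (fst p) (snd p) t)"
  let ?k = "\<lambda>(\<omega>, r). distr (\<nu> (a t \<omega> r)) (?K (Suc t)) (\<lambda>y. (\<omega>, r(t := y)))"
  have k: "?k \<in> ?K t \<rightarrow>\<^sub>M subprob_algebra (?K (Suc t))"
  proof -
    have "(\<lambda>p. distr (\<nu> (a t (fst p) (snd p))) (?K (Suc t)) (\<lambda>y. (fst p, (snd p)(t := y)))) \<in> ?K t \<rightarrow>\<^sub>M subprob_algebra (?K (Suc t))"
    proof (rule measurable_distr2)
      show "(\<lambda>p. \<nu> (a t (fst p) (snd p))) \<in> ?K t \<rightarrow>\<^sub>M subprob_algebra borel"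
        using measurable_compose[OF measurable_a measurable_prob_algebraD[OF \<nu>(1)]]
        by (simp add: case_prod_beta')
      show "(\<lambda>(p, y). (fst p, (snd p)(t := y))) \<in> ?K t \<Otimes>\<^sub>M borel \<rightarrow>\<^sub>M ?K (Suc t)"
        unfolding case_prod_beta'
        by (intro measurable_Pair measurable_PiM_fun_upd measurable_compose[OF measurable_fst]
            measurable_fst measurable_snd)
    qed
    then show ?thesis by (simp add: case_prod_beta')
  qed
  have ne: "space (distr tape (?K t) (?R t)) \<noteq> {}"
    using prob_space.not_empty[OF pair.prob_space_distr[OF measurable_run[of t]]] .
  show ?case
  proof (rule measure_eqI)
    show "sets (mab_law Q a \<nu> (Suc t)) = sets (distr tape (?K (Suc t)) (?R (Suc t)))"
      unfolding mab_law.simps Suc by (subst sets_bind[OF sets_kernel[OF k] ne]) auto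
    fix A assume "A \<in> sets (mab_law Q a \<nu> (Suc t))"
    then have A[measurable]: "A \<in> sets (?K (Suc t))"
      unfolding mab_law.simps Suc by (subst (asm) sets_bind[OF sets_kernel[OF k] ne]) auto
    have kernel: "emeasure (?k (?R t (\<omega>, \<kappa>))) A =
        (\<integral>\<^sup>+z. indicator A (?R (Suc t) (\<omega>, \<kappa>(t := z))) \<partial>N)"
      if "\<omega> \<in> space Q" "\<kappa> \<in> space (\<Pi>\<^sub>M t\<in>UNIV. N)" for \<omega> \<kappa>
    proof -
      let ?r = "mab_run a F \<omega> \<kappa> t" let ?x = "a t \<omega> ?r"
      have R: "?R t (\<omega>, \<kappa>) \<in> space (?K t)"
        using measurable_space[OF measurable_run, of "(\<omega>, \<kappa>)" t] that by (simp add: space_pair_measure)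
      then have x: "?x \<in> X"
        using measurable_space[OF measurable_a, of "?R t (\<omega>, \<kappa>)" t] by (simp add: space_restrict_space)
      have Fx: "(\<lambda>z. F z ?x) \<in> borel_measurable N"
        using measurable_compose[OF measurable_Pair2'[of ?x "arms X" N] F] x
        by (simp add: space_restrict_space)
      have upd: "(\<lambda>y. (\<omega>, ?r(t := y))) \<in> borel \<rightarrow>\<^sub>M ?K (Suc t)"
        using R that by (intro measurable_Pair measurable_PiM_fun_upd measurable_const)
          (auto simp: space_pair_measure)
      have cong: "mab_run a F \<omega> (\<kappa>(t := z)) t = ?r" for z
        by (rule mab_run_cong) auto
      have "?k (?R t (\<omega>, \<kappa>)) = distr N (?K (Suc t)) (\<lambda>z. (\<omega>, ?r(t := F z ?x)))"
        using x by (simp add: \<nu>(2) distr_distr[OF upd Fx] comp_def)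
      moreover have m: "(\<lambda>z. (\<omega>, ?r(t := F z ?x))) \<in> N \<rightarrow>\<^sub>M ?K (Suc t)"
        using measurable_compose[OF Fx upd] .
      ultimately have "emeasure (?k (?R t (\<omega>, \<kappa>))) A =
          (\<integral>\<^sup>+y. indicator A y \<partial>distr N (?K (Suc t)) (\<lambda>z. (\<omega>, ?r(t := F z ?x))))"
        by simp
      also have "\<dots> = (\<integral>\<^sup>+z. indicator A (\<omega>, ?r(t := F z ?x)) \<partial>N)"
        by (rule nn_integral_distr[OF m]) simp
      finally show ?thesis
        by (simp add: cong)
    qed
    have ind: "(\<lambda>p. indicator A (?R (Suc t) p) :: ennreal) \<in> borel_measurable tape"
      by (rule measurable_compose[OF measurable_run borel_measurable_indicator[OF A]])
    have "emeasure (mab_law Q a \<nu> (Suc t)) A = (\<integral>\<^sup>+q. emeasure (?k q) A \<partial>distr tape (?K t) (?R t))"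
      unfolding mab_law.simps Suc by (rule emeasure_bind[OF ne]) (use k A in auto)
    also have "\<dots> = (\<integral>\<^sup>+p. emeasure (?k (?R t p)) A \<partial>tape)"
      by (rule nn_integral_distr[OF measurable_run])
        (use measurable_emeasure_kernel[OF k A] in simp)
    also have "\<dots> = (\<integral>\<^sup>+p. (\<integral>\<^sup>+z. indicator A (?R (Suc t) (fst p, (snd p)(t := z))) \<partial>N) \<partial>tape)"
      using kernel by (intro nn_integral_cong) (force simp: space_pair_measure)
    also have "\<dots> = (\<integral>\<^sup>+\<omega>. (\<integral>\<^sup>+\<kappa>. (\<integral>\<^sup>+z. indicator A (?R (Suc t) (\<omega>, \<kappa>(t := z))) \<partial>N) \<partial>(\<Pi>\<^sub>M t\<in>UNIV. N)) \<partial>Q)"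
    proof (subst seq.nn_integral_fst[symmetric])
      have "(\<lambda>(p, z). indicator A (?R (Suc t) (fst p, (snd p)(t := z))) :: ennreal) \<in> borel_measurable (tape \<Otimes>\<^sub>M N)"
        unfolding case_prod_beta'
        by (rule measurable_compose[OF _ ind], intro measurable_Pair measurable_PiM_UNIV_fun_upd
            measurable_compose[OF measurable_fst] measurable_fst measurable_snd)
      then show "(\<lambda>p. \<integral>\<^sup>+z. indicator A (?R (Suc t) (fst p, (snd p)(t := z))) \<partial>N) \<in> borel_measurable tape"
        by (rule N.borel_measurable_nn_integral)
    qed simp
    also have "\<dots> = (\<integral>\<^sup>+\<omega>. (\<integral>\<^sup>+\<kappa>. indicator A (?R (Suc t) (\<omega>, \<kappa>)) \<partial>(\<Pi>\<^sub>M t\<in>UNIV. N)) \<partial>Q)"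
    proof (rule nn_integral_cong)
      fix \<omega> assume \<omega>: "\<omega> \<in> space Q"
      let ?I = "\<lambda>\<kappa>. indicator A (?R (Suc t) (\<omega>, \<kappa>)) :: ennreal"
      have I: "?I \<in> borel_measurable (\<Pi>\<^sub>M t\<in>UNIV. N)"
        using measurable_compose[OF measurable_Pair1'[OF \<omega>] ind] by simp
      have upd: "(\<lambda>(z, \<kappa>). \<kappa>(t := z)) \<in> N \<Otimes>\<^sub>M (\<Pi>\<^sub>M t\<in>UNIV. N) \<rightarrow>\<^sub>M (\<Pi>\<^sub>M t\<in>UNIV. N)"
        unfolding case_prod_beta' by (intro measurable_PiM_UNIV_fun_upd measurable_fst measurable_snd)
      have "(\<integral>\<^sup>+\<kappa>. ?I \<kappa> \<partial>(\<Pi>\<^sub>M t\<in>UNIV. N)) =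
          (\<integral>\<^sup>+p. ?I (case p of (z, \<kappa>) \<Rightarrow> \<kappa>(t := z)) \<partial>(N \<Otimes>\<^sub>M (\<Pi>\<^sub>M t\<in>UNIV. N)))"
        by (subst PiM_resample[symmetric, of t], rule nn_integral_distr[OF upd]) (use I in simp)
      also have "\<dots> = (\<integral>\<^sup>+\<kappa>. (\<integral>\<^sup>+z. ?I (\<kappa>(t := z)) \<partial>N) \<partial>(\<Pi>\<^sub>M t\<in>UNIV. N))"
      proof -
        interpret pair_sigma_finite N "\<Pi>\<^sub>M t\<in>(UNIV::nat set). N" ..
        have "(\<lambda>(z, \<kappa>). ?I (\<kappa>(t := z))) \<in> borel_measurable (N \<Otimes>\<^sub>M (\<Pi>\<^sub>M t\<in>UNIV. N))"
          using measurable_compose[OF upd I] by (simp add: case_prod_beta')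
        from nn_integral_snd[OF this] show ?thesis
          by (simp add: case_prod_beta')
      qed
      finally show "(\<integral>\<^sup>+\<kappa>. (\<integral>\<^sup>+z. ?I (\<kappa>(t := z)) \<partial>N) \<partial>(\<Pi>\<^sub>M t\<in>UNIV. N)) = (\<integral>\<^sup>+\<kappa>. ?I \<kappa> \<partial>(\<Pi>\<^sub>M t\<in>UNIV. N))"
        by simp
    qed
    also have "\<dots> = (\<integral>\<^sup>+p. indicator A (?R (Suc t) p) \<partial>tape)"
      by (rule seq.nn_integral_fst[OF ind])
    also have "\<dots> = (\<integral>\<^sup>+q. indicator A q \<partial>distr tape (?K (Suc t)) (?R (Suc t)))"
      by (rule nn_integral_distr[OF measurable_run, symmetric]) simp
    also have "\<dots> = emeasure (distr tape (?K (Suc t)) (?R (Suc t))) A"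
      by simp
    finally show "emeasure (mab_law Q a \<nu> (Suc t)) A = emeasure (distr tape (?K (Suc t)) (?R (Suc t))) A" .
  qed
qed

lemma mab_regret_eq:
  assumes inst: "mab_instance X \<mu> \<nu>" and \<nu>: "\<And>x. x \<in> X \<Longrightarrow> \<nu> x = distr N borel (\<lambda>z. F z x)"
  shows "mab_regret X Q a \<mu> \<nu> t = real t * (SUP x\<in>X. \<mu> x) -
    (\<integral>p. (\<Sum>s<t. \<mu> (pick s (fst p) (snd p))) \<partial>tape)"
proof -
  let ?K = "Q \<Otimes>\<^sub>M (\<Pi>\<^sub>M s\<in>{..<t}. (borel :: real measure))"
  have m: "\<nu> \<in> arms X \<rightarrow>\<^sub>M prob_algebra borel"
    using inst by (simp add: mab_instance_def)
  have "continuous_on X \<mu>"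
    using inst lipschitz_on_continuous_on by (auto simp: mab_instance_def)
  then have \<mu>: "\<mu> \<in> borel_measurable (arms X)"
    by (rule borel_measurable_continuous_on_restrict)
  have "(\<lambda>q. \<mu> (a s (fst q) (restrict (snd q) {..<s}))) \<in> borel_measurable ?K" if "s < t" for s
  proof -
    have "(\<lambda>q. (fst q, restrict (snd q) {..<s})) \<in> ?K \<rightarrow>\<^sub>M Q \<Otimes>\<^sub>M (\<Pi>\<^sub>M s\<in>{..<s}. borel)"
      using that by (intro measurable_Pair measurable_fst measurable_compose[OF measurable_snd] measurable_restrict_subset) auto
    from measurable_compose[OF measurable_compose[OF this measurable_a] \<mu>] show ?thesis by simp
  qed
  then have "(\<lambda>q. \<Sum>s<t. \<mu> (a s (fst q) (restrict (snd q) {..<s}))) \<in> borel_measurable ?K"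
    by (intro borel_measurable_sum) auto
  from integral_distr[OF measurable_run this]
  have "(\<integral>q. (\<Sum>s<t. \<mu> (a s (fst q) (restrict (snd q) {..<s}))) \<partial>mab_law Q a \<nu> t) =
      (\<integral>p. (\<Sum>s<t. \<mu> (pick s (fst p) (snd p))) \<partial>tape)"
    by (simp add: mab_law_eq[OF m \<nu>] restrict_mab_run)
  then show ?thesis
    by (simp add: mab_regret_def case_prod_beta')
qed

end


subsection \<open>Identifying the last maximizer\<close>

lemma (in prob_space) indep_vars_PiM_coordinates:
  fixes \<tau> :: "'i \<Rightarrow> 't"
  assumes "inj_on \<tau> I"
  shows "prob_space.indep_vars (\<Pi>\<^sub>M t\<in>UNIV. M) (\<lambda>_. M) (\<lambda>l \<kappa>. \<kappa> (\<tau> l)) I"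
proof -
  interpret seq: prob_space "\<Pi>\<^sub>M t\<in>(UNIV :: 't set). M"
    by (rule prob_space_PiM) (rule prob_space_axioms)
  interpret prod: product_prob_space "\<lambda>_. M" "UNIV :: 't set"
    by unfold_locales
  show ?thesis
  proof (cases "I = {}")
    case True
    then show ?thesis by (simp add: seq.indep_vars_def seq.indep_sets_def)
  next
    case False
    have "distr (\<Pi>\<^sub>M t\<in>UNIV. M) (\<Pi>\<^sub>M l\<in>I. M) (\<lambda>\<kappa>. \<lambda>l\<in>I. \<kappa> (\<tau> l)) = (\<Pi>\<^sub>M l\<in>I. M)"
      using distr_PiM_reindex[of UNIV "\<lambda>_. M" \<tau> I] assms prob_space_axioms by simp
    moreover have "(\<lambda>i. distr (\<Pi>\<^sub>M t\<in>UNIV. M) M (\<lambda>\<kappa>. \<kappa> (\<tau> i))) = (\<lambda>_. M)"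
      using prod.PiM_component by simp
    ultimately show ?thesis
      by (subst seq.indep_vars_iff_distr_eq_PiM'[OF False]) simp_all
  qed
qed

text \<open>Hoeffding's inequality. \<open>\<tau>\<close> selects the rounds in which an arm is
  sampled; they have to be distinct for the samples to be independent.\<close>

lemma (in prob_space) sample_mean_deviation:
  fixes Y :: "'a \<Rightarrow> real" and \<tau> :: "nat \<Rightarrow> 't"
  assumes Y: "Y \<in> borel_measurable M" "AE z in M. Y z \<in> {0..1}"
    and \<tau>: "inj_on \<tau> {..<n}" and "n > 0" "c \<ge> 0"
  shows "measure (\<Pi>\<^sub>M t\<in>UNIV. M) {\<kappa>\<in>space (\<Pi>\<^sub>M t\<in>UNIV. M).
      c \<le> \<bar>(\<Sum>l<n. Y (\<kappa> (\<tau> l))) / real n - (\<integral>z. Y z \<partial>M)\<bar>} \<le> 2 * exp (- 2 * real n * c\<^sup>2)"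
proof -
  interpret seq: prob_space "\<Pi>\<^sub>M t\<in>(UNIV :: 't set). M"
    by (rule prob_space_PiM) (rule prob_space_axioms)
  interpret prod: product_prob_space "\<lambda>_. M" "UNIV :: 't set"
    by unfold_locales
  have comp: "distr (\<Pi>\<^sub>M t\<in>UNIV. M) M (\<lambda>\<kappa>. \<kappa> i) = M" for i :: 't
    using prod.PiM_component[of i] by simp
  have Yd: "distr (\<Pi>\<^sub>M t\<in>UNIV. M) borel (\<lambda>\<kappa>. Y (\<kappa> i)) = distr M borel Y" for i :: 't
    by (subst (2) comp[of i, symmetric], subst distr_distr) (auto simp: comp_def Y)
  have mY: "(\<lambda>\<kappa>. Y (\<kappa> i)) \<in> borel_measurable (\<Pi>\<^sub>M t\<in>UNIV. M)" for i :: 't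
    using measurable_compose[OF measurable_component_singleton[of i UNIV "\<lambda>_. M"] Y(1)] by simp
  interpret H: Hoeffding_ineq_iid "\<Pi>\<^sub>M t\<in>(UNIV :: 't set). M" "{..<n}" "\<lambda>l \<kappa>. Y (\<kappa> (\<tau> l))"
    "\<lambda>\<kappa>. Y (\<kappa> (\<tau> 0))" 0 1 "seq.expectation (\<lambda>\<kappa>. Y (\<kappa> (\<tau> 0)))"
  proof unfold_locales
    show "seq.indep_vars (\<lambda>_. borel) (\<lambda>l \<kappa>. Y (\<kappa> (\<tau> l))) {..<n}"
      using seq.indep_vars_compose2[OF indep_vars_PiM_coordinates[OF \<tau>], of "\<lambda>_. Y"] Y(1) by simp
    show "AE \<kappa> in \<Pi>\<^sub>M t\<in>UNIV. M. Y (\<kappa> (\<tau> 0)) \<in> {0..1}"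
      using prod.AE_component[OF _ Y(2)] by simp
  qed (simp_all add: Yd mY)
  have "seq.expectation (\<lambda>\<kappa>. Y (\<kappa> (\<tau> 0))) = (\<integral>z. Y z \<partial>M)"
    by (subst (2) comp[of "\<tau> 0", symmetric], subst integral_distr) (auto simp: Y)
  moreover have "{..<n} \<noteq> {}" using \<open>n > 0\<close> by auto
  ultimately show ?thesis
    using H.Hoeffding_ineq_abs_ge'[OF \<open>c \<ge> 0\<close>] by simp
qed

text \<open>
  Among the first \<open>m\<close> arms whose estimate is within \<open>2 * c\<close> of the best one, the leader is the last in the
  order \<open>lt\<close>. Picking the last one is what makes the choice exactly optimal: the arms
  after the last maximizer have a positive gap, whereas the arms before it may have arbitrarily small gaps.
\<close>

definition leader :: "('a \<Rightarrow> 'a \<Rightarrow> bool) \<Rightarrow> (nat \<Rightarrow> 'a) \<Rightarrow> nat \<Rightarrow> real \<Rightarrow> (nat \<Rightarrow> real) \<Rightarrow> nat" where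
  "leader lt e m c est = (LEAST i. i < m \<and> (\<forall>j\<in>{..<m}. est j \<le> est i + 2 * c) \<and>
     (\<forall>j\<in>{..<m}. lt (e i) (e j) \<longrightarrow> (\<exists>k\<in>{..<m}. est j + 2 * c < est k)))"

lemma measurable_leader:
  assumes "\<And>i. i < m \<Longrightarrow> est i \<in> borel_measurable M"
  shows "(\<lambda>z. leader lt e m c (\<lambda>i. est i z)) \<in> M \<rightarrow>\<^sub>M count_space UNIV"
  unfolding leader_def
proof (rule measurable_Least)
  fix i
  show "Measurable.pred M (\<lambda>z. i < m \<and> (\<forall>j\<in>{..<m}. est j z \<le> est i z + 2 * c) \<and>
     (\<forall>j\<in>{..<m}. lt (e i) (e j) \<longrightarrow> (\<exists>k\<in>{..<m}. est j z + 2 * c < est k z)))"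
  proof (cases "i < m")
    case True
    then show ?thesis
      using assms by (intro pred_intros_logic pred_intros_finite borel_measurable_pred_less
          borel_measurable_le borel_measurable_add borel_measurable_const) auto
  qed simp
qed

lemma leader_cong:
  assumes "\<And>i. i < m \<Longrightarrow> est i = est' i"
  shows "leader lt e m c est = leader lt e m c est'"
  unfolding leader_def using assms by (intro arg_cong[where f=Least] ext) auto

text \<open>With estimates closer than \<open>c\<close> to the truth, the maximizer \<open>x\<close>
  is within \<open>2 * c\<close> of the best estimate, while an arm after \<open>x\<close> with gap
  \<open>4 * c\<close> falls more than \<open>2 * c\<close> short of the estimate of
  \<open>x\<close>. So a candidate before \<open>x\<close> is refuted by \<open>x\<close>, and a
  candidate after \<open>x\<close> is not near the top. The conclusion speaks of arms and not of
  indices, as the enumeration \<open>e\<close> may repeat arms.\<close>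

lemma leader_eq:
  assumes "\<And>x y. lt x y \<Longrightarrow> \<not> lt y x" "\<And>i. i < m \<Longrightarrow> e i \<noteq> x \<Longrightarrow> lt (e i) x \<or> lt x (e i)"
    and "p < m" "e p = x" "\<And>i. i < m \<Longrightarrow> \<bar>est i - \<mu> (e i)\<bar> < c"
    and "\<And>i. i < m \<Longrightarrow> \<mu> (e i) \<le> \<mu> x" "\<And>i. i < m \<Longrightarrow> lt x (e i) \<Longrightarrow> \<mu> (e i) \<le> \<mu> x - 4 * c"
  shows "e (leader lt e m c est) = x"
proof -
  define ok where "ok i \<longleftrightarrow> i < m \<and> (\<forall>j\<in>{..<m}. est j \<le> est i + 2 * c) \<and>
     (\<forall>j\<in>{..<m}. lt (e i) (e j) \<longrightarrow> (\<exists>k\<in>{..<m}. est j + 2 * c < est k))" for i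
  have later: "est j + 2 * c < est p" if "j < m" "lt x (e j)" for j
    using assms(5)[OF that(1)] assms(7)[OF that] assms(5)[OF assms(3)] assms(4) by simp
  have best: "est j \<le> est p + 2 * c" if "j < m" for j
    using assms(5)[OF that] assms(6)[OF that] assms(5)[OF assms(3)] assms(4) by simp
  have "ok p"
    unfolding ok_def using best later assms(3,4) by auto
  then have "ok (leader lt e m c est)"
    unfolding leader_def ok_def[symmetric] by (rule LeastI)
  then obtain i where i: "i = leader lt e m c est" "ok i" by blast
  have "e i = x"
  proof (rule ccontr)
    assume "e i \<noteq> x"
    then consider "lt (e i) x" | "lt x (e i)"
      using assms(2) i(2) by (auto simp: ok_def)
    then show False
    proof cases
      case 1
      then obtain k where "k < m" "est p + 2 * c < est k"
        using i(2) assms(3,4) by (auto simp: ok_def)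
      with best show False by force
    next
      case 2
      with later[of i] i(2) assms(3) show False by (force simp: ok_def)
    qed
  qed
  then show ?thesis using i(1) by simp
qed

text \<open>Hoeffding's inequality and a union bound over the arms. The union bound allows
  dependence between different arms, so only the sampling rounds of the same arm have to be
  distinct.\<close>

lemma commit_error:
  fixes N :: "('a \<Rightarrow> real) measure" and \<tau> :: "nat \<Rightarrow> nat \<Rightarrow> nat"
  assumes N: "prob_space N" and e: "\<And>i. e i \<in> X"
    and meas: "\<And>x. x \<in> X \<Longrightarrow> (\<lambda>z. z x) \<in> borel_measurable N"
    and bdd: "\<And>x. x \<in> X \<Longrightarrow> AE z in N. z x \<in> {0..1}"
    and mean: "\<And>x. x \<in> X \<Longrightarrow> (\<integral>z. z x \<partial>N) = \<mu> x"
    and lt: "\<And>x y. lt x y \<Longrightarrow> \<not> lt y x" "\<And>x y. x \<in> X \<Longrightarrow> y \<in> X \<Longrightarrow> x \<noteq> y \<Longrightarrow> lt x y \<or> lt y x"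
    and x: "x \<in> X" "\<And>y. y \<in> X \<Longrightarrow> \<mu> y \<le> \<mu> x" "\<And>y. y \<in> X \<Longrightarrow> lt x y \<Longrightarrow> \<mu> y \<le> \<mu> x - 4 * c"
    and m: "p < m" "e p = x" and "n > 0" "c \<ge> 0"
    and \<tau>: "\<And>i. i < m \<Longrightarrow> inj_on (\<tau> i) {..<n}"
  shows "measure (\<Pi>\<^sub>M t\<in>UNIV. N) {\<kappa>\<in>space (\<Pi>\<^sub>M t\<in>UNIV. N).
      e (leader lt e m c (\<lambda>i. (\<Sum>l<n. \<kappa> (\<tau> i l) (e i)) / real n)) \<noteq> x} \<le> 2 * real m * exp (- 2 * real n * c\<^sup>2)"
proof -
  interpret prob_space N by fact
  interpret seq: prob_space "\<Pi>\<^sub>M t\<in>(UNIV :: nat set). N"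
    by (rule prob_space_PiM) (rule N)
  define est where "est i \<kappa> = (\<Sum>l<n. \<kappa> (\<tau> i l) (e i)) / real n" for i \<kappa>
  have est: "est i \<in> borel_measurable (\<Pi>\<^sub>M t\<in>UNIV. N)" for i
    unfolding est_def
    by (intro borel_measurable_divide borel_measurable_sum borel_measurable_const
        measurable_compose[OF measurable_component_singleton[of _ UNIV "\<lambda>_. N"] meas[OF e]]) simp
  define bad where "bad i = {\<kappa>\<in>space (\<Pi>\<^sub>M t\<in>(UNIV :: nat set). N). c \<le> \<bar>est i \<kappa> - \<mu> (e i)\<bar>}" for i
  have bad[measurable]: "bad i \<in> seq.events" for i
    unfolding bad_def using est by measurable
  have "{\<kappa>\<in>space (\<Pi>\<^sub>M t\<in>UNIV. N). e (leader lt e m c (\<lambda>i. est i \<kappa>)) \<noteq> x} \<subseteq> (\<Union>i\<in>{..<m}. bad i)"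
  proof (rule subsetI, rule ccontr)
    fix \<kappa> assume \<kappa>: "\<kappa> \<in> {\<kappa>\<in>space (\<Pi>\<^sub>M t\<in>UNIV. N). e (leader lt e m c (\<lambda>i. est i \<kappa>)) \<noteq> x}"
      and n: "\<kappa> \<notin> (\<Union>i\<in>{..<m}. bad i)"
    have "e (leader lt e m c (\<lambda>i. est i \<kappa>)) = x"
      by (rule leader_eq[where \<mu>=\<mu>]) (use lt x m e \<kappa> n in \<open>auto simp: bad_def not_le\<close>)
    with \<kappa> show False by simp
  qed
  then have "seq.prob {\<kappa>\<in>space (\<Pi>\<^sub>M t\<in>UNIV. N). e (leader lt e m c (\<lambda>i. est i \<kappa>)) \<noteq> x} \<le> seq.prob (\<Union>i\<in>{..<m}. bad i)"
    by (intro seq.finite_measure_mono) auto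
  also have "\<dots> \<le> (\<Sum>i<m. seq.prob (bad i))"
    by (intro seq.finite_measure_subadditive_finite) auto
  also have "\<dots> \<le> (\<Sum>i<m. 2 * exp (- 2 * real n * c\<^sup>2))"
  proof (rule sum_mono)
    fix i assume "i \<in> {..<m}"
    then show "seq.prob (bad i) \<le> 2 * exp (- 2 * real n * c\<^sup>2)"
      using sample_mean_deviation[OF meas[OF e[of i]] bdd[OF e[of i]] \<tau> \<open>n > 0\<close> \<open>c \<ge> 0\<close>]
      by (simp add: bad_def est_def mean[OF e])
  qed
  finally show ?thesis
    by (simp add: est_def mult_ac)
qed


subsection \<open>Countable spaces: experts with double feedback\<close>

lemma distr_pair_snd:
  assumes "prob_space A" "sigma_finite_measure B"
  shows "distr (A \<Otimes>\<^sub>M B) B snd = B"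
proof (rule measure_eqI)
  interpret A: prob_space A by fact
  interpret B: sigma_finite_measure B by fact
  fix S assume "S \<in> sets (distr (A \<Otimes>\<^sub>M B) B snd)"
  then have S: "S \<in> sets B" by simp
  have "snd -` S \<inter> space (A \<Otimes>\<^sub>M B) = space A \<times> S"
    using sets.sets_into_space[OF S] by (auto simp: space_pair_measure)
  then show "emeasure (distr (A \<Otimes>\<^sub>M B) B snd) S = emeasure B S"
    using S by (simp add: emeasure_distr B.emeasure_pair_measure_Times A.emeasure_space_1)
qed simp

lemma (in prob_space) mean_loss_le_prob:
  fixes u :: "'a \<Rightarrow> real"
  assumes u: "u \<in> borel_measurable M" "\<And>w. w \<in> space M \<Longrightarrow> u w \<in> {0..1}"
    and "v \<le> 1" and S: "S \<in> events" "\<And>w. w \<in> space M \<Longrightarrow> w \<notin> S \<Longrightarrow> u w = v"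
  shows "v - expectation u \<le> prob S"
proof -
  have int: "integrable M u"
    by (rule integrable_const_bound[where B=1]) (use u in auto)
  have "expectation (\<lambda>w. v - u w) \<le> expectation (indicator S)"
  proof (rule integral_mono)
    show "integrable M (\<lambda>w. v - u w)" using int by simp
    show "integrable M (indicat_real S)"
      using S(1) by (simp add: integrable_indicator_iff less_top[symmetric])
    fix w assume w: "w \<in> space M"
    then show "v - u w \<le> indicat_real S w"
      using u(2)[OF w] S(2)[OF w] \<open>v \<le> 1\<close> by (cases "w \<in> S") auto
  qed
  then show ?thesis
    using int S(1) by (simp add: prob_space)
qed

text \<open>In the double-feedback algorithm the extra query of round
  \<open>prod_encode (i, l)\<close> is the \<open>l\<close>-th sample of arm \<open>e i\<close>.
  With \<open>m = Suc k\<close> the largest code is at most \<open>k * (2 * k + 1) + k\<close>, so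
  \<open>m\<close> samples of each of \<open>m\<close> arms are available by round
  \<open>2 * m * m\<close>.\<close>

lemma prod_encode_less:
  assumes "i < m" "l < m" "2 * m * m \<le> t"
  shows "prod_encode (i, l) < t"
proof -
  obtain k where m: "m = Suc k" using assms(1) by (cases m) auto
  have "i + l \<le> 2 * k" using assms m by simp
  then have "(i + l) * Suc (i + l) \<le> (2 * k) * Suc (2 * k)"
    by (intro mult_le_mono) auto
  then have "triangle (i + l) \<le> k * Suc (2 * k)"
    unfolding triangle_def by (metis (no_types, lifting) div_le_mono mult.assoc nonzero_mult_div_cancel_left zero_neq_numeral)
  then have "prod_encode (i, l) \<le> k * Suc (2 * k) + k"
    using assms(1) m by (simp add: prod_encode_def)
  also have "\<dots> < 2 * m * m" by (simp add: m algebra_simps)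
  finally show ?thesis using assms(3) by simp
qed

lemma double_run_nth:
  assumes "s < t"
  shows "double_run a \<omega> \<phi> t s = (\<phi> s (fst (a s \<omega> (double_run a \<omega> \<phi> s))), \<phi> s (snd (a s \<omega> (double_run a \<omega> \<phi> s))))"
  using assms by (induction t) (auto simp: Let_def less_Suc_eq split: prod.split)

lemma mab_run_nth:
  assumes "s < t"
  shows "mab_run a F \<omega> \<kappa> t s = F (\<kappa> s) (a s \<omega> (mab_run a F \<omega> \<kappa> s))"
  using assms by (induction t) (auto simp: less_Suc_eq)

lemma SUP_eq_maximum:
  fixes \<mu> :: "'a \<Rightarrow> real"
  assumes "x \<in> X" "\<And>y. y \<in> X \<Longrightarrow> \<mu> y \<le> \<mu> x"
  shows "(SUP y\<in>X. \<mu> y) = \<mu> x"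
  using assms by (intro cSup_eq_maximum) auto

lemma seed_law_return: "seed_law (return borel x)"
  by (simp add: seed_law_def prob_space_return)

lemma sum_le_initial_plus_suminf:
  fixes b err :: "nat \<Rightarrow> real"
  assumes "\<And>s. b s \<le> 1" "\<And>s. s \<ge> s0 \<Longrightarrow> b s \<le> err s" "summable err" "\<And>s. 0 \<le> err s"
  shows "(\<Sum>s<t. b s) \<le> real s0 + (\<Sum>s. err s)"
proof -
  have "(\<Sum>s<t. b s) \<le> (\<Sum>s<t. (if s < s0 then 1 else 0) + err s)"
    using assms by (intro sum_mono) (smt (verit, best) not_less)
  also have "\<dots> = real (card ({..<t} \<inter> {..<s0})) + (\<Sum>s<t. err s)"
    by (simp add: sum.distrib sum.If_cases lessThan_def)
  also have "\<dots> \<le> real (card {..<s0}) + (\<Sum>s. err s)"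
    using assms(3,4) by (intro add_mono sum_le_suminf of_nat_mono card_mono) auto
  finally show ?thesis by simp
qed

lemma expert_instance_eval:
  assumes "expert_instance X P" "x \<in> X"
  shows "(\<lambda>f. f x) \<in> borel_measurable P" "\<And>f. f \<in> space P \<Longrightarrow> f x \<in> {0..1}"
proof -
  have s: "sets P = sets (payoff_borel X)" using assms by (simp add: expert_instance_def)
  show "(\<lambda>f. f x) \<in> borel_measurable P"
    using measurable_payoff_eval[OF assms(2)] by (subst measurable_cong_sets[OF s refl])
  show "f x \<in> {0..1}" if "f \<in> space P" for f
    using that assms(2) unfolding sets_eq_imp_space_eq[OF s] space_payoff_borel by blast
qed

lemma expert_mean_bounds:
  assumes "expert_instance X P" "x \<in> X"
  shows "expert_mean P x \<in> {0..1}"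
proof -
  interpret prob_space P using assms(1) by (simp add: expert_instance_def)
  have int: "integrable P (\<lambda>f. f x)"
    by (rule integrable_const_bound[where B=1]) (use expert_instance_eval[OF assms] in auto)
  have "expectation (\<lambda>f. f x) \<le> expectation (\<lambda>_. 1)"
    using expert_instance_eval(2)[OF assms] int by (intro integral_mono) auto
  moreover have "0 \<le> expectation (\<lambda>f. f x)"
    using expert_instance_eval(2)[OF assms] by (intro Bochner_Integration.integral_nonneg) auto
  ultimately show ?thesis by (simp add: expert_mean_def prob_space)
qed

theorem countable_imp_double_tractable:
  fixes X :: "'a::metric_space set"
  assumes X: "compact X" "X \<noteq> {}" "countable X"
  shows "double_tractable X (\<lambda>_. 1)"
proof -
  obtain lt :: "'a \<Rightarrow> 'a \<Rightarrow> bool" where lt: "\<And>x y. lt x y \<Longrightarrow> \<not> lt y x"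
    "\<And>x y. x \<in> X \<Longrightarrow> y \<in> X \<Longrightarrow> x \<noteq> y \<Longrightarrow> lt x y \<or> lt y x"
    "\<And>S. compact S \<Longrightarrow> S \<noteq> {} \<Longrightarrow> S \<subseteq> X \<Longrightarrow> \<exists>x\<in>S. (\<forall>y\<in>S. \<not> lt x y) \<and> compact {y\<in>X. lt x y}"
    by (rule countable_compact_order[OF X(1,3)]) (rule that)
  define e where "e = from_nat_into X"
  have e: "e i \<in> X" for i
    using X(2) by (simp add: e_def from_nat_into)
  \<comment> \<open>\<open>m t\<close> is both the number of arms compared and the number of samples
    of each, the most that \<open>prod_encode_less\<close> permits. The tolerance \<open>c t\<close>
    tends to 0 and so drops below a quarter of any gap, while
    \<open>m t * (c t)\<^sup>2 = sqrt (m t)\<close> still makes the error bound \<open>err\<close>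
    summable.\<close>
  define m where "m t = nat \<lfloor>sqrt (real t / 2)\<rfloor>" for t
  define c where "c t = real (m t) powr (- 1 / 4)" for t
  have m: "2 * m t * m t \<le> t" for t
  proof -
    have "real (m t) \<le> sqrt (real t / 2)" by (simp add: m_def)
    then have "real (m t) ^ 2 \<le> real t / 2"
      using real_sqrt_pow2[of "real t / 2"] power_mono[of "real (m t)" "sqrt (real t / 2)" 2] by simp
    then have "real (2 * m t * m t) \<le> real t" by (simp add: power2_eq_square)
    then show ?thesis by (simp only: of_nat_le_iff)
  qed
  \<comment> \<open>The picked arm is the current leader, and the extra query samples each arm
    infinitely often. The estimates use the extra values only, so the sampling schedule does not
    depend on the picks.\<close>
  define a :: "'a double_rule" where "a = (\<lambda>t \<omega> v.
    (e (leader lt e (m t) (c t) (\<lambda>i. (\<Sum>l<m t. snd (v (prod_encode (i, l)))) / real (m t))), e (fst (prod_decode t))))"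
  define Q :: "real measure" where "Q = return borel 0"
  have e_meas: "(\<lambda>i. e i) \<in> count_space UNIV \<rightarrow>\<^sub>M arms X"
    using e by (simp add: space_restrict_space)
  have alg: "double_algorithm X Q a"
    unfolding double_algorithm_def
  proof (intro conjI allI)
    show "seed_law Q" by (simp add: Q_def seed_law_return)
    fix t :: nat
    let ?M = "Q \<Otimes>\<^sub>M (\<Pi>\<^sub>M s\<in>{..<t}. (borel :: real measure) \<Otimes>\<^sub>M (borel :: real measure))"
    have "(\<lambda>p. \<Sum>l<m t. snd (snd p (prod_encode (i, l)))) \<in> borel_measurable ?M" if "i < m t" for i
    proof (rule borel_measurable_sum)
      fix l assume "l \<in> {..<m t}"
      then have "prod_encode (i, l) \<in> {..<t}"
        using prod_encode_less[OF that _ m[of t]] by simp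
      from measurable_compose[OF measurable_compose[OF measurable_snd measurable_component_singleton[OF this]] measurable_snd]
      show "(\<lambda>p. snd (snd p (prod_encode (i, l)))) \<in> borel_measurable ?M" .
    qed
    then have "(\<lambda>p. (\<Sum>l<m t. snd (snd p (prod_encode (i, l)))) / real (m t)) \<in> borel_measurable ?M" if "i < m t" for i
      using that by simp
    from measurable_compose[OF measurable_leader[OF this] e_meas]
    show "(\<lambda>(\<omega>, v). a t \<omega> v) \<in> ?M \<rightarrow>\<^sub>M arms X \<Otimes>\<^sub>M arms X"
      unfolding a_def case_prod_beta'
      by (intro measurable_Pair measurable_const) (use e in \<open>simp_all add: space_restrict_space\<close>)
  qed
  define G where "G t \<phi> = e (leader lt e (m t) (c t) (\<lambda>i. (\<Sum>l<m t. \<phi> (prod_encode (i, l)) (e i)) / real (m t)))"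
    for t :: nat and \<phi> :: "nat \<Rightarrow> 'a \<Rightarrow> real"
  have pick: "double_pick a t \<omega> \<phi> = G t \<phi>" for t \<omega> \<phi>
  proof -
    have "snd (double_run a \<omega> \<phi> t (prod_encode (i, l))) = \<phi> (prod_encode (i, l)) (e i)" if "i < m t" "l < m t" for i l
      using prod_encode_less[OF that m[of t]] by (simp add: double_run_nth) (simp add: a_def)
    then have "leader lt e (m t) (c t) (\<lambda>i. (\<Sum>l<m t. snd (double_run a \<omega> \<phi> t (prod_encode (i, l)))) / real (m t)) =
        leader lt e (m t) (c t) (\<lambda>i. (\<Sum>l<m t. \<phi> (prod_encode (i, l)) (e i)) / real (m t))"
      by (intro leader_cong) simp
    then show ?thesis by (simp add: double_pick_def a_def G_def)
  qed
  define err where "err s = 2 * real (m s) * exp (- 2 * sqrt (real (m s)))" for s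
  have "err \<in> O(\<lambda>s. 1 / real s ^ 2)"
    unfolding err_def m_def by real_asymp
  moreover have "summable (\<lambda>s. norm (1 / real s ^ 2))"
    using inverse_power_summable[of 2, where 'a=real] by (simp add: inverse_eq_divide)
  ultimately have err: "summable err"
    by (rule summable_comparison_test_bigo[rotated])
  have "\<exists>C. \<forall>t\<ge>1. expert_regret X Q (double_pick a) P t \<le> C * 1" if P: "expert_instance X P" for P
  proof -
    let ?\<mu> = "expert_mean P"
    interpret P: prob_space P using P by (simp add: expert_instance_def)
    interpret Q: prob_space Q by (simp add: Q_def prob_space_return)
    interpret seq: prob_space "\<Pi>\<^sub>M t\<in>(UNIV :: nat set). P"
      by (rule prob_space_PiM) (rule P.prob_space_axioms)
    have cont: "continuous_on X ?\<mu>"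
      using P lipschitz_on_continuous_on by (auto simp: expert_instance_def)
    obtain x \<delta> where x: "x \<in> X" "\<delta> > 0" "\<And>y. y \<in> X \<Longrightarrow> ?\<mu> y \<le> ?\<mu> x"
      "\<And>y. y \<in> X \<Longrightarrow> lt x y \<Longrightarrow> ?\<mu> y \<le> ?\<mu> x - \<delta>"
      by (rule order_maximal_maximizer[OF X(1,2) cont, of lt]) ((rule lt(3); assumption), rule that)
    obtain i0 where i0: "e i0 = x"
      using from_nat_into_surj[OF X(3) x(1)] by (auto simp: e_def)
    have "filterlim m at_top sequentially"
      unfolding m_def by real_asymp
    then have ev1: "\<forall>\<^sub>F s in sequentially. Suc i0 \<le> m s"
      unfolding filterlim_at_top by blast
    have "c \<longlonglongrightarrow> 0"
      unfolding c_def m_def by real_asymp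
    then have ev2: "\<forall>\<^sub>F s in sequentially. c s < \<delta> / 4"
      using x(2) by (intro order_tendstoD) auto
    obtain s0 where s0: "\<And>s. s \<ge> s0 \<Longrightarrow> i0 < m s \<and> c s < \<delta> / 4"
      using eventually_conj[OF ev1 ev2] by (auto simp: eventually_sequentially Suc_le_eq)
    have meas: "\<And>y. y \<in> X \<Longrightarrow> (\<lambda>z. z y) \<in> borel_measurable P"
      using expert_instance_eval(1)[OF P] .
    have G: "G s \<in> (\<Pi>\<^sub>M t\<in>UNIV. P) \<rightarrow>\<^sub>M arms X" for s
      unfolding G_def
      by (intro measurable_compose[OF measurable_leader e_meas] borel_measurable_divide borel_measurable_sum
        borel_measurable_const measurable_compose[OF measurable_component_singleton[of _ UNIV "\<lambda>_. P"] meas[OF e]]) simp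
    have X_x: "X - {x} \<in> sets (arms X)"
      using sets_arms_countable[OF X(3)] by simp
    have ev: "{\<phi>\<in>space (\<Pi>\<^sub>M t\<in>UNIV. P). G s \<phi> \<noteq> x} \<in> seq.events" for s
    proof -
      have "{\<phi>\<in>space (\<Pi>\<^sub>M t\<in>UNIV. P). G s \<phi> \<noteq> x} = G s -` (X - {x}) \<inter> space (\<Pi>\<^sub>M t\<in>UNIV. P)"
        using e by (auto simp: G_def)
      then show ?thesis using measurable_sets[OF G X_x] by simp
    qed
    have \<mu>_meas: "?\<mu> \<in> borel_measurable (arms X)"
      using cont by (rule borel_measurable_continuous_on_restrict)
    have \<mu>G: "(\<lambda>\<phi>. ?\<mu> (G s \<phi>)) \<in> borel_measurable (\<Pi>\<^sub>M t\<in>UNIV. P)" for s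
      using measurable_compose[OF G \<mu>_meas] .
    have \<mu>G01: "?\<mu> (G s \<phi>) \<in> {0..1}" for s \<phi>
      using expert_mean_bounds[OF P e] unfolding G_def .
    have int: "integrable (\<Pi>\<^sub>M t\<in>UNIV. P) (\<lambda>\<phi>. ?\<mu> (G s \<phi>))" for s
      by (rule seq.integrable_const_bound[where B=1]) (use \<mu>G \<mu>G01 in auto)
    define b where "b s = ?\<mu> x - seq.expectation (\<lambda>\<phi>. ?\<mu> (G s \<phi>))" for s
    have loss: "b s \<le> seq.prob {\<phi>\<in>space (\<Pi>\<^sub>M t\<in>UNIV. P). G s \<phi> \<noteq> x}" for s
      unfolding b_def using expert_mean_bounds[OF P x(1)]
      by (intro seq.mean_loss_le_prob[OF \<mu>G \<mu>G01 _ ev]) auto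
    have "b s \<le> err s" if "s \<ge> s0" for s
    proof -
      have pos: "m s > 0" "i0 < m s" "c s < \<delta> / 4" using s0[OF that] by auto
      have "real (m s) * (c s)\<^sup>2 = sqrt (real (m s))"
        using pos by (simp add: c_def power2_eq_square flip: powr_add powr_half_sqrt) (simp add: powr_mult_base)
      moreover have "seq.prob {\<phi>\<in>space (\<Pi>\<^sub>M t\<in>UNIV. P). G s \<phi> \<noteq> x} \<le> 2 * real (m s) * exp (- 2 * real (m s) * (c s)\<^sup>2)"
        unfolding G_def
      proof (rule commit_error[where X=X and \<mu>="?\<mu>" and \<tau>="\<lambda>i l. prod_encode (i, l)" and p=i0])
        show "AE z in P. z y \<in> {0..1}" if "y \<in> X" for y
          using expert_instance_eval(2)[OF P that] by auto
        show "?\<mu> y \<le> ?\<mu> x - 4 * c s" if "y \<in> X" "lt x y" for y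
          using x(4)[OF that] pos(3) by simp
        show "inj_on (\<lambda>l. prod_encode (i, l)) {..<m s}" for i
          by (auto simp: inj_on_def prod_encode_eq)
      qed (use P.prob_space_axioms e meas lt x i0 pos in \<open>auto simp: expert_mean_def c_def\<close>)
      ultimately show ?thesis
        using loss[of s] by (simp add: err_def mult.assoc)
    qed
    moreover have "b s \<le> 1" for s
      using loss[of s] seq.prob_le_1 order_trans by blast
    ultimately have bound: "(\<Sum>s<t. b s) \<le> real s0 + (\<Sum>s. err s)" for t
      by (intro sum_le_initial_plus_suminf err) (auto simp: err_def)
    have "expert_regret X Q (double_pick a) P t = (\<Sum>s<t. b s)" for t
    proof -
      let ?g = "\<lambda>\<phi>. \<Sum>s<t. ?\<mu> (G s \<phi>)"
      have g: "?g \<in> borel_measurable (\<Pi>\<^sub>M t\<in>UNIV. P)"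
        using \<mu>G by (intro borel_measurable_sum)
      have "(\<integral>p. ?g (snd p) \<partial>expert_space Q P) = (\<integral>p. ?g (snd p) \<partial>(Q \<Otimes>\<^sub>M (\<Pi>\<^sub>M t\<in>UNIV. P)))"
        unfolding expert_space_def by (rule integral_completion) (rule measurable_compose[OF measurable_snd g])
      also have "\<dots> = (\<integral>\<phi>. ?g \<phi> \<partial>distr (Q \<Otimes>\<^sub>M (\<Pi>\<^sub>M t\<in>UNIV. P)) (\<Pi>\<^sub>M t\<in>UNIV. P) snd)"
        by (rule integral_distr[OF measurable_snd g, symmetric])
      also have "\<dots> = (\<integral>\<phi>. ?g \<phi> \<partial>(\<Pi>\<^sub>M t\<in>UNIV. P))"
        by (subst distr_pair_snd) (auto intro: Q.prob_space_axioms seq.sigma_finite_measure_axioms)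
      also have "\<dots> = (\<Sum>s<t. seq.expectation (\<lambda>\<phi>. ?\<mu> (G s \<phi>)))"
        using int by (intro Bochner_Integration.integral_sum) auto
      finally show ?thesis
        by (simp add: expert_regret_def pick case_prod_beta' b_def sum_subtractf SUP_eq_maximum[of x X ?\<mu>, OF x(1,3)])
    qed
    with bound show ?thesis by (intro exI[of _ "real s0 + (\<Sum>s. err s)"]) simp
  qed
  with alg show ?thesis
    unfolding double_tractable_def by blast
qed


subsection \<open>Countable spaces: the bandit problem\<close>

text \<open>Each epoch starts at the square of the previous start, so the logarithm of the time at
  most doubles within an epoch. Samples taken at the start therefore buy enough confidence for the
  whole epoch, and the factors \<open>2 ^ j\<close> in the exploration costs sum up
  geometrically.\<close>

definition epoch_start :: "nat \<Rightarrow> nat" where "epoch_start j = 2 ^ 2 ^ j"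

definition epoch :: "nat \<Rightarrow> nat" where "epoch t = (GREATEST j. epoch_start j \<le> t)"

lemma strict_mono_epoch_start: "strict_mono epoch_start"
  by (simp add: strict_mono_Suc_iff epoch_start_def)

lemma epoch_start_ge: "j < epoch_start j" "2 \<le> epoch_start j"
proof -
  have "j < 2 ^ j" by (rule less_exp)
  also have "(2::nat) ^ j < 2 ^ 2 ^ j" by (rule less_exp)
  finally show "j < epoch_start j" by (simp add: epoch_start_def)
  have "(2::nat) ^ 1 \<le> 2 ^ 2 ^ j" by (rule power_increasing) auto
  then show "2 \<le> epoch_start j" by (simp add: epoch_start_def)
qed

lemma epoch_eq:
  assumes "epoch_start j \<le> t" "t < epoch_start (Suc j)"
  shows "epoch t = j"
  unfolding epoch_def
proof (rule Greatest_equality)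
  show "i \<le> j" if "epoch_start i \<le> t" for i
  proof (rule ccontr)
    assume "\<not> i \<le> j"
    then have "epoch_start (Suc j) \<le> epoch_start i"
      using strict_mono_less_eq[OF strict_mono_epoch_start] by simp
    with that assms(2) show False by simp
  qed
qed fact

lemma epoch_bounds:
  assumes "2 \<le> t"
  shows "epoch_start (epoch t) \<le> t" "t < epoch_start (Suc (epoch t))"
proof -
  have bound: "i \<le> t" if "epoch_start i \<le> t" for i
    using epoch_start_ge(1)[of i] that by simp
  have 0: "epoch_start 0 \<le> t" using assms by (simp add: epoch_start_def)
  show "epoch_start (epoch t) \<le> t"
    unfolding epoch_def by (rule GreatestI_nat[where P="\<lambda>j. epoch_start j \<le> t", OF 0 bound])
  show "t < epoch_start (Suc (epoch t))"
  proof (rule ccontr)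
    assume "\<not> ?thesis"
    then have "epoch_start (Suc (epoch t)) \<le> t" by simp
    then have "Suc (epoch t) \<le> (GREATEST j. epoch_start j \<le> t)"
      by (rule Greatest_le_nat) (rule bound)
    then have "Suc (epoch t) \<le> epoch t" by (simp only: epoch_def)
    then show False by simp
  qed
qed

text \<open>\<open>w j\<close> is the largest \<open>k \<le> j\<close> that \<open>f\<close> can
  afford from epoch \<open>j\<close> on; it tends to infinity because \<open>f t / ln t\<close>
  exceeds every \<open>k\<^sup>2\<close> eventually. The square arises as epoch \<open>j\<close>
  explores \<open>w j\<close> arms with a number of samples that is itself proportional to
  \<open>w j\<close>.\<close>

lemma slowly_growing_weights:
  fixes f :: "nat \<Rightarrow> real"
  assumes pos: "\<And>t. t \<ge> 1 \<Longrightarrow> f t > 0" and lim: "filterlim (\<lambda>t. f t / ln (real t)) at_top sequentially"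
  obtains w :: "nat \<Rightarrow> nat" where "\<And>j. w j \<le> j" "filterlim w at_top sequentially"
    "\<And>j t. epoch_start j \<le> t \<Longrightarrow> (real (w j))\<^sup>2 * ln (real t) \<le> f t"
proof -
  define W where "W j = {k\<in>{..j}. \<forall>t\<ge>epoch_start j. (real k)\<^sup>2 * ln (real t) \<le> f t}" for j
  have fin: "finite (W j)" for j by (simp add: W_def)
  have f_pos: "f t > 0" if "epoch_start j \<le> t" for j t
    using pos[of t] epoch_start_ge(2)[of j] that by simp
  have "0 \<in> W j" for j
    using f_pos[of j] by (auto simp: W_def intro: less_imp_le)
  then have Max: "Max (W j) \<in> W j" for j
    using fin by (intro Max_in) auto
  show ?thesis
  proof (rule that)
    show "Max (W j) \<le> j" "\<And>t. epoch_start j \<le> t \<Longrightarrow> (real (Max (W j)))\<^sup>2 * ln (real t) \<le> f t" for j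
      using Max[of j] unfolding W_def by blast+
    show "filterlim (\<lambda>j. Max (W j)) at_top sequentially"
      unfolding filterlim_at_top
    proof
      fix k :: nat
      obtain t0 where t0: "\<And>t. t \<ge> t0 \<Longrightarrow> (real k)\<^sup>2 \<le> f t / ln (real t)"
        using lim unfolding filterlim_at_top eventually_sequentially by blast
      have "k \<le> Max (W j)" if "j \<ge> max k t0" for j
      proof (rule Max_ge[OF fin])
        have "(real k)\<^sup>2 * ln (real t) \<le> f t" if t: "epoch_start j \<le> t" for t
        proof -
          have "t \<ge> t0" "t \<ge> 2"
            using epoch_start_ge[of j] t \<open>j \<ge> max k t0\<close> by auto
          then show ?thesis
            using t0[of t] by (simp add: pos_le_divide_eq)
        qed
        then show "k \<in> W j" using that by (auto simp: W_def)
      qed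
      then show "\<forall>\<^sub>F j in sequentially. k \<le> Max (W j)"
        unfolding eventually_sequentially by blast
    qed
  qed
qed

text \<open>In epoch \<open>j\<close>, \<open>s\<^sup>2\<close> is below
  \<open>2 ^ 2 ^ (j + 2)\<close> and hence below \<open>exp (2 ^ (j + 2))\<close>, and
  \<open>2 * w\<close> is below the same bound. The product of the two bounds is
  \<open>exp (2 ^ (j + 3))\<close>.\<close>

lemma commit_error_le_inverse_square:
  assumes "w \<le> j" "s < epoch_start (Suc j)" "s > 0"
  shows "2 * real w * exp (- (2 ^ (j + 3))) \<le> 1 / (real s)\<^sup>2"
proof -
  let ?E = "2 ^ (j + 2) :: real"
  have exp_ge: "2 ^ n \<le> exp (real n)" for n
  proof -
    have "2 ^ n \<le> exp (1::real) ^ n"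
      using exp_ge_add_one_self[of 1] by (intro power_mono) auto
    then show ?thesis by (simp add: exp_of_nat_mult[symmetric])
  qed
  have "(real s)\<^sup>2 \<le> (real (epoch_start (Suc j)))\<^sup>2"
    using assms(2) by (intro power_mono) auto
  also have "\<dots> = 2 ^ (2 ^ (j + 2))"
    by (simp add: epoch_start_def power_mult[symmetric] mult.commute)
  also have "\<dots> \<le> exp ?E"
    using exp_ge[of "2 ^ (j + 2)"] by simp
  finally have 1: "(real s)\<^sup>2 \<le> exp ?E" .
  have "2 * real w \<le> ?E"
  proof -
    have "real w \<le> real j" "real j < 2 ^ j" "?E = 4 * 2 ^ j"
      using assms(1) of_nat_less_two_power[of j, where 'a=real] by (auto simp: power_add)
    then show ?thesis by linarith
  qed
  also have "\<dots> \<le> exp ?E"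
    using exp_ge_add_one_self[of ?E] by linarith
  finally have 2: "2 * real w \<le> exp ?E" .
  have "2 * real w * (real s)\<^sup>2 \<le> exp ?E * exp ?E"
    using 1 2 by (intro mult_mono) auto
  also have "\<dots> = exp (2 ^ (j + 3))"
    by (simp add: exp_add[symmetric] power_add)
  finally show ?thesis
    using assms(3) by (simp add: exp_minus divide_simps)
qed

lemma card_exploration_le:
  fixes n :: "nat \<Rightarrow> nat"
  shows "card {s. s < t \<and> 2 \<le> s \<and> s - epoch_start (epoch s) < n (epoch s)} \<le> (\<Sum>j\<le>epoch t. n j)"
proof -
  have "{s. s < t \<and> 2 \<le> s \<and> s - epoch_start (epoch s) < n (epoch s)} \<subseteq>
      (\<Union>j\<in>{..epoch t}. {epoch_start j..<epoch_start j + n j})"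
  proof
    fix s assume "s \<in> {s. s < t \<and> 2 \<le> s \<and> s - epoch_start (epoch s) < n (epoch s)}"
    then have s: "s < t" "2 \<le> s" "s - epoch_start (epoch s) < n (epoch s)" by auto
    have "epoch s \<le> epoch t"
    proof (rule ccontr)
      assume "\<not> epoch s \<le> epoch t"
      then have "epoch_start (Suc (epoch t)) \<le> epoch_start (epoch s)"
        using strict_mono_less_eq[OF strict_mono_epoch_start] by simp
      then show False
        using epoch_bounds[of s] epoch_bounds[of t] s by simp
    qed
    then show "s \<in> (\<Union>j\<in>{..epoch t}. {epoch_start j..<epoch_start j + n j})"
      using epoch_bounds[OF s(2)] s(3) by (intro UN_I[of "epoch s"]) auto
  qed
  then have "card {s. s < t \<and> 2 \<le> s \<and> s - epoch_start (epoch s) < n (epoch s)} \<le>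
      card (\<Union>j\<in>{..epoch t}. {epoch_start j..<epoch_start j + n j})"
    by (intro card_mono) auto
  also have "\<dots> \<le> (\<Sum>j\<le>epoch t. card {epoch_start j..<epoch_start j + n j})"
    by (rule card_UN_le) simp
  finally show ?thesis by simp
qed

text \<open>All \<open>j \<le> epoch t\<close> may be charged at the same time \<open>t\<close>:
  multiplied by \<open>ln t\<close>, the cost of epoch \<open>j\<close> is at most
  \<open>2 ^ (j + 2) * f t\<close>. The sum is at most \<open>8 * f t * 2 ^ epoch t\<close>, and
  dividing by \<open>ln t \<ge> 2 ^ epoch t / 2\<close> gives the factor 16.\<close>

lemma exploration_le:
  fixes w :: "nat \<Rightarrow> nat" and f :: "nat \<Rightarrow> real"
  assumes w: "\<And>j t. epoch_start j \<le> t \<Longrightarrow> (real (w j))\<^sup>2 * ln (real t) \<le> f t" and "2 \<le> t"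
  shows "real (\<Sum>j\<le>epoch t. w j * (2 ^ (j + 2) * w j)) \<le> 16 * f t"
proof -
  let ?J = "epoch t"
  let ?S = "\<Sum>j\<le>?J. w j * (2 ^ (j + 2) * w j)"
  have "ln (real (epoch_start ?J)) \<le> ln (real t)"
    using epoch_bounds(1)[OF \<open>2 \<le> t\<close>] epoch_start_ge(2)[of ?J] by (intro ln_mono) auto
  moreover have "ln (real (epoch_start ?J)) = 2 ^ ?J * ln 2"
    by (simp add: epoch_start_def ln_realpow)
  moreover have "2 ^ ?J * (1/2) \<le> 2 ^ ?J * ln (2::real)"
    using ln2_ge_two_thirds by (intro mult_left_mono) auto
  ultimately have ln: "2 ^ ?J / 2 \<le> ln (real t)" by linarith
  have "ln (real t) * real ?S = (\<Sum>j\<le>?J. 2 ^ (j + 2) * ((real (w j))\<^sup>2 * ln (real t)))"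
    by (simp add: sum_distrib_left power2_eq_square mult_ac)
  also have "\<dots> \<le> (\<Sum>j\<le>?J. 2 ^ (j + 2) * f t)"
  proof (intro sum_mono mult_left_mono w)
    fix j assume "j \<in> {..?J}"
    then have "epoch_start j \<le> epoch_start ?J"
      using strict_mono_less_eq[OF strict_mono_epoch_start] by simp
    then show "epoch_start j \<le> t"
      using epoch_bounds(1)[OF \<open>2 \<le> t\<close>] by simp
  qed simp
  also have "\<dots> = 4 * f t * (\<Sum>j\<le>?J. 2 ^ j)"
    by (simp add: sum_distrib_left power_add mult_ac)
  also have "\<dots> \<le> 4 * f t * 2 ^ Suc ?J"
  proof (rule mult_left_mono)
    show "(\<Sum>j\<le>?J. 2 ^ j) \<le> (2 ^ Suc ?J :: real)"
      using sum_gp_basic[of "2::real" ?J] by (simp add: lessThan_Suc_atMost[symmetric] sum_gp_strict)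
    have "0 \<le> (real (w 0))\<^sup>2 * ln (real t)" using \<open>2 \<le> t\<close> by simp
    also have "\<dots> \<le> f t" using \<open>2 \<le> t\<close> by (intro w) (simp add: epoch_start_def)
    finally show "0 \<le> 4 * f t" by simp
  qed
  finally have *: "ln (real t) * real ?S \<le> 8 * f t * 2 ^ ?J" by simp
  define S where "S = real ?S"
  have "2 ^ ?J / 2 * S \<le> ln (real t) * S"
    unfolding S_def by (rule mult_right_mono[OF ln of_nat_0_le_iff])
  also have "\<dots> \<le> 8 * f t * 2 ^ ?J"
    using * unfolding S_def .
  finally have "2 ^ ?J * S \<le> 2 ^ ?J * (16 * f t)" by (simp add: mult_ac)
  then show ?thesis unfolding S_def[symmetric] by simp
qed

text \<open>Needed to absorb the additive constant of the regret into a multiple of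
  \<open>f t\<close>, also at small \<open>t\<close>. Eventually \<open>f t\<close> is at least
  \<open>ln t\<close>, and the finitely many earlier values are positive.\<close>

lemma positive_lower_bound:
  fixes f :: "nat \<Rightarrow> real"
  assumes pos: "\<And>t. t \<ge> 1 \<Longrightarrow> f t > 0" and lim: "filterlim (\<lambda>t. f t / ln (real t)) at_top sequentially"
  obtains \<eta> where "\<eta> > 0" "\<And>t. t \<ge> 1 \<Longrightarrow> \<eta> \<le> f t"
proof -
  have "\<forall>\<^sub>F t in sequentially. 1 \<le> f t / ln (real t)"
    using lim unfolding filterlim_at_top by blast
  then obtain t0 where t0: "\<And>t. t \<ge> t0 \<Longrightarrow> 1 \<le> f t / ln (real t)"
    unfolding eventually_sequentially by blast
  define \<eta> where "\<eta> = Min (insert (ln 2) (f ` {1..t0 + 2}))"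
  show ?thesis
  proof (rule that)
    show "\<eta> > 0" unfolding \<eta>_def using pos by (subst Min_gr_iff) auto
    show "\<eta> \<le> f t" if "t \<ge> 1" for t
    proof (cases "t \<le> t0 + 2")
      case True
      then show ?thesis unfolding \<eta>_def using that by (intro Min_le) auto
    next
      case False
      then have "ln 2 \<le> ln (real t)" by simp
      also have "\<dots> \<le> f t"
        using t0[of t] False by (simp add: pos_le_divide_eq)
      finally have "ln 2 \<le> f t" .
      moreover have "\<eta> \<le> ln 2" unfolding \<eta>_def by (intro Min_le) auto
      ultimately show ?thesis by simp
    qed
  qed
qed

theorem countable_imp_mab_tractable:
  fixes X :: "'a::metric_space set" and f :: "nat \<Rightarrow> real"
  assumes X: "compact X" "X \<noteq> {}" "countable X"
    and f: "\<And>t. t \<ge> 1 \<Longrightarrow> f t > 0" "filterlim (\<lambda>t. f t / ln (real t)) at_top sequentially"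
  shows "mab_tractable X f"
proof -
  obtain lt :: "'a \<Rightarrow> 'a \<Rightarrow> bool" where lt: "\<And>x y. lt x y \<Longrightarrow> \<not> lt y x"
    "\<And>x y. x \<in> X \<Longrightarrow> y \<in> X \<Longrightarrow> x \<noteq> y \<Longrightarrow> lt x y \<or> lt y x"
    "\<And>S. compact S \<Longrightarrow> S \<noteq> {} \<Longrightarrow> S \<subseteq> X \<Longrightarrow> \<exists>x\<in>S. (\<forall>y\<in>S. \<not> lt x y) \<and> compact {y\<in>X. lt x y}"
    by (rule countable_compact_order[OF X(1,3)]) (rule that)
  define e where "e = from_nat_into X"
  have e: "e i \<in> X" for i
    using X(2) by (simp add: e_def from_nat_into)
  obtain w where w: "\<And>j. w j \<le> j" "filterlim w at_top sequentially"
    "\<And>j t. epoch_start j \<le> t \<Longrightarrow> (real (w j))\<^sup>2 * ln (real t) \<le> f t"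
    by (rule slowly_growing_weights[OF f]) (assumption, rule that)
  \<comment> \<open>\<open>n j\<close> samples for each of \<open>w j\<close> arms. The choices give
    \<open>n j * (c j)\<^sup>2 = 2 ^ (j + 2)\<close>, the exponent required by
    \<open>commit_error_le_inverse_square\<close>, and \<open>c j\<close> tends to 0. Block
    \<open>i\<close> of length \<open>n j\<close> in epoch \<open>j\<close> samples arm
    \<open>e i\<close>.\<close>
  define n where "n j = 2 ^ (j + 2) * w j" for j
  define c where "c j = 1 / sqrt (real (w j))" for j
  define \<tau> where "\<tau> j i l = epoch_start j + i * n j + l" for j i l
  \<comment> \<open>Rounds 0 and 1 precede \<open>epoch_start 0 = 2\<close> and belong to no
    epoch.\<close>
  define explore where "explore t \<longleftrightarrow> t < 2 \<or> t - epoch_start (epoch t) < w (epoch t) * n (epoch t)" for t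
  define a :: "nat \<Rightarrow> real \<Rightarrow> (nat \<Rightarrow> real) \<Rightarrow> 'a" where "a = (\<lambda>t \<omega> r. let j = epoch t in
    if explore t then e ((t - epoch_start j) div n j)
    else e (leader lt e (w j) (c j) (\<lambda>i. (\<Sum>l<n j. r (\<tau> j i l)) / real (n j))))"
  define Q :: "real measure" where "Q = return borel 0"
  have \<tau>_less: "\<tau> (epoch t) i l < t" if "\<not> explore t" "i < w (epoch t)" "l < n (epoch t)" for t i l
  proof -
    let ?j = "epoch t"
    have "i * n ?j + l < Suc i * n ?j" using that(3) by simp
    also have "\<dots> \<le> w ?j * n ?j" using that(2) by (intro mult_le_mono1) simp
    finally show ?thesis
      using that(1) epoch_bounds(1)[of t] by (auto simp: explore_def \<tau>_def)
  qed
  have e_meas: "(\<lambda>i. e i) \<in> count_space UNIV \<rightarrow>\<^sub>M arms X"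
    using e by (simp add: space_restrict_space)
  have alg: "mab_algorithm X Q a"
    unfolding mab_algorithm_def
  proof (intro conjI allI)
    show "seed_law Q" by (simp add: Q_def seed_law_return)
    fix t :: nat
    let ?M = "Q \<Otimes>\<^sub>M (\<Pi>\<^sub>M s\<in>{..<t}. (borel :: real measure))"
    let ?j = "epoch t"
    show "(\<lambda>(\<omega>, r). a t \<omega> r) \<in> ?M \<rightarrow>\<^sub>M arms X"
    proof (cases "explore t")
      case True
      then show ?thesis by (simp add: a_def Let_def case_prod_beta' space_restrict_space e)
    next
      case False
      have "(\<lambda>p. (\<Sum>l<n ?j. snd p (\<tau> ?j i l)) / real (n ?j)) \<in> borel_measurable ?M" if "i < w ?j" for i
      proof (intro borel_measurable_divide borel_measurable_sum borel_measurable_const)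
        fix l assume "l \<in> {..<n ?j}"
        then have "\<tau> ?j i l \<in> {..<t}" using \<tau>_less[OF False that] by simp
        from measurable_compose[OF measurable_snd measurable_component_singleton[OF this]]
        show "(\<lambda>p. snd p (\<tau> ?j i l)) \<in> borel_measurable ?M" .
      qed
      from measurable_compose[OF measurable_leader[OF this] e_meas]
      show ?thesis using False by (simp add: a_def Let_def case_prod_beta')
    qed
  qed
  define G where "G t \<kappa> = e (leader lt e (w (epoch t)) (c (epoch t))
      (\<lambda>i. (\<Sum>l<n (epoch t). \<kappa> (\<tau> (epoch t) i l) (e i)) / real (n (epoch t))))"
    for t :: nat and \<kappa> :: "nat \<Rightarrow> 'a \<Rightarrow> real"
  have pick: "a t \<omega> (mab_run a (\<lambda>z. z) \<omega> \<kappa> t) = G t \<kappa>" if "\<not> explore t" for t \<omega> and \<kappa> :: "nat \<Rightarrow> 'a \<Rightarrow> real"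
  proof -
    let ?j = "epoch t"
    have "mab_run a (\<lambda>z. z) \<omega> \<kappa> t (\<tau> ?j i l) = \<kappa> (\<tau> ?j i l) (e i)" if il: "i < w ?j" "l < n ?j" for i l
    proof -
      let ?s = "\<tau> ?j i l"
      have t: "2 \<le> t" using \<open>\<not> explore t\<close> by (simp add: explore_def)
      have less: "?s < t" by (rule \<tau>_less[OF \<open>\<not> explore t\<close> il])
      have s: "epoch_start ?j \<le> ?s" by (simp add: \<tau>_def)
      have ep: "epoch ?s = ?j"
        using less epoch_bounds(2)[OF t] by (intro epoch_eq[OF s]) simp
      have "i * n ?j + l < Suc i * n ?j" using il by simp
      also have "\<dots> \<le> w ?j * n ?j" using il by (intro mult_le_mono1) simp
      finally have "explore ?s" by (simp add: explore_def ep) (simp add: \<tau>_def)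
      moreover have "(?s - epoch_start ?j) div n ?j = i"
        using il by (simp add: \<tau>_def)
      ultimately have "a ?s \<omega> r = e i" for r
        by (simp add: a_def ep)
      then show ?thesis by (simp add: mab_run_nth[OF less])
    qed
    then have "leader lt e (w ?j) (c ?j) (\<lambda>i. (\<Sum>l<n ?j. mab_run a (\<lambda>z. z) \<omega> \<kappa> t (\<tau> ?j i l)) / real (n ?j)) =
        leader lt e (w ?j) (c ?j) (\<lambda>i. (\<Sum>l<n ?j. \<kappa> (\<tau> ?j i l) (e i)) / real (n ?j))"
      by (intro leader_cong) simp
    then show ?thesis using that by (simp add: a_def G_def Let_def)
  qed
  obtain \<eta> where \<eta>: "\<eta> > 0" "\<And>t. t \<ge> 1 \<Longrightarrow> \<eta> \<le> f t"
    by (rule positive_lower_bound[OF f]) (assumption, rule that)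
  have "\<exists>C. \<forall>t\<ge>1. mab_regret X Q a \<mu> \<nu> t \<le> C * f t" if inst: "mab_instance X \<mu> \<nu>" for \<mu> \<nu>
  proof -
    have \<mu>01: "\<mu> y \<in> {0..1}" if "y \<in> X" for y
      using inst that by (auto simp: mab_instance_def)
    have cont: "continuous_on X \<mu>"
      using inst lipschitz_on_continuous_on by (auto simp: mab_instance_def)
    have \<nu>_alg: "\<nu> \<in> arms X \<rightarrow>\<^sub>M prob_algebra borel"
      using inst by (simp add: mab_instance_def)
    have \<nu>_prob: "prob_space (\<nu> y)" "sets (\<nu> y) = sets borel" if "y \<in> X" for y
      using measurable_space[OF \<nu>_alg, of y] that by (auto simp: space_prob_algebra space_restrict_space)
    have \<nu>_AE: "AE v in \<nu> y. v \<in> {0..1}" and \<nu>_mean: "(\<integral>v. v \<partial>\<nu> y) = \<mu> y" if "y \<in> X" for y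
      using inst that by (auto simp: mab_instance_def)
    \<comment> \<open>The tape carries payoff functions with independent values at the different
      arms, one coupling with the marginals that \<open>mab_law_eq\<close> asks for. The default
      outside \<open>X\<close> supplies a probability measure at every index, as the locale of
      product measures demands. Countability of \<open>X\<close> makes evaluation jointly
      measurable.\<close>
    define \<nu>' where "\<nu>' y = (if y \<in> X then \<nu> y else return borel 0)" for y
    interpret N': product_prob_space \<nu>' X
      by (intro product_prob_spaceI) (auto simp: \<nu>'_def \<nu>_prob prob_space_return)
    define N where "N = PiM X \<nu>'"
    have N: "prob_space N" unfolding N_def by (rule N'.prob_space_axioms)
    interpret N: prob_space N by (rule N)
    have eval: "(\<lambda>z. z y) \<in> N \<rightarrow>\<^sub>M \<nu>' y" if "y \<in> X" for y
      unfolding N_def using that by simp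
    have meas: "(\<lambda>z. z y) \<in> borel_measurable N" if "y \<in> X" for y
      using eval[OF that] \<nu>_prob(2)[OF that] that by (simp add: \<nu>'_def cong: measurable_cong_sets)
    have comp: "distr N (\<nu>' y) (\<lambda>z. z y) = \<nu>' y" if "y \<in> X" for y
      unfolding N_def using that by (rule N'.PiM_component)
    have \<nu>_eq: "\<nu> y = distr N borel (\<lambda>z. z y)" if "y \<in> X" for y
      using comp[OF that] distr_cong[OF refl, of borel "\<nu>' y" N "\<lambda>z. z y" "\<lambda>z. z y"] \<nu>_prob(2)[OF that] that
      by (simp add: \<nu>'_def)
    have bdd: "AE z in N. z y \<in> {0..1}" if "y \<in> X" for y
      using \<nu>_AE[OF that] by (subst (asm) \<nu>_eq[OF that]) (simp add: AE_distr_iff meas that)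
    have mean: "(\<integral>z. z y \<partial>N) = \<mu> y" if "y \<in> X" for y
      using \<nu>_mean[OF that] meas[OF that] by (simp add: \<nu>_eq[OF that] integral_distr)
    have F: "(\<lambda>(z, y). z y) \<in> borel_measurable (N \<Otimes>\<^sub>M arms X)"
    proof -
      have "(\<lambda>p. (fst p) (snd p)) \<in> borel_measurable (N \<Otimes>\<^sub>M count_space X)"
        by (rule measurable_compose_countable'[where f="\<lambda>y p. (fst p) y" and I=X])
          (use X(3) meas in \<open>auto intro: measurable_compose[OF measurable_fst]\<close>)
      then show ?thesis
        using measurable_cong_sets[OF sets_pair_measure_cong[OF refl[of "sets N"] arms_countable[OF X(3)]]
            refl[of "sets (borel :: real measure)"]]
        unfolding case_prod_beta' by (simp only:)
    qed
    interpret tape: mab_tape X Q a N "\<lambda>z. z"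
      by (intro mab_tape.intro mab_tape_axioms.intro N alg F)
    obtain x \<delta> where x: "x \<in> X" "\<delta> > 0" "\<And>y. y \<in> X \<Longrightarrow> \<mu> y \<le> \<mu> x"
      "\<And>y. y \<in> X \<Longrightarrow> lt x y \<Longrightarrow> \<mu> y \<le> \<mu> x - \<delta>"
      by (rule order_maximal_maximizer[OF X(1,2) cont, of lt]) ((rule lt(3); assumption), rule that)
    obtain i0 where i0: "e i0 = x"
      using from_nat_into_surj[OF X(3) x(1)] by (auto simp: e_def)
    obtain j0 where j0: "\<And>j. j \<ge> j0 \<Longrightarrow> i0 < w j \<and> c j < \<delta> / 4"
    proof -
      have "\<forall>\<^sub>F j in sequentially. Suc i0 \<le> w j"
        using w(2) unfolding filterlim_at_top by blast
      moreover have "c \<longlonglongrightarrow> 0"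
      proof -
        have "(\<lambda>k. 1 / sqrt (real k)) \<longlonglongrightarrow> 0" by real_asymp
        from filterlim_compose[OF this w(2)] show ?thesis by (simp add: c_def[abs_def])
      qed
      then have "\<forall>\<^sub>F j in sequentially. c j < \<delta> / 4"
        using x(2) by (intro order_tendstoD) auto
      ultimately have "\<forall>\<^sub>F j in sequentially. Suc i0 \<le> w j \<and> c j < \<delta> / 4"
        by (rule eventually_conj)
      then show ?thesis
        using that by (auto simp: eventually_sequentially Suc_le_eq)
    qed
    have \<mu>_meas: "\<mu> \<in> borel_measurable (arms X)"
      using cont by (rule borel_measurable_continuous_on_restrict)
    let ?p = "\<lambda>s p. a s (fst p) (mab_run a (\<lambda>z. z) (fst p) (snd p) s)"
    have pX: "?p s q \<in> X" for s q
      using e by (auto simp: a_def Let_def)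
    have \<mu>p: "(\<lambda>p. \<mu> (?p s p)) \<in> borel_measurable tape.tape" for s
      using measurable_compose[OF tape.measurable_pick \<mu>_meas] .
    have \<mu>p01: "\<mu> (?p s q) \<in> {0..1}" for s q
      using \<mu>01[OF pX] .
    have int: "integrable tape.tape (\<lambda>p. \<mu> (?p s p))" for s
      by (rule tape.pair.integrable_const_bound[where B=1]) (use \<mu>p \<mu>p01 in auto)
    define b where "b s = \<mu> x - tape.pair.expectation (\<lambda>p. \<mu> (?p s p))" for s
    have b1: "b s \<le> 1" for s
    proof -
      have "0 \<le> tape.pair.expectation (\<lambda>p. \<mu> (?p s p))"
        using \<mu>p01 by (intro Bochner_Integration.integral_nonneg) auto
      then show ?thesis using \<mu>01[OF x(1)] by (simp add: b_def)
    qed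
    have b_commit: "b s \<le> 1 / (real s)\<^sup>2" if s: "s \<ge> epoch_start j0" "\<not> explore s" for s
    proof -
      let ?j = "epoch s"
      have s2: "2 \<le> s" using s(2) by (simp add: explore_def)
      have "j0 \<le> ?j"
      proof (rule ccontr)
        assume "\<not> j0 \<le> ?j"
        then have "epoch_start (Suc ?j) \<le> epoch_start j0"
          using strict_mono_less_eq[OF strict_mono_epoch_start] by simp
        with s(1) epoch_bounds(2)[OF s2] show False by simp
      qed
      then have pos: "w ?j > 0" "i0 < w ?j" "c ?j < \<delta> / 4" "n ?j > 0"
        using j0[of ?j] by (auto simp: n_def)
      define Bad where "Bad = {\<kappa>\<in>space (\<Pi>\<^sub>M t\<in>UNIV. N). G s \<kappa> \<noteq> x}"
      have G: "G s \<in> (\<Pi>\<^sub>M t\<in>UNIV. N) \<rightarrow>\<^sub>M arms X"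
        unfolding G_def
        by (intro measurable_compose[OF measurable_leader e_meas] borel_measurable_divide borel_measurable_sum
          borel_measurable_const measurable_compose[OF measurable_component_singleton[of _ UNIV "\<lambda>_. N"] meas[OF e]]) simp
      have X_x: "X - {x} \<in> sets (arms X)"
        using sets_arms_countable[OF X(3)] by simp
      have "Bad = G s -` (X - {x}) \<inter> space (\<Pi>\<^sub>M t\<in>UNIV. N)"
        using e by (auto simp: G_def Bad_def)
      then have Bad: "Bad \<in> tape.seq.events"
        using measurable_sets[OF G X_x] by simp
      have "b s \<le> tape.pair.prob (space Q \<times> Bad)"
        unfolding b_def
      proof (rule tape.pair.mean_loss_le_prob[OF \<mu>p \<mu>p01])
        show "\<mu> x \<le> 1" using \<mu>01[OF x(1)] by simp
        show "space Q \<times> Bad \<in> tape.pair.events" using Bad by simp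
        fix q assume q: "q \<in> space tape.tape" "q \<notin> space Q \<times> Bad"
        then have "snd q \<notin> Bad" "snd q \<in> space (\<Pi>\<^sub>M t\<in>UNIV. N)" by (auto simp: space_pair_measure)
        then have "G s (snd q) = x" by (simp add: Bad_def)
        then show "\<mu> (?p s q) = \<mu> x" by (simp add: pick[OF s(2)])
      qed
      also have "\<dots> = tape.seq.prob Bad"
        using Bad by (simp add: measure_def tape.seq.emeasure_pair_measure_Times tape.Q.emeasure_space_1)
      also have "\<dots> \<le> 2 * real (w ?j) * exp (- 2 * real (n ?j) * (c ?j)\<^sup>2)"
        unfolding Bad_def G_def
      proof (rule commit_error[where X=X and \<mu>=\<mu> and \<tau>="\<tau> (epoch s)" and p=i0])
        show "\<mu> y \<le> \<mu> x - 4 * c ?j" if "y \<in> X" "lt x y" for y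
          using x(4)[OF that] pos(3) by simp
        show "inj_on (\<tau> ?j i) {..<n ?j}" for i
          by (auto simp: inj_on_def \<tau>_def)
      qed (use N e meas lt x i0 pos bdd mean in \<open>auto simp: c_def\<close>)
      also have "real (n ?j) * (c ?j)\<^sup>2 = 2 ^ (?j + 2)"
        using pos by (simp add: n_def c_def power_divide)
      then have "- 2 * real (n ?j) * (c ?j)\<^sup>2 = - (2 ^ (?j + 3))"
        by (simp add: power_add)
      also have "2 * real (w ?j) * exp (- (2 ^ (?j + 3))) \<le> 1 / (real s)\<^sup>2"
        using epoch_bounds(2)[OF s2] s2 w(1) by (intro commit_error_le_inverse_square) auto
      finally show ?thesis .
    qed
    have sq: "summable (\<lambda>s. 1 / (real s)\<^sup>2)"
      using inverse_power_summable[of 2, where 'a=real] by (simp add: inverse_eq_divide)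
    define K where "K = real (epoch_start j0) + (\<Sum>s. 1 / (real s)\<^sup>2) + 2"
    have "0 \<le> (\<Sum>s. 1 / (real s)\<^sup>2)" by (intro suminf_nonneg sq) simp
    then have "K \<ge> 0" by (simp add: K_def)
    have regret: "mab_regret X Q a \<mu> \<nu> t = (\<Sum>s<t. b s)" for t
      using int by (subst tape.mab_regret_eq[OF inst \<nu>_eq])
        (simp_all add: b_def sum_subtractf SUP_eq_maximum[of x X \<mu>, OF x(1,3)])
    have "mab_regret X Q a \<mu> \<nu> t \<le> (K / \<eta> + 16) * f t" if t: "t \<ge> 1" for t
    proof -
      let ?E = "{s. s < t \<and> 2 \<le> s \<and> s - epoch_start (epoch s) < w (epoch s) * n (epoch s)}"
      \<comment> \<open>Exploring rounds inside an epoch are counted by \<open>?E\<close> at cost at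
        most 1 each. The remaining sum contains rounds 0 and 1 and the committed rounds, whose
        losses are summable from epoch \<open>j0\<close> on.\<close>
      have "(\<Sum>s<t. b s) \<le> (\<Sum>s<t. (if s \<in> ?E then 1 else 0) + (if explore s then if s < 2 then 1 else 0 else b s))"
        using b1 by (intro sum_mono) (auto simp: explore_def)
      also have "\<dots> = real (card ({..<t} \<inter> ?E)) + (\<Sum>s<t. if explore s then if s < 2 then 1 else 0 else b s)"
        by (simp only: sum.distrib) (auto simp: sum.If_cases intro!: arg_cong[where f=card])
      also have "{..<t} \<inter> ?E = ?E" by auto
      also have "(\<Sum>s<t. if explore s then if s < 2 then 1 else 0 else b s) \<le> real (max 2 (epoch_start j0)) + (\<Sum>s. 1 / (real s)\<^sup>2)"
        by (rule sum_le_initial_plus_suminf[OF _ _ sq]) (use b1 b_commit in auto)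
      also have "\<dots> \<le> K" by (simp add: K_def)
      finally have 1: "mab_regret X Q a \<mu> \<nu> t \<le> real (card ?E) + K" by (simp add: regret)
      have "K = (K / \<eta>) * \<eta>" using \<eta>(1) by simp
      also have "\<dots> \<le> (K / \<eta>) * f t" using \<eta> \<open>K \<ge> 0\<close> t by (intro mult_left_mono) auto
      finally have 2: "K \<le> (K / \<eta>) * f t" .
      have "real (card ?E) \<le> 16 * f t"
      proof (cases "t < 2")
        case True
        then have E: "?E = {}" by auto
        show ?thesis unfolding E using f(1)[OF t] by simp
      next
        case False
        have "real (card ?E) \<le> real (\<Sum>j\<le>epoch t. w j * n j)"
          by (intro of_nat_mono card_exploration_le)
        also have "\<dots> \<le> 16 * f t"
          unfolding n_def using False by (intro exploration_le w(3)) auto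
        finally show ?thesis .
      qed
      with 1 2 show ?thesis by (simp add: distrib_right)
    qed
    then show ?thesis by blast
  qed
  with alg show ?thesis
    unfolding mab_tractable_def by blast
qed


subsection \<open>Products of biased coins\<close>

lemma expectation_change_pmf:
  fixes f :: "'z \<Rightarrow> real"
  assumes "\<And>z. pmf p z = pmf q z * W z"
  shows "measure_pmf.expectation p f = measure_pmf.expectation q (\<lambda>z. W z * f z)"
proof -
  have "measure_pmf.expectation p' g = (\<integral>z. pmf p' z * g z \<partial>count_space UNIV)" for p' and g :: "'z \<Rightarrow> real"
    unfolding measure_pmf_eq_density[of p'] by (simp add: integral_density)
  then show ?thesis by (simp add: assms mult_ac)
qed

lemma integrable_measure_pmf_bounded:
  fixes g :: "'z \<Rightarrow> real"
  assumes "\<And>x. \<bar>g x\<bar> \<le> B"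
  shows "integrable (measure_pmf q) g"
  by (rule measure_pmf.integrable_const_bound[where B=B]) (use assms in auto)

text \<open>
  \<open>W\<close> below is the likelihood ratio of the two product laws. Its second moment factorizes, and the
  Cauchy-Schwarz inequality turns it into a bound on the total variation distance.
\<close>

lemma Pi_pmf_expectation_diff:
  fixes p q :: "'z pmf" and Z :: "(nat \<Rightarrow> 'z) \<Rightarrow> real"
  assumes pq: "\<And>z. pmf p z = pmf q z * (1 + L z)" and L: "\<And>z. \<bar>L z\<bar> \<le> \<eta>" "\<eta> \<le> 1"
    and Z: "\<And>x. Z x \<in> {0..1}"
  shows "\<bar>measure_pmf.expectation (Pi_pmf {..<T} d (\<lambda>_. p)) Z - measure_pmf.expectation (Pi_pmf {..<T} d (\<lambda>_. q)) Z\<bar>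
    \<le> sqrt ((1 + \<eta>\<^sup>2) ^ T - 1)"
proof -
  let ?p = "Pi_pmf {..<T} d (\<lambda>_. p)" and ?q = "Pi_pmf {..<T} d (\<lambda>_. q)"
  define W where "W x = (\<Prod>i<T. 1 + L (x i))" for x :: "nat \<Rightarrow> 'z"
  have L': "0 \<le> 1 + L z" "1 + L z \<le> 2" for z
    using L(1)[of z] L(2) by (auto simp: abs_le_iff)
  have W: "0 \<le> W x" "W x \<le> 2 ^ T" for x
    using L' prod_nonneg[of "{..<T}" "\<lambda>i. 1 + L (x i)"] prod_mono[of "{..<T}" "\<lambda>i. 1 + L (x i)" "\<lambda>_. 2"]
    by (auto simp: W_def)
  have eq: "pmf ?p x = pmf ?q x * W x" for x
    by (cases "\<forall>i. i \<notin> {..<T} \<longrightarrow> x i = d") (auto simp: pmf_Pi pq W_def prod.distrib)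
  have intL: "integrable (measure_pmf q) L"
    using L(1) by (rule integrable_measure_pmf_bounded)
  have L2: "(L z)\<^sup>2 \<le> \<eta>\<^sup>2" for z
    using power_mono[OF L(1)[of z], of 2] by simp
  have intL2: "integrable (measure_pmf q) (\<lambda>z. (L z)\<^sup>2)"
    by (rule integrable_measure_pmf_bounded[where B="\<eta>\<^sup>2"]) (use L2 in auto)
  have EL: "measure_pmf.expectation q (\<lambda>z. 1 + L z) = 1"
    using expectation_change_pmf[OF pq, of "\<lambda>_. 1"] by simp
  then have EL0: "measure_pmf.expectation q L = 0"
    using intL by simp
  have "measure_pmf.expectation q (\<lambda>z. (1 + L z)\<^sup>2) = 1 + measure_pmf.expectation q (\<lambda>z. (L z)\<^sup>2)"
    using intL intL2 EL0 by (simp add: power2_sum)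
  also have "measure_pmf.expectation q (\<lambda>z. (L z)\<^sup>2) \<le> measure_pmf.expectation q (\<lambda>_. \<eta>\<^sup>2)"
    using intL2 L2 by (intro integral_mono) auto
  finally have EL2: "measure_pmf.expectation q (\<lambda>z. (1 + L z)\<^sup>2) \<le> 1 + \<eta>\<^sup>2" by simp
  have intW: "integrable (measure_pmf ?q) W"
    by (rule integrable_measure_pmf_bounded[where B="2 ^ T"]) (use W in auto)
  have W2: "(W x)\<^sup>2 = (\<Prod>i<T. (1 + L (x i))\<^sup>2)" for x
    by (simp add: W_def prod_power_distrib)
  have intW2: "integrable (measure_pmf ?q) (\<lambda>x. (W x)\<^sup>2)"
    by (rule integrable_measure_pmf_bounded[where B="(2 ^ T)\<^sup>2"]) (use W power_mono in auto)
  have EW: "measure_pmf.expectation ?q W = 1"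
    unfolding W_def using intL L' EL by (subst expectation_prod_Pi_pmf) auto
  have "measure_pmf.expectation ?q (\<lambda>x. (W x)\<^sup>2) = (measure_pmf.expectation q (\<lambda>z. (1 + L z)\<^sup>2)) ^ T"
    unfolding W2
  proof (subst expectation_prod_Pi_pmf)
    show "integrable (measure_pmf q) (\<lambda>z. (1 + L z)\<^sup>2)"
      using intL intL2 by (simp add: power2_sum)
  qed auto
  also have "\<dots> \<le> (1 + \<eta>\<^sup>2) ^ T"
    using EL2 by (intro power_mono) auto
  finally have EW2: "measure_pmf.expectation ?q (\<lambda>x. (W x)\<^sup>2) \<le> (1 + \<eta>\<^sup>2) ^ T" .
  have intA: "integrable (measure_pmf ?q) (\<lambda>x. \<bar>W x - 1\<bar>)"
    using intW by simp
  \<comment> \<open>The Cauchy-Schwarz inequality, as nonnegativity of the variance of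
    \<open>\<bar>W x - 1\<bar>\<close>.\<close>
  have "(measure_pmf.expectation ?q (\<lambda>x. \<bar>W x - 1\<bar>))\<^sup>2 \<le> measure_pmf.expectation ?q (\<lambda>x. \<bar>W x - 1\<bar>\<^sup>2)"
    using measure_pmf.variance_positive[of ?q "\<lambda>x. \<bar>W x - 1\<bar>"] intA intW intW2
    by (subst (asm) measure_pmf.variance_eq) (auto simp: power2_diff)
  also have "\<dots> = measure_pmf.expectation ?q (\<lambda>x. (W x)\<^sup>2) - 1"
    using intW intW2 EW by (simp add: power2_diff)
  also have "\<dots> \<le> (1 + \<eta>\<^sup>2) ^ T - 1"
    using EW2 by simp
  finally have CS: "measure_pmf.expectation ?q (\<lambda>x. \<bar>W x - 1\<bar>) \<le> sqrt ((1 + \<eta>\<^sup>2) ^ T - 1)"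
    by (rule real_le_rsqrt)
  have intZ: "integrable (measure_pmf ?q) Z"
    by (rule integrable_measure_pmf_bounded[where B=1]) (use Z in auto)
  have intWZ: "integrable (measure_pmf ?q) (\<lambda>x. W x * Z x)"
  proof (rule integrable_measure_pmf_bounded[where B="2 ^ T"])
    fix x show "\<bar>W x * Z x\<bar> \<le> 2 ^ T"
      using W[of x] Z[of x] mult_mono[of "W x" "2 ^ T" "Z x" 1] by simp
  qed
  have "measure_pmf.expectation ?p Z - measure_pmf.expectation ?q Z = measure_pmf.expectation ?q (\<lambda>x. W x * Z x - Z x)"
    unfolding expectation_change_pmf[OF eq] using intZ intWZ by simp
  also have "\<bar>\<dots>\<bar> \<le> measure_pmf.expectation ?q (\<lambda>x. \<bar>W x * Z x - Z x\<bar>)"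
    by (rule integral_abs_bound)
  also have "\<dots> \<le> measure_pmf.expectation ?q (\<lambda>x. \<bar>W x - 1\<bar>)"
  proof (rule integral_mono)
    fix x
    have "W x * Z x - Z x = (W x - 1) * Z x" by (simp add: algebra_simps)
    then show "\<bar>W x * Z x - Z x\<bar> \<le> \<bar>W x - 1\<bar>"
      using Z[of x] mult_left_mono[of "Z x" 1 "\<bar>W x - 1\<bar>"] by (simp add: abs_mult)
  qed (use intZ intWZ intA in auto)
  also note CS
  finally show ?thesis .
qed

lemma sets_PiM_pmf: "sets (\<Pi>\<^sub>M i\<in>I. measure_pmf p) = sets (\<Pi>\<^sub>M i\<in>I. count_space UNIV)"
  by (rule sets_PiM_cong) simp_all

text \<open>The laws of infinitely many rounds under different biases need not have a density with
  respect to each other. For a quantity that reads only the first \<open>T\<close> rounds one may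
  pass to a finite product, where the likelihood ratio of \<open>Pi_pmf_expectation_diff\<close>
  exists pointwise.\<close>

lemma integral_PiM_pmf_local:
  fixes Z :: "(nat \<Rightarrow> 'z) \<Rightarrow> real"
  assumes Z: "Z \<in> borel_measurable (\<Pi>\<^sub>M i\<in>UNIV. count_space UNIV)" and "T > 0"
    and cong: "\<And>x y. (\<And>i. i < T \<Longrightarrow> x i = y i) \<Longrightarrow> Z x = Z y"
  shows "(\<integral>x. Z x \<partial>(\<Pi>\<^sub>M i\<in>UNIV. measure_pmf p)) = measure_pmf.expectation (Pi_pmf {..<T} d (\<lambda>_. p)) Z"
proof -
  let ?I = "{..<T}"
  let ?C = "\<Pi>\<^sub>M i\<in>?I. count_space (UNIV :: 'z set)"
  let ?q = "Pi_pmf ?I d (\<lambda>_. p)"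
  define Z' where "Z' x = Z (\<lambda>i. if i < T then x i else d)" for x
  have "(\<lambda>x i. if i < T then x i else d) \<in> ?C \<rightarrow>\<^sub>M (\<Pi>\<^sub>M i\<in>UNIV. count_space UNIV)"
  proof (rule measurable_PiM_single')
    fix i show "(\<lambda>x. if i < T then x i else d) \<in> ?C \<rightarrow>\<^sub>M count_space UNIV"
      by (cases "i < T") auto
  qed auto
  then have Z': "Z' \<in> borel_measurable ?C"
    unfolding Z'_def using Z by (rule measurable_compose)
  then have Z'p: "Z' \<in> borel_measurable (\<Pi>\<^sub>M i\<in>?I. measure_pmf p)"
    by (subst measurable_cong_sets[OF sets_PiM_pmf refl])
  have Z_eq: "Z x = Z' (restrict x ?I)" for x
    unfolding Z'_def by (rule cong) simp
  interpret prod: product_prob_space "\<lambda>_. measure_pmf p" "UNIV :: nat set"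
    by (intro product_prob_spaceI measure_pmf.prob_space_axioms)
  have "(\<integral>x. Z x \<partial>(\<Pi>\<^sub>M i\<in>UNIV. measure_pmf p)) =
      (\<integral>x. Z' x \<partial>distr (\<Pi>\<^sub>M i\<in>UNIV. measure_pmf p) (\<Pi>\<^sub>M i\<in>?I. measure_pmf p) (\<lambda>x. restrict x ?I))"
    unfolding Z_eq by (rule integral_distr[OF measurable_restrict_subset Z'p, symmetric]) simp
  also have "distr (\<Pi>\<^sub>M i\<in>UNIV. measure_pmf p) (\<Pi>\<^sub>M i\<in>?I. measure_pmf p) (\<lambda>x. restrict x ?I) = (\<Pi>\<^sub>M i\<in>?I. measure_pmf p)"
    using prod.distr_PiM_restrict_finite[of ?I] by simp
  also have "(\<Pi>\<^sub>M i\<in>?I. measure_pmf p) = distr (measure_pmf ?q) ?C (\<lambda>x. \<lambda>i\<in>?I. x i)"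
  proof -
    have "distr (measure_pmf ?q) ?C (\<lambda>x. \<lambda>i\<in>?I. x i) = (\<Pi>\<^sub>M i\<in>?I. distr (measure_pmf ?q) (count_space UNIV) (\<lambda>x. x i))"
      by (rule iffD1[OF prob_space.indep_vars_iff_distr_eq_PiM'[OF measure_pmf.prob_space_axioms] indep_vars_Pi_pmf])
        (use \<open>T > 0\<close> in auto)
    also have "\<dots> = (\<Pi>\<^sub>M i\<in>?I. measure_pmf p)"
    proof (rule PiM_cong[OF refl])
      fix i assume i: "i \<in> ?I"
      have "distr (measure_pmf ?q) (count_space UNIV) (\<lambda>x. x i) = measure_pmf (map_pmf (\<lambda>x. x i) ?q)"
        by (simp add: map_pmf_rep_eq)
      then show "distr (measure_pmf ?q) (count_space UNIV) (\<lambda>x. x i) = measure_pmf p"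
        using i by (simp add: Pi_pmf_component)
    qed
    finally show ?thesis by simp
  qed
  also have "(\<integral>x. Z' x \<partial>distr (measure_pmf ?q) ?C (\<lambda>x. \<lambda>i\<in>?I. x i)) = measure_pmf.expectation ?q Z"
    unfolding Z_eq by (rule integral_distr[OF _ Z']) (simp add: space_PiM)
  finally show ?thesis .
qed

section \<open>One round of the hard instance\<close>

text \<open>A law that charges every level; its weight at level \<open>k\<close> becomes a factor of
  the lower bound at time \<open>T k\<close>.\<close>

definition level :: "nat pmf" where "level = geometric_pmf (1/2)"

lemma pmf_level_pos: "pmf level k > 0"
  by (simp add: level_def)

text \<open>
  Each round draws a level \<open>K\<close> and a sign that is positive with probability \<open>(1 + \<theta> K) / 2\<close>; the payoff
  function is then \<open>1/2 + h K\<close> or \<open>1/2 - h K\<close>. So even the whole payoff function reveals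
  no more than the level and the sign.
\<close>

definition coin :: "(nat \<Rightarrow> real) \<Rightarrow> (nat \<times> bool) pmf" where
  "coin \<theta> = bind_pmf level (\<lambda>K. map_pmf (Pair K) (bernoulli_pmf ((1 + \<theta> K) / 2)))"

definition signed_payoff :: "(nat \<Rightarrow> 'a \<Rightarrow> real) \<Rightarrow> nat \<times> bool \<Rightarrow> 'a \<Rightarrow> real" where
  "signed_payoff h z x = 1/2 + (if snd z then h (fst z) x else - h (fst z) x)"

lemma pmf_coin:
  assumes "\<bar>\<theta> K\<bar> \<le> 1"
  shows "pmf (coin \<theta>) (K, s) = pmf level K * ((1 + (if s then \<theta> K else - \<theta> K)) / 2)"
proof -
  have *: "pmf (map_pmf (Pair K') (bernoulli_pmf ((1 + \<theta> K') / 2))) (K, s) =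
      indicator {K} K' * ((1 + (if s then \<theta> K else - \<theta> K)) / 2)" for K'
  proof (cases "K' = K")
    case True
    have "pmf (map_pmf (Pair K) (bernoulli_pmf ((1 + \<theta> K) / 2))) (K, s) = pmf (bernoulli_pmf ((1 + \<theta> K) / 2)) s"
      by (rule pmf_map_inj') (auto simp: inj_def)
    also have "\<dots> = (1 + (if s then \<theta> K else - \<theta> K)) / 2"
      using assms by (cases s) (auto simp: abs_le_iff field_simps)
    finally show ?thesis using True by simp
  next
    case False
    then show ?thesis by (subst pmf_map_outside) auto
  qed
  show ?thesis
    unfolding coin_def pmf_bind * by (simp add: measure_pmf_single)
qed

lemma expectation_coin:
  fixes u :: "nat \<times> bool \<Rightarrow> real"
  assumes "\<And>K. \<bar>\<theta> K\<bar> \<le> 1" "\<And>z. 0 \<le> u z" "\<And>z. u z \<le> B"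
  shows "measure_pmf.expectation (coin \<theta>) u =
    measure_pmf.expectation level (\<lambda>K. (1 + \<theta> K) / 2 * u (K, True) + (1 - \<theta> K) / 2 * u (K, False))"
proof -
  let ?B = "\<lambda>K. map_pmf (Pair K) (bernoulli_pmf ((1 + \<theta> K) / 2))"
  let ?v = "\<lambda>K. (1 + \<theta> K) / 2 * u (K, True) + (1 - \<theta> K) / 2 * u (K, False)"
  have v: "measure_pmf.expectation (?B K) u = ?v K" for K
  proof -
    have "0 \<le> (1 + \<theta> K) / 2" "(1 + \<theta> K) / 2 \<le> 1" "1 - (1 + \<theta> K) / 2 = (1 - \<theta> K) / 2"
      using assms(1)[of K] by (auto simp: abs_le_iff field_simps)
    then show ?thesis
      by (simp only: integral_map_pmf integral_bernoulli_pmf) (simp add: mult.commute)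
  qed
  have "(\<integral>\<^sup>+z. ennreal (u z) \<partial>coin \<theta>) = (\<integral>\<^sup>+K. (\<integral>\<^sup>+z. ennreal (u z) \<partial>?B K) \<partial>level)"
    unfolding coin_def by (rule nn_integral_bind_pmf)
  also have "\<dots> = (\<integral>\<^sup>+K. ennreal (?v K) \<partial>level)"
  proof (rule nn_integral_cong)
    fix K
    have "integrable (measure_pmf (?B K)) u"
      by (rule measure_pmf.integrable_const_bound[where B=B]) (use assms(2,3) in auto)
    then show "(\<integral>\<^sup>+z. ennreal (u z) \<partial>?B K) = ennreal (?v K)"
      using assms(2) by (subst nn_integral_eq_integral) (simp_all only: v AE_I2)
  qed
  finally have "(\<integral>\<^sup>+z. ennreal (u z) \<partial>coin \<theta>) = (\<integral>\<^sup>+K. ennreal (?v K) \<partial>level)" .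
  moreover have "0 \<le> ?v K" for K
    unfolding v[symmetric] using assms(2) by (intro Bochner_Integration.integral_nonneg) auto
  ultimately show ?thesis
    using assms(2) by (subst (1 2) integral_eq_nn_integral) auto
qed


subsection \<open>The adversary\<close>

text \<open>Common ground of both lower bounds: \<open>pick\<close> is any rule whose choice in
  round \<open>s\<close> depends on the seed and the coins of earlier rounds. Bandit and
  full-feedback algorithms become such rules once their runs on coin sequences are substituted.
  Monotonicity of \<open>T\<close> makes the biases decrease with the level.\<close>

locale adversary = Q: prob_space Q
  for X :: "'a::metric_space set" and Q :: "real measure"
    and pick :: "nat \<Rightarrow> real \<Rightarrow> (nat \<Rightarrow> nat \<times> bool) \<Rightarrow> 'a"
    and h :: "nat \<Rightarrow> 'a \<Rightarrow> real" and r :: "nat \<Rightarrow> real" and T :: "nat \<Rightarrow> nat" +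
  assumes r: "\<And>k. 0 < r k" "\<And>k. r k \<le> 1 / 2"
    and h: "\<And>k x. \<bar>h k x\<bar> \<le> r k" "\<And>k. h k \<in> borel_measurable (arms X)"
    and h_sign: "\<And>\<beta>. \<exists>x\<in>X. \<forall>k. h k x = (if \<beta> k then r k else - r k)"
    and pick_measurable: "\<And>s. (\<lambda>p. pick s (fst p) (snd p)) \<in> Q \<Otimes>\<^sub>M (\<Pi>\<^sub>M i\<in>UNIV. count_space UNIV) \<rightarrow>\<^sub>M arms X"
    and pick_local: "\<And>s \<omega> \<kappa> \<kappa>'. (\<And>i. i < s \<Longrightarrow> \<kappa> i = \<kappa>' i) \<Longrightarrow> pick s \<omega> \<kappa> = pick s \<omega> \<kappa>'"
    and T: "\<And>k. T k \<ge> 1" "mono T"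
begin

text \<open>The constant 6 gives \<open>T k * (bias k)\<^sup>2 = 1 / 36\<close>, so that
  \<open>T k\<close> rounds change the probability of an event by at most \<open>1 / 4\<close>; see
  \<open>chi_square_small\<close>.\<close>

definition bias :: "nat \<Rightarrow> real" where "bias k = 1 / (6 * sqrt (real (T k)))"

lemma bias_pos: "0 < bias k" and bias_le: "bias k \<le> 1 / 6"
  using T(1)[of k] by (auto simp: bias_def)

lemma bias_mono: "j \<le> k \<Longrightarrow> bias k \<le> bias j"
  using T(1)[of j] monoD[OF T(2), of j k] by (auto simp: bias_def intro!: divide_left_mono)

definition mean :: "(nat \<Rightarrow> real) \<Rightarrow> 'a \<Rightarrow> real" where
  "mean \<theta> x = measure_pmf.expectation (coin \<theta>) (\<lambda>z. signed_payoff h z x)"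

abbreviation rounds :: "(nat \<Rightarrow> real) \<Rightarrow> (nat \<Rightarrow> nat \<times> bool) measure" where
  "rounds \<theta> \<equiv> (\<Pi>\<^sub>M i\<in>(UNIV :: nat set). measure_pmf (coin \<theta>))"

abbreviation law :: "(nat \<Rightarrow> real) \<Rightarrow> (real \<times> (nat \<Rightarrow> nat \<times> bool)) measure" where
  "law \<theta> \<equiv> Q \<Otimes>\<^sub>M rounds \<theta>"

lemma signed_payoff_bounds: "0 \<le> signed_payoff h z x" "signed_payoff h z x \<le> 1"
  using h(1)[of "fst z" x] r(2)[of "fst z"] by (auto simp: signed_payoff_def abs_le_iff)

lemma mean_eq:
  assumes "\<And>K. \<bar>\<theta> K\<bar> \<le> 1"
  shows "mean \<theta> x = 1 / 2 + measure_pmf.expectation level (\<lambda>K. \<theta> K * h K x)"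
proof -
  have "mean \<theta> x = measure_pmf.expectation level (\<lambda>K. 1 / 2 + \<theta> K * h K x)"
  proof -
    have "(1 + \<theta> K) / 2 * signed_payoff h (K, True) x + (1 - \<theta> K) / 2 * signed_payoff h (K, False) x =
        1 / 2 + \<theta> K * h K x" for K
      by (simp add: signed_payoff_def field_simps)
    then show ?thesis
      unfolding mean_def by (simp only: expectation_coin[OF assms signed_payoff_bounds])
  qed
  also have "integrable level (\<lambda>K. \<theta> K * h K x)"
  proof (rule integrable_measure_pmf_bounded[where B=1])
    show "\<bar>\<theta> K * h K x\<bar> \<le> 1" for K
      using assms[of K] h(1)[of K x] r(2)[of K] mult_mono[of "\<bar>\<theta> K\<bar>" 1 "\<bar>h K x\<bar>" 1] by (simp add: abs_mult)
  qed
  then have "measure_pmf.expectation level (\<lambda>K. 1 / 2 + \<theta> K * h K x) =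
      1 / 2 + measure_pmf.expectation level (\<lambda>K. \<theta> K * h K x)"
    by simp
  finally show ?thesis .
qed

lemma mean_bounds: "0 \<le> mean \<theta> x" "mean \<theta> x \<le> 1"
proof -
  have int: "integrable (coin \<theta>) (\<lambda>z. signed_payoff h z x)"
    by (rule integrable_measure_pmf_bounded[where B=1]) (use signed_payoff_bounds in auto)
  show "0 \<le> mean \<theta> x"
    unfolding mean_def using signed_payoff_bounds by (intro Bochner_Integration.integral_nonneg) auto
  have "mean \<theta> x \<le> measure_pmf.expectation (coin \<theta>) (\<lambda>_. 1)"
    unfolding mean_def using signed_payoff_bounds int by (intro integral_mono) auto
  then show "mean \<theta> x \<le> 1" by simp
qed

lemma mean_measurable: "mean \<theta> \<in> borel_measurable (arms X)"
proof -
  have "(\<lambda>(x, z). signed_payoff h z x) \<in> borel_measurable (arms X \<Otimes>\<^sub>M measure_pmf (coin \<theta>))"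
  proof -
    have "(\<lambda>p. signed_payoff h (snd p) (fst p)) \<in> borel_measurable (arms X \<Otimes>\<^sub>M count_space UNIV)"
    proof (rule measurable_compose_countable[where f="\<lambda>z p. signed_payoff h z (fst p)" and g=snd])
      fix z :: "nat \<times> bool"
      show "(\<lambda>p. signed_payoff h z (fst p)) \<in> borel_measurable (arms X \<Otimes>\<^sub>M count_space (UNIV :: (nat \<times> bool) set))"
        using measurable_compose[OF measurable_fst[of "arms X" "count_space (UNIV :: (nat \<times> bool) set)"] h(2)[of "fst z"]]
        unfolding signed_payoff_def by (cases "snd z") auto
    qed simp
    then show ?thesis
      by (simp add: case_prod_beta' cong: measurable_cong_sets sets_pair_measure_cong)
  qed
  then show ?thesis
    unfolding mean_def by (rule measure_pmf.borel_measurable_lebesgue_integral)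
qed

lemma sets_law: "sets (law \<theta>) = sets (Q \<Otimes>\<^sub>M (\<Pi>\<^sub>M i\<in>UNIV. count_space UNIV))"
  by (intro sets_pair_measure_cong sets_PiM_pmf refl)

lemma pick_law: "(\<lambda>p. pick s (fst p) (snd p)) \<in> law \<theta> \<rightarrow>\<^sub>M arms X"
  using pick_measurable by (subst measurable_cong_sets[OF sets_law refl])

lemma prob_rounds: "prob_space (rounds \<theta>)"
  by (intro prob_space_PiM measure_pmf.prob_space_axioms)

lemma pair_prob: "pair_prob_space Q (rounds \<theta>)"
proof -
  interpret prob_space "rounds \<theta>" by (rule prob_rounds)
  show ?thesis by unfold_locales
qed

text \<open>A hit has the sign \<open>b\<close> at level \<open>k\<close>. A pick with
  \<open>h k = 0\<close> hits neither sign, so the two signs together are hit at most once per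
  round, and any miss is at least \<open>r k\<close> away from the favoured extreme value.\<close>

definition hit :: "nat \<Rightarrow> bool \<Rightarrow> nat \<Rightarrow> real \<times> (nat \<Rightarrow> nat \<times> bool) \<Rightarrow> real" where
  "hit k b s p = (if b then indicator {0<..} (h k (pick s (fst p) (snd p)))
     else indicator {..<0} (h k (pick s (fst p) (snd p))))"

lemma hit_01: "0 \<le> hit k b s p" "hit k b s p \<le> 1"
  by (auto simp: hit_def indicator_def)

lemma hit_measurable: "hit k b s \<in> borel_measurable (Q \<Otimes>\<^sub>M (\<Pi>\<^sub>M i\<in>UNIV. count_space UNIV))"
proof -
  have m: "(\<lambda>p. h k (pick s (fst p) (snd p))) \<in> borel_measurable (Q \<Otimes>\<^sub>M (\<Pi>\<^sub>M i\<in>UNIV. count_space UNIV))"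
    by (rule measurable_compose[OF pick_measurable h(2)])
  show ?thesis
    unfolding hit_def[abs_def]
    by (cases b) (auto intro!: measurable_compose[OF m] borel_measurable_indicator)
qed

lemma hit_integrable: "integrable (law \<theta>) (hit k b s)"
proof -
  interpret pair_prob_space Q "rounds \<theta>" by (rule pair_prob)
  show ?thesis
    by (rule integrable_const_bound[where B=1])
      (use hit_01 hit_measurable in \<open>auto simp: measurable_cong_sets[OF sets_law refl]\<close>)
qed

definition hits :: "nat \<Rightarrow> bool \<Rightarrow> (nat \<Rightarrow> real) \<Rightarrow> real" where
  "hits k b \<theta> = (\<Sum>s<T k. \<integral>p. hit k b s p \<partial>law \<theta>)"

text \<open>
  At level \<open>k\<close> the adversary runs the algorithm for \<open>T k\<close> rounds against the instance whose signs are unbiased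
  from level \<open>k\<close> on, and then favours the sign that the algorithm hits at most half of the time.
\<close>

primrec biases :: "nat \<Rightarrow> nat \<Rightarrow> real" where
  "biases 0 = (\<lambda>_. 0)"
| "biases (Suc k) = (biases k)(k := if hits k True (biases k) \<le> T k / 2 then bias k else - bias k)"

definition sign :: "nat \<Rightarrow> bool" where "sign k \<longleftrightarrow> hits k True (biases k) \<le> T k / 2"

definition \<theta> :: "nat \<Rightarrow> real" where "\<theta> k = (if sign k then bias k else - bias k)"

text \<open>Later stages never alter a level already decided, so the stages are the truncations of
  one limit \<open>\<theta>\<close>.\<close>

lemma biases_eq: "biases k j = (if j < k then \<theta> j else 0)"
  by (induction k arbitrary: j) (auto simp: \<theta>_def sign_def less_Suc_eq)

lemma \<theta>_abs: "\<bar>\<theta> k\<bar> = bias k" "\<bar>\<theta> k\<bar> \<le> 1"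
  using bias_pos[of k] bias_le[of k] by (auto simp: \<theta>_def)

lemma hits_add_le: "hits k True \<theta>' + hits k False \<theta>' \<le> T k"
proof -
  interpret pair_prob_space Q "rounds \<theta>'" by (rule pair_prob)
  have "(\<integral>p. hit k True s p \<partial>law \<theta>') + (\<integral>p. hit k False s p \<partial>law \<theta>') \<le> 1" for s
  proof -
    have "(\<integral>p. hit k True s p + hit k False s p \<partial>law \<theta>') \<le> (\<integral>p. 1 \<partial>law \<theta>')"
    proof (rule integral_mono)
      show "integrable (law \<theta>') (\<lambda>p. hit k True s p + hit k False s p)"
        by (intro Bochner_Integration.integrable_add hit_integrable)
      show "hit k True s p + hit k False s p \<le> 1" for p
        by (auto simp: hit_def indicator_def)
    qed simp
    then show ?thesis
      using hit_integrable by (simp add: prob_space)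
  qed
  then have "(\<Sum>s<T k. (\<integral>p. hit k True s p \<partial>law \<theta>') + (\<integral>p. hit k False s p \<partial>law \<theta>')) \<le> (\<Sum>s<T k. 1)"
    by (intro sum_mono)
  then show ?thesis by (simp add: hits_def sum.distrib)
qed

lemma hits_sign: "hits k (sign k) (biases k) \<le> T k / 2"
proof (cases "sign k")
  case True
  then show ?thesis by (simp add: sign_def)
next
  case False
  then have "hits k True (biases k) > T k / 2" by (simp add: sign_def)
  with hits_add_le[of k "biases k"] False show ?thesis by simp
qed

lemma chi_square_small: "sqrt ((1 + (bias k)\<^sup>2) ^ T k - 1) \<le> 1 / 4"
proof -
  have *: "real (T k) * (bias k)\<^sup>2 = 1 / 36"
    using T(1)[of k] by (simp add: bias_def power_divide power_mult_distrib)
  have "(1 + (bias k)\<^sup>2) ^ T k \<le> exp ((bias k)\<^sup>2) ^ T k"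
    using exp_ge_add_one_self[of "(bias k)\<^sup>2"] by (intro power_mono) auto
  also have "\<dots> = exp (1 / 36)"
    by (simp only: exp_of_nat_mult[symmetric] *)
  also have "\<dots> \<le> 1 + 1 / 36 + (1 / 36)\<^sup>2"
    by (rule exp_bound) auto
  also have "\<dots> \<le> 1 + (1 / 4)\<^sup>2" by (simp add: power2_eq_square)
  finally have "(1 + (bias k)\<^sup>2) ^ T k - 1 \<le> (1 / 4)\<^sup>2" by simp
  then show ?thesis by (intro real_le_lsqrt) auto
qed

text \<open>\<open>\<theta>\<close> and \<open>biases k\<close> agree below level \<open>k\<close>,
  and \<open>biases k\<close> is unbiased from there on. The likelihood ratio is therefore 1 below
  level \<open>k\<close> and differs from 1 by at most \<open>bias k\<close> everywhere, since the
  biases decrease.\<close>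

lemma pmf_coin_\<theta>:
  "pmf (coin \<theta>) z = pmf (coin (biases k)) z * (1 + (if fst z < k then 0 else if snd z then \<theta> (fst z) else - \<theta> (fst z)))"
proof (cases z)
  case (Pair K s)
  have "\<bar>biases k K\<bar> \<le> 1" using \<theta>_abs(2)[of K] by (simp add: biases_eq)
  then show ?thesis
    using \<theta>_abs(2)[of K] by (simp add: Pair pmf_coin biases_eq)
qed

text \<open>For a fixed seed, a hit before time \<open>T k\<close> is decided by the first
  \<open>T k\<close> coins, whose two laws are close by \<open>chi_square_small\<close>. The bound
  is then integrated over the seed.\<close>

lemma hit_close:
  assumes "s < T k"
  shows "(\<integral>p. hit k b s p \<partial>law \<theta>) \<le> (\<integral>p. hit k b s p \<partial>law (biases k)) + 1 / 4"
proof -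
  interpret P: pair_prob_space Q "rounds \<theta>" by (rule pair_prob)
  interpret B: pair_prob_space Q "rounds (biases k)" by (rule pair_prob)
  let ?Z = "\<lambda>\<omega> \<kappa>. hit k b s (\<omega>, \<kappa>)"
  have inner: "(\<integral>\<kappa>. ?Z \<omega> \<kappa> \<partial>rounds \<theta>) \<le> (\<integral>\<kappa>. ?Z \<omega> \<kappa> \<partial>rounds (biases k)) + 1 / 4" if \<omega>: "\<omega> \<in> space Q" for \<omega>
  proof -
    have m: "?Z \<omega> \<in> borel_measurable (\<Pi>\<^sub>M i\<in>UNIV. count_space UNIV)"
      using measurable_compose[OF measurable_Pair1'[OF \<omega>] hit_measurable] .
    have loc: "?Z \<omega> \<kappa> = ?Z \<omega> \<kappa>'" if "\<And>i. i < T k \<Longrightarrow> \<kappa> i = \<kappa>' i" for \<kappa> \<kappa>'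
    proof -
      have "pick s \<omega> \<kappa> = pick s \<omega> \<kappa>'"
        using that assms by (intro pick_local) auto
      then show ?thesis by (simp add: hit_def)
    qed
    have eq: "(\<integral>\<kappa>. ?Z \<omega> \<kappa> \<partial>rounds \<theta>') = measure_pmf.expectation (Pi_pmf {..<T k} undefined (\<lambda>_. coin \<theta>')) (?Z \<omega>)" for \<theta>'
      by (rule integral_PiM_pmf_local[OF m _ loc]) (use assms in auto)
    have "\<bar>measure_pmf.expectation (Pi_pmf {..<T k} undefined (\<lambda>_. coin \<theta>)) (?Z \<omega>) -
        measure_pmf.expectation (Pi_pmf {..<T k} undefined (\<lambda>_. coin (biases k))) (?Z \<omega>)\<bar> \<le> sqrt ((1 + (bias k)\<^sup>2) ^ T k - 1)"
      by (rule Pi_pmf_expectation_diff[OF pmf_coin_\<theta>])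
        (use bias_mono bias_pos[of k] bias_le[of k] hit_01 in \<open>auto simp: \<theta>_abs\<close>)
    then show ?thesis
      using chi_square_small[of k] by (simp add: eq abs_le_iff)
  qed
  have "(\<integral>p. hit k b s p \<partial>law \<theta>) = (\<integral>\<omega>. (\<integral>\<kappa>. ?Z \<omega> \<kappa> \<partial>rounds \<theta>) \<partial>Q)"
    by (rule P.integral_fst'[OF hit_integrable, symmetric])
  also have "\<dots> \<le> (\<integral>\<omega>. (\<integral>\<kappa>. ?Z \<omega> \<kappa> \<partial>rounds (biases k)) + 1 / 4 \<partial>Q)"
    using inner P.integrable_fst'[OF hit_integrable] B.integrable_fst'[OF hit_integrable]
    by (intro integral_mono Bochner_Integration.integrable_add) auto
  also have "\<dots> = (\<integral>\<omega>. (\<integral>\<kappa>. ?Z \<omega> \<kappa> \<partial>rounds (biases k)) \<partial>Q) + 1 / 4"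
    using B.integrable_fst'[OF hit_integrable] by (simp add: Q.prob_space)
  also have "(\<integral>\<omega>. (\<integral>\<kappa>. ?Z \<omega> \<kappa> \<partial>rounds (biases k)) \<partial>Q) = (\<integral>p. hit k b s p \<partial>law (biases k))"
    by (rule B.integral_fst'[OF hit_integrable])
  finally show ?thesis .
qed

lemma hits_\<theta>: "hits k (sign k) \<theta> \<le> 3 / 4 * T k"
proof -
  have "hits k (sign k) \<theta> \<le> (\<Sum>s<T k. (\<integral>p. hit k (sign k) s p \<partial>law (biases k)) + 1 / 4)"
    unfolding hits_def by (intro sum_mono hit_close) simp
  also have "\<dots> = hits k (sign k) (biases k) + T k / 4"
    by (simp add: hits_def sum.distrib)
  finally show ?thesis using hits_sign[of k] by simp
qed

lemma integrable_\<theta>_h: "integrable level (\<lambda>K. \<theta> K * h K x)"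
proof (rule integrable_measure_pmf_bounded[where B=1])
  show "\<bar>\<theta> K * h K x\<bar> \<le> 1" for K
    using \<theta>_abs(2)[of K] h(1)[of K x] r(2)[of K] mult_mono[of "\<bar>\<theta> K\<bar>" 1 "\<bar>h K x\<bar>" 1] by (simp add: abs_mult)
qed

text \<open>\<open>y\<close> has the favoured extreme value at every level, so
  \<open>mean \<theta> y - mean \<theta> x\<close> averages the nonnegative terms
  \<open>\<theta> K * (h K y - h K x)\<close> over the levels. Keeping level \<open>k\<close> alone
  gives the second claim, as its term is at least \<open>bias k * r k\<close> when \<open>x\<close>
  misses the favoured sign.\<close>

lemma gap:
  assumes y: "\<And>k. h k y = (if sign k then r k else - r k)"
  shows "mean \<theta> x \<le> mean \<theta> y"
    and "pmf level k * (bias k * r k) * (1 - (if sign k then indicator {0<..} (h k x) else indicator {..<0} (h k x)))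
      \<le> mean \<theta> y - mean \<theta> x"
proof -
  let ?u = "\<lambda>K. \<theta> K * (h K y - h K x)"
  have int: "integrable level ?u"
    using Bochner_Integration.integrable_diff[OF integrable_\<theta>_h[of y] integrable_\<theta>_h[of x]] by (simp add: right_diff_distrib)
  have eq: "mean \<theta> y - mean \<theta> x = measure_pmf.expectation level ?u"
    using integrable_\<theta>_h by (simp add: mean_eq[OF \<theta>_abs(2)] right_diff_distrib)
  have nonneg: "0 \<le> ?u K" for K
  proof (cases "sign K")
    case True
    then have "h K x \<le> h K y" using y[of K] h(1)[of K x] by auto
    then show ?thesis using True bias_pos[of K] by (simp add: \<theta>_def)
  next
    case False
    then have "h K y \<le> h K x" using y[of K] h(1)[of K x] by auto
    then show ?thesis using False bias_pos[of K] by (simp add: \<theta>_def mult_le_0_iff)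
  qed
  show "mean \<theta> x \<le> mean \<theta> y"
  proof -
    have "0 \<le> measure_pmf.expectation level ?u"
      using nonneg by (intro Bochner_Integration.integral_nonneg)
    then show ?thesis using eq by simp
  qed
  have "pmf level k * ?u k = measure_pmf.expectation level (\<lambda>K. indicator {k} K * ?u k)"
    by (simp add: measure_pmf_single)
  also have "\<dots> \<le> measure_pmf.expectation level ?u"
  proof (rule integral_mono[OF _ int])
    show "integrable level (\<lambda>K. indicator {k} K * ?u k)"
      by (rule integrable_measure_pmf_bounded[where B="\<bar>?u k\<bar>"]) (auto simp: indicator_def)
    show "indicator {k} K * ?u k \<le> ?u K" for K
      using nonneg[of K] by (auto simp: indicator_def)
  qed
  finally have single: "pmf level k * ?u k \<le> mean \<theta> y - mean \<theta> x" by (simp add: eq)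
  have "bias k * r k * (1 - (if sign k then indicator {0<..} (h k x) else indicator {..<0} (h k x))) \<le> ?u k"
  proof (cases "(if sign k then indicator {0<..} (h k x) else indicator {..<0} (h k x)) = (1::real)")
    case True
    then show ?thesis using nonneg[of k] by simp
  next
    case False
    then have "r k \<le> (if sign k then h k y - h k x else h k x - h k y)"
      using y[of k] by (auto simp: indicator_def split: if_splits)
    from mult_left_mono[OF this less_imp_le[OF bias_pos[of k]]]
    have "bias k * r k \<le> ?u k" by (auto simp only: \<theta>_def right_diff_distrib split: if_splits)
    moreover have "(if sign k then indicator {0<..} (h k x) else indicator {..<0} (h k x)) = (0::real)"
      using False by (auto simp: indicator_def split: if_splits)
    ultimately show ?thesis by (simp only: diff_zero mult_1_right)
  qed
  then have "pmf level k * (bias k * r k * (1 - (if sign k then indicator {0<..} (h k x) else indicator {..<0} (h k x)))) \<le> pmf level k * ?u k"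
    by (rule mult_left_mono) simp
  with single show "pmf level k * (bias k * r k) * (1 - (if sign k then indicator {0<..} (h k x) else indicator {..<0} (h k x)))
      \<le> mean \<theta> y - mean \<theta> x"
    by (simp add: mult.assoc)
qed

lemma mean_pick_integrable: "integrable (law \<theta>') (\<lambda>p. mean \<theta>' (pick s (fst p) (snd p)))"
proof -
  interpret pair_prob_space Q "rounds \<theta>'" by (rule pair_prob)
  show ?thesis
    by (rule integrable_const_bound[where B=1])
      (use mean_bounds measurable_compose[OF pick_law mean_measurable] in auto)
qed

text \<open>By \<open>hits_\<theta>\<close> at least a quarter of the first \<open>T k\<close>
  rounds are expected to miss the favoured sign, and each miss costs
  \<open>pmf level k * (bias k * r k)\<close> by \<open>gap\<close>. As
  \<open>bias k * T k = sqrt (T k) / 6\<close>, the constant is \<open>4 * 6 = 24\<close>.\<close>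

theorem regret_lower_bound:
  "pmf level k * r k * sqrt (T k) / 24 \<le>
    real (T k) * (SUP x\<in>X. mean \<theta> x) - (\<integral>p. (\<Sum>s<T k. mean \<theta> (pick s (fst p) (snd p))) \<partial>law \<theta>)"
proof -
  interpret pair_prob_space Q "rounds \<theta>" by (rule pair_prob)
  obtain y where y: "y \<in> X" "\<And>k. h k y = (if sign k then r k else - r k)"
    using h_sign[of sign] by blast
  have sup: "(SUP x\<in>X. mean \<theta> x) = mean \<theta> y"
    using y(1) gap(1)[OF y(2)] by (intro cSup_eq_maximum) auto
  define c where "c = pmf level k * (bias k * r k)"
  let ?b = "sign k"
  have c: "0 \<le> c" using bias_pos[of k] r(1)[of k] by (simp add: c_def)
  have round: "c * (1 - (\<integral>p. hit k ?b s p \<partial>law \<theta>)) \<le> mean \<theta> y - (\<integral>p. mean \<theta> (pick s (fst p) (snd p)) \<partial>law \<theta>)" for s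
  proof -
    have "(\<integral>p. c * (1 - hit k ?b s p) \<partial>law \<theta>) \<le> (\<integral>p. mean \<theta> y - mean \<theta> (pick s (fst p) (snd p)) \<partial>law \<theta>)"
    proof (rule integral_mono)
      show "c * (1 - hit k ?b s p) \<le> mean \<theta> y - mean \<theta> (pick s (fst p) (snd p))" for p
        using gap(2)[OF y(2), of k "pick s (fst p) (snd p)"] by (simp only: hit_def c_def)
    qed (use hit_integrable mean_pick_integrable in auto)
    then show ?thesis
      using hit_integrable[of \<theta> k ?b s] mean_pick_integrable[of \<theta> s] by (simp add: prob_space)
  qed
  have "c * (real (T k) / 4) \<le> c * (real (T k) - hits k ?b \<theta>)"
    using hits_\<theta>[of k] c by (intro mult_left_mono) auto
  also have "\<dots> = (\<Sum>s<T k. c * (1 - (\<integral>p. hit k ?b s p \<partial>law \<theta>)))"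
    by (simp add: hits_def sum_subtractf right_diff_distrib sum_distrib_left mult.commute)
  also have "\<dots> \<le> (\<Sum>s<T k. mean \<theta> y - (\<integral>p. mean \<theta> (pick s (fst p) (snd p)) \<partial>law \<theta>))"
    by (intro sum_mono round)
  also have "\<dots> = real (T k) * (SUP x\<in>X. mean \<theta> x) - (\<integral>p. (\<Sum>s<T k. mean \<theta> (pick s (fst p) (snd p))) \<partial>law \<theta>)"
    using mean_pick_integrable by (simp add: sup sum_subtractf)
  also have "c * (real (T k) / 4) = pmf level k * r k * sqrt (T k) / 24"
  proof -
    have "bias k * real (T k) = sqrt (T k) / 6"
      using T(1)[of k] by (simp add: bias_def field_simps)
    then show ?thesis by (simp add: c_def algebra_simps)
  qed
  finally show ?thesis .
qed

end


subsection \<open>Uncountable spaces: the bandit problem\<close>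

text \<open>The factors \<open>q k\<close> are known before the times are chosen, so each time can
  be late enough to compensate for its factor. The additional \<open>Suc k\<close> outgrows the
  constant \<open>C\<close>, which is revealed only after the instance has been built.\<close>

lemma sparse_times:
  fixes g :: "nat \<Rightarrow> real" and q :: "nat \<Rightarrow> real"
  assumes g: "(\<lambda>t. g t / sqrt (real t)) \<longlonglongrightarrow> 0" and q: "\<And>k. q k > 0"
  obtains T :: "nat \<Rightarrow> nat" where "\<And>k. T k \<ge> 1" "mono T" "\<And>k. \<bar>g (T k)\<bar> * real (Suc k) \<le> q k * sqrt (T k)"
proof -
  have "\<exists>N. \<forall>t\<ge>N. \<bar>g t / sqrt (real t)\<bar> < q k / real (Suc k)" for k
    using LIMSEQ_D[OF g, of "q k / real (Suc k)"] q[of k] by (simp del: of_nat_Suc)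
  then obtain N where N: "\<And>k t. t \<ge> N k \<Longrightarrow> \<bar>g t / sqrt (real t)\<bar> < q k / real (Suc k)"
    by metis
  define T where "T k = Suc (\<Sum>j\<le>k. N j)" for k
  show ?thesis
  proof (rule that)
    show T1: "T k \<ge> 1" for k by (simp add: T_def)
    show "mono T"
      by (auto simp: T_def mono_iff_le_Suc)
    show "\<bar>g (T k)\<bar> * real (Suc k) \<le> q k * sqrt (T k)" for k
    proof -
      have "N k \<le> T k"
        using member_le_sum[of k "{..k}" N] by (simp add: T_def)
      from N[OF this] T1[of k] show ?thesis
        by (simp add: field_simps abs_divide del: of_nat_Suc)
    qed
  qed
qed

lemma not_bounded_by_sparse:
  fixes g R q :: "nat \<Rightarrow> real" and T :: "nat \<Rightarrow> nat"
  assumes T: "\<And>k. T k \<ge> 1" "\<And>k. \<bar>g (T k)\<bar> * real (Suc k) \<le> q k * sqrt (T k)" and q: "\<And>k. q k > 0"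
    and R: "\<And>k. q k * sqrt (T k) / 24 \<le> R (T k)" "\<And>t. t \<ge> 1 \<Longrightarrow> R t \<le> C * g t"
  shows False
proof -
  obtain k :: nat where k: "24 * \<bar>C\<bar> < real (Suc k)"
    using reals_Archimedean2[of "24 * \<bar>C\<bar>"] less_Suc_eq by (metis less_trans of_nat_less_iff lessI)
  let ?s = "q k * sqrt (T k)"
  have s: "?s > 0" using q[of k] T(1)[of k] by simp
  have "?s / 24 \<le> C * g (T k)"
    using R(1)[of k] R(2)[OF T(1)[of k]] by simp
  also have "\<dots> \<le> \<bar>C\<bar> * \<bar>g (T k)\<bar>"
    by (metis abs_ge_self abs_mult)
  finally have "?s / 24 * real (Suc k) \<le> \<bar>C\<bar> * \<bar>g (T k)\<bar> * real (Suc k)"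
    by (rule mult_right_mono) simp
  also have "\<dots> \<le> \<bar>C\<bar> * ?s"
    using mult_left_mono[OF T(2)[of k], of "\<bar>C\<bar>"] by (simp add: mult.assoc del: of_nat_Suc)
  finally have "?s * real (Suc k) \<le> ?s * (24 * \<bar>C\<bar>)"
    by (simp add: mult_ac del: of_nat_Suc)
  then have "real (Suc k) \<le> 24 * \<bar>C\<bar>"
    using s mult_le_cancel_left_pos by blast
  with k show False by simp
qed

lemma signed_payoff_lipschitz:
  assumes "1-lipschitz_on X (h (fst z))"
  shows "1-lipschitz_on X (signed_payoff h z)"
proof (rule lipschitz_onI)
  fix x y assume "x \<in> X" "y \<in> X"
  then have "dist (h (fst z) x) (h (fst z) y) \<le> dist x y"
    using lipschitz_onD[OF assms] by simp
  then show "dist (signed_payoff h z x) (signed_payoff h z y) \<le> 1 * dist x y"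
    by (auto simp: signed_payoff_def dist_real_def)
qed simp

lemma signed_payoff_measurable:
  assumes h: "\<And>k. h k \<in> borel_measurable (arms X)"
  shows "(\<lambda>(z, x). signed_payoff h z x) \<in> borel_measurable (count_space UNIV \<Otimes>\<^sub>M arms X)"
proof (rule measurable_pair_measure_countable1)
  fix z :: "nat \<times> bool"
  show "(\<lambda>y. case (z, y) of (z, x) \<Rightarrow> signed_payoff h z x) \<in> borel_measurable (arms X)"
    using h[of "fst z"] unfolding signed_payoff_def by (cases "snd z") auto
qed simp

context adversary
begin

lemma mean_lipschitz:
  assumes "\<And>k. 1-lipschitz_on X (h k)"
  shows "1-lipschitz_on X (mean \<theta>')"
proof (rule lipschitz_onI)
  fix x y assume xy: "x \<in> X" "y \<in> X"
  have int: "integrable (coin \<theta>') (\<lambda>z. signed_payoff h z x)" for x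
    by (rule integrable_measure_pmf_bounded[where B=1]) (use signed_payoff_bounds in auto)
  have "\<bar>mean \<theta>' x - mean \<theta>' y\<bar> = \<bar>measure_pmf.expectation (coin \<theta>') (\<lambda>z. signed_payoff h z x - signed_payoff h z y)\<bar>"
    using int by (simp add: mean_def)
  also have "\<dots> \<le> measure_pmf.expectation (coin \<theta>') (\<lambda>z. \<bar>signed_payoff h z x - signed_payoff h z y\<bar>)"
    by (rule integral_abs_bound)
  also have "\<dots> \<le> measure_pmf.expectation (coin \<theta>') (\<lambda>_. dist x y)"
  proof (rule integral_mono)
    fix z
    show "\<bar>signed_payoff h z x - signed_payoff h z y\<bar> \<le> dist x y"
      using lipschitz_onD[OF signed_payoff_lipschitz[OF assms] xy] by (simp add: dist_real_def)
  qed (use int in auto)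
  finally show "dist (mean \<theta>' x) (mean \<theta>' y) \<le> 1 * dist x y"
    by (simp add: dist_real_def)
qed simp

end

theorem uncountable_imp_not_mab_tractable:
  fixes X :: "'a::metric_space set" and g :: "nat \<Rightarrow> real"
  assumes X: "compact X" "uncountable X" and g: "(\<lambda>t. g t / sqrt (real t)) \<longlonglongrightarrow> 0"
  shows "\<not> mab_tractable X g"
proof
  assume "mab_tractable X g"
  then obtain Q a where alg: "mab_algorithm X Q a"
    and tr: "\<And>\<mu> \<nu>. mab_instance X \<mu> \<nu> \<Longrightarrow> \<exists>C. \<forall>t\<ge>1. mab_regret X Q a \<mu> \<nu> t \<le> C * g t"
    unfolding mab_tractable_def by metis
  obtain h :: "nat \<Rightarrow> 'a \<Rightarrow> real" and r where hr: "\<And>k. 0 < r k" "\<And>k. r k \<le> 1 / 2" "\<And>k x. \<bar>h k x\<bar> \<le> r k"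
    "\<And>k. 1-lipschitz_on UNIV (h k)" "\<And>\<beta>. \<exists>x\<in>X. \<forall>k. h k x = (if \<beta> k then r k else - r k)"
    by (rule uncountable_compact_lipschitz_coordinates[OF X]) (rule that)
  have lip: "1-lipschitz_on X (h k)" for k
    using lipschitz_on_subset[OF hr(4)] by simp
  have h_meas: "h k \<in> borel_measurable (arms X)" for k
    using lipschitz_on_continuous_on[OF lip] by (rule borel_measurable_continuous_on_restrict)
  have q: "pmf level k * r k > 0" for k using hr(1)[of k] pmf_level_pos[of k] by simp
  obtain T where times: "\<And>k. T k \<ge> 1" "mono T" "\<And>k. \<bar>g (T k)\<bar> * real (Suc k) \<le> pmf level k * r k * sqrt (T k)"
    by (rule sparse_times[OF g q]) (rule that)
  let ?F = "signed_payoff h"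
  have tape: "mab_tape X Q a (measure_pmf p) ?F" for p
    using signed_payoff_measurable[OF h_meas] alg
    by (intro mab_tape.intro mab_tape_axioms.intro measure_pmf.prob_space_axioms)
      (auto cong: measurable_cong_sets sets_pair_measure_cong)
  have Q: "prob_space Q" using alg by (simp add: mab_algorithm_def seed_law_def)
  interpret adversary X Q "\<lambda>s \<omega> \<kappa>. a s \<omega> (mab_run a ?F \<omega> \<kappa> s)" h r T
  proof (intro adversary.intro adversary_axioms.intro Q hr h_meas times(1,2))
    fix s
    \<comment> \<open>Measurability depends only on the sigma-algebra, which is the same for all
      coins; the unbiased coin serves as a representative, because \<open>\<theta>\<close> exists
      only after this interpretation.\<close>
    have "sets (Q \<Otimes>\<^sub>M (\<Pi>\<^sub>M i\<in>(UNIV::nat set). measure_pmf (coin (\<lambda>_. 0)))) = sets (Q \<Otimes>\<^sub>M (\<Pi>\<^sub>M i\<in>(UNIV::nat set). count_space UNIV))"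
      by (intro sets_pair_measure_cong sets_PiM_pmf refl)
    with mab_tape.measurable_pick[OF tape[of "coin (\<lambda>_. 0)"], of s]
    show "(\<lambda>p. a s (fst p) (mab_run a ?F (fst p) (snd p) s)) \<in> Q \<Otimes>\<^sub>M (\<Pi>\<^sub>M i\<in>UNIV. count_space UNIV) \<rightarrow>\<^sub>M arms X"
      by (subst (asm) measurable_cong_sets[OF _ refl])
  next
    fix s \<omega> and \<kappa> \<kappa>' :: "nat \<Rightarrow> nat \<times> bool"
    assume "\<And>i. i < s \<Longrightarrow> \<kappa> i = \<kappa>' i"
    then have "mab_run a ?F \<omega> \<kappa> s = mab_run a ?F \<omega> \<kappa>' s"
      by (rule mab_run_cong)
    then show "a s \<omega> (mab_run a ?F \<omega> \<kappa> s) = a s \<omega> (mab_run a ?F \<omega> \<kappa>' s)"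
      by (rule arg_cong)
  qed
  define \<nu> where "\<nu> x = distr (measure_pmf (coin \<theta>)) borel (\<lambda>z. ?F z x)" for x
  have inst: "mab_instance X (mean \<theta>) \<nu>"
    unfolding mab_instance_def
  proof (intro conjI ballI)
    show "mean \<theta> ` X \<subseteq> {0..1}" using mean_bounds by auto
    show "1-lipschitz_on X (mean \<theta>)" by (rule mean_lipschitz[OF lip])
    show "\<nu> \<in> arms X \<rightarrow>\<^sub>M prob_algebra borel"
      unfolding \<nu>_def
    proof (rule measurable_distr_prob_space2)
      show "(\<lambda>x. measure_pmf (coin \<theta>)) \<in> arms X \<rightarrow>\<^sub>M prob_algebra (count_space UNIV)"
        by (rule measurable_const) (simp add: space_prob_algebra measure_pmf.prob_space_axioms)
      show "(\<lambda>(x, z). ?F z x) \<in> arms X \<Otimes>\<^sub>M count_space UNIV \<rightarrow>\<^sub>M borel"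
        using measurable_compose[OF measurable_pair_swap' signed_payoff_measurable[OF h_meas]]
        by (simp add: case_prod_beta')
    qed
    fix x assume "x \<in> X"
    show "AE y in \<nu> x. y \<in> {0..1}"
      unfolding \<nu>_def using signed_payoff_bounds by (subst AE_distr_iff) auto
    show "(\<integral>y. y \<partial>\<nu> x) = mean \<theta> x"
      unfolding \<nu>_def mean_def by (subst integral_distr) auto
  qed
  obtain C where C: "\<And>t. t \<ge> 1 \<Longrightarrow> mab_regret X Q a (mean \<theta>) \<nu> t \<le> C * g t"
    using tr[OF inst] by blast
  have "pmf level k * r k * sqrt (T k) / 24 \<le> mab_regret X Q a (mean \<theta>) \<nu> (T k)" for k
    using regret_lower_bound[of k] mab_tape.mab_regret_eq[OF tape[of "coin \<theta>"] inst, of "T k"]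
    by (simp add: \<nu>_def)
  then show False
    by (rule not_bounded_by_sparse[OF times(1,3) q _ C])
qed

section \<open>From independent coins to independent payoff functions\<close>

text \<open>\<open>expert_space\<close> consists of independent payoff functions, the adversary of
  independent coins. Decoding the coins round by round carries one product law to the other, as both
  agree on finite-dimensional rectangles.\<close>

lemma distr_PiM_UNIV:
  assumes M: "prob_space M" and f: "f \<in> M \<rightarrow>\<^sub>M L"
  shows "distr (\<Pi>\<^sub>M i\<in>(UNIV :: nat set). M) (\<Pi>\<^sub>M i\<in>UNIV. distr M L f) (\<lambda>\<kappa> i. f (\<kappa> i)) = (\<Pi>\<^sub>M i\<in>UNIV. distr M L f)"
proof -
  interpret M: prob_space M by fact
  interpret P: product_prob_space "\<lambda>_. M" "UNIV :: nat set"
    by (intro product_prob_spaceI M)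
  interpret D: product_prob_space "\<lambda>_. distr M L f" "UNIV :: nat set"
    by (intro product_prob_spaceI M.prob_space_distr f)
  have m: "(\<lambda>\<kappa> i. f (\<kappa> i)) \<in> (\<Pi>\<^sub>M i\<in>(UNIV :: nat set). M) \<rightarrow>\<^sub>M (\<Pi>\<^sub>M i\<in>UNIV. distr M L f)"
  proof (rule measurable_PiM_single')
    fix i :: nat
    have "(\<lambda>\<kappa>. \<kappa> i) \<in> (\<Pi>\<^sub>M i\<in>(UNIV :: nat set). M) \<rightarrow>\<^sub>M M"
      using measurable_component_singleton[of i UNIV "\<lambda>_. M"] by simp
    from measurable_compose[OF this f] show "(\<lambda>\<kappa>. f (\<kappa> i)) \<in> (\<Pi>\<^sub>M i\<in>(UNIV :: nat set). M) \<rightarrow>\<^sub>M distr M L f"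
      by simp
  qed (use measurable_space[OF f] in \<open>auto simp: space_PiM PiE_iff\<close>)
  show ?thesis
  proof (rule D.PiM_eq)
    fix J F assume J: "finite J" "J \<subseteq> (UNIV :: nat set)" "\<And>j. j \<in> J \<Longrightarrow> F j \<in> sets (distr M L f)"
    let ?E = "D.emb UNIV J (Pi\<^sub>E J F)"
    have "?E \<in> sets (\<Pi>\<^sub>M i\<in>UNIV. distr M L f)"
      using J by (intro sets_PiM_I) auto
    then have "emeasure (distr (\<Pi>\<^sub>M i\<in>(UNIV :: nat set). M) (\<Pi>\<^sub>M i\<in>UNIV. distr M L f) (\<lambda>\<kappa> i. f (\<kappa> i))) ?E =
        emeasure (\<Pi>\<^sub>M i\<in>UNIV. M) ((\<lambda>\<kappa> i. f (\<kappa> i)) -` ?E \<inter> space (\<Pi>\<^sub>M i\<in>UNIV. M))"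
      using m by (intro emeasure_distr)
    also have "(\<lambda>\<kappa> i. f (\<kappa> i)) -` ?E \<inter> space (\<Pi>\<^sub>M i\<in>UNIV. M) = P.emb UNIV J (\<Pi>\<^sub>E j\<in>J. f -` F j \<inter> space M)"
      using measurable_space[OF f] by (auto simp: prod_emb_def space_PiM PiE_iff)
    also have "emeasure (\<Pi>\<^sub>M i\<in>UNIV. M) \<dots> = (\<Prod>j\<in>J. emeasure M (f -` F j \<inter> space M))"
      using J f by (intro P.emeasure_PiM_emb) auto
    also have "\<dots> = (\<Prod>j\<in>J. emeasure (distr M L f) (F j))"
      using J f by (intro prod.cong) (auto simp: emeasure_distr)
    finally show "emeasure (distr (\<Pi>\<^sub>M i\<in>(UNIV :: nat set). M) (\<Pi>\<^sub>M i\<in>UNIV. distr M L f) (\<lambda>\<kappa> i. f (\<kappa> i))) ?E =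
        (\<Prod>j\<in>J. emeasure (distr M L f) (F j))" .
  qed simp
qed

text \<open>An inequality suffices, as the integral of a function that is not measurable is 0.\<close>

lemma integral_completion_distr_le:
  fixes u :: "'b \<Rightarrow> real"
  assumes f: "f \<in> M \<rightarrow>\<^sub>M N" and N: "N = distr M N f" and u: "(\<lambda>x. u (f x)) \<in> borel_measurable M" "\<And>y. 0 \<le> u y"
  shows "(\<integral>y. u y \<partial>completion N) \<le> (\<integral>x. u (f x) \<partial>M)"
proof (cases "u \<in> borel_measurable (completion N)")
  case True
  from completion_ex_borel_measurable_real[OF this]
  obtain v where v: "v \<in> borel_measurable N" "AE y in N. u y = v y" by blast
  have "(\<integral>y. u y \<partial>completion N) = (\<integral>y. v y \<partial>completion N)"
    using True v by (intro integral_cong_AE) (auto intro: AE_completion measurable_completion)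
  also have "\<dots> = (\<integral>y. v y \<partial>N)"
    using v(1) by (rule integral_completion)
  also have "\<dots> = (\<integral>y. v y \<partial>distr M N f)"
    using N by simp
  also have "\<dots> = (\<integral>x. v (f x) \<partial>M)"
    by (rule integral_distr[OF f v(1)])
  also have "\<dots> = (\<integral>x. u (f x) \<partial>M)"
  proof (rule integral_cong_AE)
    have "AE y in distr M N f. u y = v y" using v(2) by (simp only: N[symmetric])
    from AE_distrD[OF f this] show "AE x in M. v (f x) = u (f x)" by auto
  qed (use u(1) measurable_compose[OF f v(1)] in auto)
  finally show ?thesis by simp
next
  case False
  then have "\<not> integrable (completion N) u"
    using borel_measurable_integrable by blast
  then have "(\<integral>y. u y \<partial>completion N) = 0"
    by (rule not_integrable_integral_eq)
  also have "0 \<le> (\<integral>x. u (f x) \<partial>M)"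
    using u(2) by (intro Bochner_Integration.integral_nonneg) auto
  finally show ?thesis .
qed


subsection \<open>Uncountable spaces: experts with full feedback\<close>

lemma full_run_Suc:
  "fst (full_run a \<omega> \<phi> (Suc i)) = fst (full_run a \<omega> \<phi> i) + of_bool (fst (a i \<omega> (snd (full_run a \<omega> \<phi> i))))"
  "snd (full_run a \<omega> \<phi> (Suc i)) =
    (snd (full_run a \<omega> \<phi> i))(i := \<phi> (fst (full_run a \<omega> \<phi> (Suc i)) - 1) (snd (a i \<omega> (snd (full_run a \<omega> \<phi> i)))))"
  by (simp_all add: Let_def split: prod.split)

declare full_run.simps(2) [simp del]

lemma full_count_mono:
  assumes "i \<le> j" shows "fst (full_run a \<omega> \<phi> i) \<le> fst (full_run a \<omega> \<phi> j)"
  using assms by (induction rule: dec_induct) (auto simp: full_run_Suc(1))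

lemma full_run_extensional: "snd (full_run a \<omega> \<phi> i) \<in> extensional {..<i}"
  by (induction i) (auto simp: full_run_Suc(2) extensional_def)

text \<open>Presents the histories of all steps as restrictions of one infinite sequence of values,
  which is the form in which \<open>full_algorithm\<close> guarantees infinitely many
  rounds.\<close>

lemma restrict_full_run:
  "restrict (\<lambda>j. snd (full_run a \<omega> \<phi> (Suc j)) j) {..<i} = snd (full_run a \<omega> \<phi> i)"
proof -
  have "snd (full_run a \<omega> \<phi> i) j = snd (full_run a \<omega> \<phi> (Suc j)) j" if "Suc j \<le> i" for j
    using that by (induction rule: dec_induct) (auto simp: full_run_Suc(2))
  then show ?thesis
    using full_run_extensional[of a \<omega> \<phi> i] by (auto simp: fun_eq_iff restrict_def extensional_def Suc_le_eq)
qed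

context
  fixes X :: "'a::metric_space set" and Q :: "real measure" and a :: "'a full_rule"
  assumes alg: "full_algorithm X Q a"
begin

lemma full_rule_measurable:
  "(\<lambda>(\<omega>, v). a i \<omega> v) \<in> Q \<Otimes>\<^sub>M (\<Pi>\<^sub>M j\<in>{..<i}. borel) \<rightarrow>\<^sub>M count_space UNIV \<Otimes>\<^sub>M arms X"
  using alg by (simp add: full_algorithm_def)

lemma space_seed: "space Q = UNIV"
  using alg sets_eq_imp_space_eq[of Q borel] by (simp add: full_algorithm_def seed_law_def)

lemma full_rule_arm: "snd (a i \<omega> (snd (full_run a \<omega> \<phi> i))) \<in> X"
  using measurable_space[OF full_rule_measurable, of "(\<omega>, snd (full_run a \<omega> \<phi> i))" i] full_run_extensional[of a \<omega> \<phi> i]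
  by (auto simp: space_pair_measure space_PiM PiE_iff space_seed space_restrict_space)

lemma full_pick_arm: "full_pick a t \<omega> \<phi> \<in> X"
  unfolding full_pick_def Let_def by (rule full_rule_arm)

lemma full_count_pos: "0 < fst (full_run a \<omega> \<phi> (Suc i))"
proof -
  have "fst (a 0 \<omega> (restrict (\<lambda>_. undefined) {..<0}))"
    using alg unfolding full_algorithm_def by blast
  then have "0 < fst (full_run a \<omega> \<phi> (Suc 0))"
    by (simp add: full_run_Suc(1) restrict_def)
  also have "\<dots> \<le> fst (full_run a \<omega> \<phi> (Suc i))"
    by (rule full_count_mono) simp
  finally show ?thesis .
qed

lemma full_count_unbounded: "\<exists>i. n \<le> fst (full_run a \<omega> \<phi> i)"
proof (induction n)
  case (Suc n)
  then obtain i where i: "n \<le> fst (full_run a \<omega> \<phi> i)" by blast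
  have "\<exists>\<^sub>\<infinity>j. fst (a j \<omega> (restrict (\<lambda>j. snd (full_run a \<omega> \<phi> (Suc j)) j) {..<j}))"
    using alg unfolding full_algorithm_def by blast
  then obtain j where j: "j \<ge> i" "fst (a j \<omega> (snd (full_run a \<omega> \<phi> j)))"
    unfolding restrict_full_run INFM_nat_le by blast
  have "n \<le> fst (full_run a \<omega> \<phi> j)"
    using i full_count_mono[OF j(1), of a \<omega> \<phi>] by simp
  with j(2) have "Suc n \<le> fst (full_run a \<omega> \<phi> (Suc j))"
    by (simp add: full_run_Suc(1))
  then show ?case by blast
qed simp

text \<open>The count of started rounds is unbounded and grows by at most one per step, so it takes
  the value \<open>Suc t\<close>. The first step after which it has this value is the step that
  starts round \<open>t\<close>, and its arm is the pick of that round.\<close>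

lemma full_step:
  fixes \<omega> \<phi> t
  defines "i \<equiv> LEAST i. fst (full_run a \<omega> \<phi> (Suc i)) = Suc t"
  shows "fst (full_run a \<omega> \<phi> i) = t" "fst (full_run a \<omega> \<phi> (Suc i)) = Suc t"
proof -
  obtain n where n: "Suc t \<le> fst (full_run a \<omega> \<phi> n)" "\<And>m. m < n \<Longrightarrow> \<not> Suc t \<le> fst (full_run a \<omega> \<phi> m)"
    using full_count_unbounded[of "Suc t" \<omega> \<phi>] exists_least_iff[of "\<lambda>n. Suc t \<le> fst (full_run a \<omega> \<phi> n)"] by blast
  then obtain m where m: "n = Suc m" by (cases n) auto
  have "fst (full_run a \<omega> \<phi> m) \<le> t" using n(2)[of m] m by simp
  then have "fst (full_run a \<omega> \<phi> (Suc m)) = Suc t"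
    using n(1) m by (auto simp: full_run_Suc(1) of_bool_def split: if_splits)
  then show *: "fst (full_run a \<omega> \<phi> (Suc i)) = Suc t"
    unfolding i_def by (rule LeastI)
  show "fst (full_run a \<omega> \<phi> i) = t"
  proof (rule ccontr)
    assume ne: "fst (full_run a \<omega> \<phi> i) \<noteq> t"
    then have c: "fst (full_run a \<omega> \<phi> i) = Suc t"
      using * by (auto simp: full_run_Suc(1) of_bool_def split: if_splits)
    then obtain j where j: "i = Suc j" by (cases "i") auto
    then have "i \<le> j"
      using c unfolding i_def by (intro Least_le) simp
    then show False using j by simp
  qed
qed

lemma full_run_cong:
  assumes "\<And>s. s < t \<Longrightarrow> \<phi> s = \<phi>' s" "fst (full_run a \<omega> \<phi> i) \<le> t"
  shows "full_run a \<omega> \<phi>' i = full_run a \<omega> \<phi> i"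
  using assms(2)
proof (induction i)
  case (Suc i)
  have IH: "full_run a \<omega> \<phi>' i = full_run a \<omega> \<phi> i"
    using Suc full_count_mono[of i "Suc i" a \<omega> \<phi>] by simp
  then have c: "fst (full_run a \<omega> \<phi>' (Suc i)) = fst (full_run a \<omega> \<phi> (Suc i))"
    by (simp add: full_run_Suc(1))
  \<comment> \<open>Step 0 starts a round, so the count is positive after every step; subtracting 1
    from a count that is at most \<open>t\<close> thus gives a round before
    \<open>t\<close>.\<close>
  have "\<phi> (fst (full_run a \<omega> \<phi> (Suc i)) - 1) = \<phi>' (fst (full_run a \<omega> \<phi> (Suc i)) - 1)"
    using full_count_pos[of \<omega> \<phi> i] Suc.prems by (intro assms(1)) simp
  then have "snd (full_run a \<omega> \<phi>' (Suc i)) = snd (full_run a \<omega> \<phi> (Suc i))"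
    by (simp add: full_run_Suc(2) c IH)
  with c show ?case by (simp add: prod_eq_iff)
qed simp

text \<open>The pick of round \<open>t\<close> is made before any value of that round is observed,
  whatever the number of queries in earlier rounds. This provides \<open>pick_local\<close> for the
  adversary.\<close>

lemma full_pick_cong:
  assumes "\<And>s. s < t \<Longrightarrow> \<phi> s = \<phi>' s"
  shows "full_pick a t \<omega> \<phi> = full_pick a t \<omega> \<phi>'"
proof -
  let ?i = "LEAST i. fst (full_run a \<omega> \<phi> (Suc i)) = Suc t"
  have run: "full_run a \<omega> \<phi>' j = full_run a \<omega> \<phi> j" if "j \<le> ?i" for j
    using full_count_mono[OF that, of a \<omega> \<phi>] full_step(1)[of \<omega> \<phi> t] assms by (intro full_run_cong) auto
  have "(LEAST i. fst (full_run a \<omega> \<phi>' (Suc i)) = Suc t) = ?i"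
  proof (rule Least_equality)
    show "fst (full_run a \<omega> \<phi>' (Suc ?i)) = Suc t"
      using full_step(2)[of \<omega> \<phi> t] run[of ?i] by (simp add: full_run_Suc(1))
    fix j assume j: "fst (full_run a \<omega> \<phi>' (Suc j)) = Suc t"
    show "?i \<le> j"
    proof (rule ccontr)
      assume "\<not> ?i \<le> j"
      then have "fst (full_run a \<omega> \<phi> (Suc j)) = Suc t"
        using run[of "Suc j"] j by simp
      then have "?i \<le> j" by (rule Least_le)
      with \<open>\<not> ?i \<le> j\<close> show False by simp
    qed
  qed
  then show ?thesis
    by (simp add: full_pick_def run)
qed

lemma full_pick_measurable:
  fixes F :: "'z::countable \<Rightarrow> 'a \<Rightarrow> real"
  assumes F: "(\<lambda>(z, x). F z x) \<in> borel_measurable (count_space UNIV \<Otimes>\<^sub>M arms X)"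
  shows "(\<lambda>p. full_pick a t (fst p) (\<lambda>s. restrict (F (snd p s)) X)) \<in>
    Q \<Otimes>\<^sub>M (\<Pi>\<^sub>M i\<in>UNIV. count_space UNIV) \<rightarrow>\<^sub>M arms X"
proof -
  let ?M = "Q \<Otimes>\<^sub>M (\<Pi>\<^sub>M i\<in>(UNIV :: nat set). count_space (UNIV :: 'z set))"
  let ?run = "\<lambda>i p. full_run a (fst p) (\<lambda>s. restrict (F (snd p s)) X) i"
  have run: "(\<lambda>p. fst (?run i p)) \<in> ?M \<rightarrow>\<^sub>M count_space UNIV \<and> (\<lambda>p. snd (?run i p)) \<in> ?M \<rightarrow>\<^sub>M (\<Pi>\<^sub>M j\<in>{..<i}. borel)" for i
  proof (induction i)
    case 0
    then show ?case by (auto intro!: measurable_const simp: space_PiM)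
  next
    case (Suc i)
    have "(\<lambda>p. (fst p, snd (?run i p))) \<in> ?M \<rightarrow>\<^sub>M Q \<Otimes>\<^sub>M (\<Pi>\<^sub>M j\<in>{..<i}. borel)"
      by (intro measurable_Pair measurable_fst conjunct2[OF Suc])
    from measurable_compose[OF this full_rule_measurable]
    have a: "(\<lambda>p. a i (fst p) (snd (?run i p))) \<in> ?M \<rightarrow>\<^sub>M count_space UNIV \<Otimes>\<^sub>M arms X" by simp
    have b: "(\<lambda>p. fst (a i (fst p) (snd (?run i p)))) \<in> ?M \<rightarrow>\<^sub>M count_space UNIV"
      using measurable_compose[OF a measurable_fst] .
    have x: "(\<lambda>p. snd (a i (fst p) (snd (?run i p)))) \<in> ?M \<rightarrow>\<^sub>M arms X"
      using measurable_compose[OF a measurable_snd] .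
    have k: "(\<lambda>p. fst (?run (Suc i) p)) \<in> ?M \<rightarrow>\<^sub>M count_space UNIV"
    proof -
      have "(\<lambda>p. (\<lambda>(k, b). k + of_bool b) (fst (?run i p), fst (a i (fst p) (snd (?run i p))))) \<in> ?M \<rightarrow>\<^sub>M count_space (UNIV :: nat set)"
        by (rule measurable_compose[OF measurable_Pair[OF conjunct1[OF Suc] b]]) (simp add: pair_measure_countable)
      then show ?thesis by (simp add: full_run_Suc(1))
    qed
    \<comment> \<open>The round whose payoff function is queried is itself random; the coordinate of
      a random round is measurable by splitting over the countably many values of the count.\<close>
    have z: "(\<lambda>p. snd p (fst (?run (Suc i) p) - 1)) \<in> ?M \<rightarrow>\<^sub>M count_space UNIV"
    proof (rule measurable_compose_countable[where f="\<lambda>n p. snd p (n - 1)"])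
      fix n :: nat
      show "(\<lambda>p. snd p (n - 1)) \<in> ?M \<rightarrow>\<^sub>M count_space UNIV"
        using measurable_compose[OF measurable_snd[of Q] measurable_component_singleton[of "n - 1" UNIV "\<lambda>_. count_space (UNIV :: 'z set)"]] by simp
    qed (rule k)
    have "(\<lambda>p. F (snd p (fst (?run (Suc i) p) - 1)) (snd (a i (fst p) (snd (?run i p))))) \<in> borel_measurable ?M"
      using measurable_compose[OF measurable_Pair[OF z x] F] by simp
    then have "(\<lambda>p. restrict (F (snd p (fst (?run (Suc i) p) - 1))) X (snd (a i (fst p) (snd (?run i p))))) \<in> borel_measurable ?M"
      by (simp add: restrict_def full_rule_arm)
    then have "(\<lambda>p. snd (?run (Suc i) p)) \<in> ?M \<rightarrow>\<^sub>M (\<Pi>\<^sub>M j\<in>{..<Suc i}. borel)"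
      unfolding full_run_Suc(2) by (intro measurable_PiM_fun_upd conjunct2[OF Suc])
    with k show ?case by blast
  qed
  have arm: "(\<lambda>p. snd (a i (fst p) (snd (?run i p)))) \<in> ?M \<rightarrow>\<^sub>M arms X" for i
  proof -
    have "(\<lambda>p. (fst p, snd (?run i p))) \<in> ?M \<rightarrow>\<^sub>M Q \<Otimes>\<^sub>M (\<Pi>\<^sub>M j\<in>{..<i}. borel)"
      by (intro measurable_Pair measurable_fst conjunct2[OF run])
    from measurable_compose[OF measurable_compose[OF this full_rule_measurable] measurable_snd]
    show ?thesis by simp
  qed
  have least: "(\<lambda>p. LEAST i. fst (?run (Suc i) p) = Suc t) \<in> ?M \<rightarrow>\<^sub>M count_space UNIV"
  proof (rule measurable_Least)
    fix i
    show "Measurable.pred ?M (\<lambda>p. fst (?run (Suc i) p) = Suc t)"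
      using measurable_compose[OF conjunct1[OF run[of "Suc i"]], of "\<lambda>n. n = Suc t" "count_space UNIV"] by simp
  qed
  show ?thesis
    unfolding full_pick_def Let_def
    by (rule measurable_compose_countable[where f="\<lambda>i p. snd (a i (fst p) (snd (?run i p)))", OF arm least])
qed

end

theorem uncountable_imp_not_full_tractable_uniform:
  fixes X :: "'a::metric_space set" and g :: "nat \<Rightarrow> real"
  assumes X: "compact X" "uncountable X" and g: "(\<lambda>t. g t / sqrt (real t)) \<longlonglongrightarrow> 0"
  shows "\<not> full_tractable_uniform X g"
proof
  assume "full_tractable_uniform X g"
  then obtain Q a where alg: "full_algorithm X Q a"
    and tr: "\<And>P. expert_instance X P \<Longrightarrow> uniformly_lipschitz X P \<Longrightarrow>
      \<exists>C. \<forall>t\<ge>1. expert_regret X Q (full_pick a) P t \<le> C * g t"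
    unfolding full_tractable_uniform_def by metis
  obtain h :: "nat \<Rightarrow> 'a \<Rightarrow> real" and r where hr: "\<And>k. 0 < r k" "\<And>k. r k \<le> 1 / 2" "\<And>k x. \<bar>h k x\<bar> \<le> r k"
    "\<And>k. 1-lipschitz_on UNIV (h k)" "\<And>\<beta>. \<exists>x\<in>X. \<forall>k. h k x = (if \<beta> k then r k else - r k)"
    by (rule uncountable_compact_lipschitz_coordinates[OF X]) (rule that)
  have lip: "1-lipschitz_on X (h k)" for k
    using lipschitz_on_subset[OF hr(4)] by simp
  have h_meas: "h k \<in> borel_measurable (arms X)" for k
    using lipschitz_on_continuous_on[OF lip] by (rule borel_measurable_continuous_on_restrict)
  have q: "pmf level k * r k > 0" for k using hr(1)[of k] pmf_level_pos[of k] by simp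
  obtain T where times: "\<And>k. T k \<ge> 1" "mono T" "\<And>k. \<bar>g (T k)\<bar> * real (Suc k) \<le> pmf level k * r k * sqrt (T k)"
    by (rule sparse_times[OF g q]) (rule that)
  \<comment> \<open>The points of \<open>payoff_borel X\<close> are extensional functions on
    \<open>X\<close>, hence the restriction. All picks and queries lie in \<open>X\<close>, where it
    changes nothing.\<close>
  define \<Phi> where "\<Phi> z = restrict (signed_payoff h z) X" for z
  have Q: "prob_space Q" using alg by (simp add: full_algorithm_def seed_law_def)
  interpret adversary X Q "\<lambda>s \<omega> \<kappa>. full_pick a s \<omega> (\<lambda>t. \<Phi> (\<kappa> t))" h r T
  proof (intro adversary.intro adversary_axioms.intro Q hr h_meas times(1,2))
    show "(\<lambda>p. full_pick a s (fst p) (\<lambda>t. \<Phi> (snd p t))) \<in> Q \<Otimes>\<^sub>M (\<Pi>\<^sub>M i\<in>UNIV. count_space UNIV) \<rightarrow>\<^sub>M arms X" for s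
      unfolding \<Phi>_def by (rule full_pick_measurable[OF alg signed_payoff_measurable[OF h_meas]])
    show "full_pick a s \<omega> (\<lambda>t. \<Phi> (\<kappa> t)) = full_pick a s \<omega> (\<lambda>t. \<Phi> (\<kappa>' t))" if "\<And>i. i < s \<Longrightarrow> \<kappa> i = \<kappa>' i" for s \<omega> \<kappa> \<kappa>'
      using that by (intro full_pick_cong[OF alg]) simp
  qed
  define P where "P = distr (measure_pmf (coin \<theta>)) (payoff_borel X) \<Phi>"
  have \<Phi>: "\<Phi> \<in> measure_pmf (coin \<theta>) \<rightarrow>\<^sub>M payoff_borel X"
    using signed_payoff_bounds by (auto simp: \<Phi>_def space_payoff_borel)
  have P: "prob_space P" unfolding P_def by (rule measure_pmf.prob_space_distr[OF \<Phi>])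
  have sP: "sets P = sets (payoff_borel X)" by (simp add: P_def)
  have mean: "expert_mean P x = mean \<theta> x" if "x \<in> X" for x
    unfolding expert_mean_def P_def mean_def
    using that by (subst integral_distr[OF \<Phi> measurable_payoff_eval[OF that]]) (simp add: \<Phi>_def)
  have AE_lip: "AE f in P. 1-lipschitz_on X f"
  proof -
    have "{f \<in> space (payoff_borel X). 1-lipschitz_on X f} \<in> sets (payoff_borel X)"
      using closedin_payoff_borel[OF closedin_lipschitz[of X]]
      by (simp add: space_payoff_borel payoff_topology_def)
    moreover have "1-lipschitz_on X (\<Phi> z)" for z
      using signed_payoff_lipschitz[where z=z, OF lip] by (auto simp: \<Phi>_def lipschitz_on_def)
    ultimately show ?thesis
      unfolding P_def by (subst AE_distr_iff[OF \<Phi>]) auto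
  qed
  have inst: "expert_instance X P"
    unfolding expert_instance_def
  proof (intro conjI P sP measurable_evaluation_lipschitz[OF X(1) P sP AE_lip])
    show "1-lipschitz_on X (expert_mean P)"
      using mean_lipschitz[OF lip, of \<theta>] mean by (auto simp: lipschitz_on_def)
  qed
  obtain C where C: "\<And>t. t \<ge> 1 \<Longrightarrow> expert_regret X Q (full_pick a) P t \<le> C * g t"
    using tr[OF inst uniformly_lipschitz_AE[OF P sP AE_lip]] by blast
  have "pmf level k * r k * sqrt (T k) / 24 \<le> expert_regret X Q (full_pick a) P (T k)" for k
  proof -
    let ?N = "Q \<Otimes>\<^sub>M (\<Pi>\<^sub>M t\<in>(UNIV :: nat set). P)"
    let ?f = "\<lambda>p. (fst p, \<lambda>t. \<Phi> (snd p t))"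
    define u where "u p = (\<Sum>s<T k. expert_mean P (full_pick a s (fst p) (snd p)))" for p
    have seq: "distr (rounds \<theta>) (\<Pi>\<^sub>M t\<in>UNIV. P) (\<lambda>\<kappa> t. \<Phi> (\<kappa> t)) = (\<Pi>\<^sub>M t\<in>UNIV. P)"
      unfolding P_def by (rule distr_PiM_UNIV[OF measure_pmf.prob_space_axioms \<Phi>])
    have m: "(\<lambda>\<kappa> t. \<Phi> (\<kappa> t)) \<in> rounds \<theta> \<rightarrow>\<^sub>M (\<Pi>\<^sub>M t\<in>UNIV. P)"
    proof (rule measurable_PiM_single')
      fix i :: nat
      have "(\<lambda>\<kappa>. \<kappa> i) \<in> rounds \<theta> \<rightarrow>\<^sub>M measure_pmf (coin \<theta>)"
        using measurable_component_singleton[of i UNIV "\<lambda>_. measure_pmf (coin \<theta>)"] by simp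
      from measurable_compose[OF this \<Phi>] show "(\<lambda>\<kappa>. \<Phi> (\<kappa> i)) \<in> rounds \<theta> \<rightarrow>\<^sub>M P"
        by (simp add: P_def)
    qed (use measurable_space[OF \<Phi>] in \<open>auto simp: P_def PiE_iff\<close>)
    have f: "?f \<in> law \<theta> \<rightarrow>\<^sub>M ?N"
      by (intro measurable_Pair measurable_fst measurable_compose[OF measurable_snd m])
    have N: "?N = distr (law \<theta>) ?N ?f"
    proof -
      interpret seq: prob_space "\<Pi>\<^sub>M t\<in>(UNIV :: nat set). P"
        by (intro prob_space_PiM P)
      have "distr Q Q (\<lambda>x. x) \<Otimes>\<^sub>M distr (rounds \<theta>) (\<Pi>\<^sub>M t\<in>UNIV. P) (\<lambda>\<kappa> t. \<Phi> (\<kappa> t)) =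
          distr (law \<theta>) ?N (\<lambda>(x, y). (x, \<lambda>t. \<Phi> (y t)))"
        by (rule pair_measure_distr) (use m seq seq.sigma_finite_measure_axioms in auto)
      then show ?thesis by (simp add: seq distr_id case_prod_beta')
    qed
    have u_f: "u (?f p) = (\<Sum>s<T k. mean \<theta> (full_pick a s (fst p) (\<lambda>t. \<Phi> (snd p t))))" for p
      unfolding u_def using full_pick_arm[OF alg] by (simp add: mean)
    have "(\<integral>p. u p \<partial>completion ?N) \<le> (\<integral>p. u (?f p) \<partial>law \<theta>)"
    proof (rule integral_completion_distr_le[OF f N])
      show "(\<lambda>p. u (?f p)) \<in> borel_measurable (law \<theta>)"
        unfolding u_f by (intro borel_measurable_sum measurable_compose[OF pick_law mean_measurable])
      show "0 \<le> u p" for p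
        unfolding u_def using full_pick_arm[OF alg] mean_bounds by (intro sum_nonneg) (simp add: mean)
    qed
    moreover have "(SUP x\<in>X. expert_mean P x) = (SUP x\<in>X. mean \<theta> x)"
      using mean by (intro SUP_cong) auto
    ultimately show ?thesis
      using regret_lower_bound[of k]
      by (simp add: expert_regret_def expert_space_def case_prod_beta' u_f flip: u_def)
  qed
  then show False
    by (rule not_bounded_by_sparse[OF times(1,3) q _ C])
qed


subsection \<open>The dichotomies\<close>

text \<open>Steps \<open>2 * s\<close> and \<open>2 * s + 1\<close> of the full-feedback run form
  round \<open>s\<close>. The restriction hides the value just observed at step
  \<open>2 * t\<close>, so that both members of a pair come from the same evaluation of the double
  rule; beyond it, the entries are \<open>undefined\<close> as in \<open>double_run\<close>.\<close>

definition paired :: "nat \<Rightarrow> (nat \<Rightarrow> real) \<Rightarrow> nat \<Rightarrow> real \<times> real" where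
  "paired t v = restrict (\<lambda>s. (v (2 * s), v (2 * s + 1))) {..<t}"

definition full_of_double :: "'a double_rule \<Rightarrow> 'a full_rule" where
  "full_of_double a i \<omega> v = (even i, (if even i then fst else snd) (a (i div 2) \<omega> (paired (i div 2) v)))"

lemma full_of_double_sel:
  "fst (full_of_double a i \<omega> v) = even i"
  "snd (full_of_double a i \<omega> v) = (if even i then fst else snd) (a (i div 2) \<omega> (paired (i div 2) v))"
  by (simp_all add: full_of_double_def)

lemma full_of_double_algorithm:
  assumes "double_algorithm X Q a"
  shows "full_algorithm X Q (full_of_double a)"
  unfolding full_algorithm_def
proof (intro conjI allI)
  show "seed_law Q" using assms by (simp add: double_algorithm_def)
  show "fst (full_of_double a 0 \<omega> (restrict v {..<0}))" for \<omega> v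
    by (simp add: full_of_double_sel)
  show "\<exists>\<^sub>\<infinity>i. fst (full_of_double a i \<omega> (restrict v {..<i}))" for \<omega> v
    unfolding INFM_nat_le
  proof
    show "\<exists>n\<ge>m. fst (full_of_double a n \<omega> (restrict v {..<n}))" for m
      by (rule exI[of _ "2 * m"]) (simp add: full_of_double_sel)
  qed
  fix i :: nat
  let ?M = "Q \<Otimes>\<^sub>M (\<Pi>\<^sub>M j\<in>{..<i}. (borel :: real measure))"
  have component: "(\<lambda>p. snd p j) \<in> borel_measurable ?M" if "j < i" for j
    using measurable_compose[OF measurable_snd measurable_component_singleton[of j "{..<i}" "\<lambda>_. borel"]] that by simp
  have "(\<lambda>p. (fst p, paired (i div 2) (snd p))) \<in> ?M \<rightarrow>\<^sub>M Q \<Otimes>\<^sub>M (\<Pi>\<^sub>M s\<in>{..<i div 2}. borel \<Otimes>\<^sub>M borel)"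
    unfolding paired_def by (intro measurable_Pair measurable_fst measurable_restrict component) auto
  moreover have "(\<lambda>(\<omega>, v). a (i div 2) \<omega> v) \<in> Q \<Otimes>\<^sub>M (\<Pi>\<^sub>M s\<in>{..<i div 2}. borel \<Otimes>\<^sub>M borel) \<rightarrow>\<^sub>M arms X \<Otimes>\<^sub>M arms X"
    using assms by (simp add: double_algorithm_def)
  ultimately have "(\<lambda>p. a (i div 2) (fst p) (paired (i div 2) (snd p))) \<in> ?M \<rightarrow>\<^sub>M arms X \<Otimes>\<^sub>M arms X"
    using measurable_compose by fastforce
  then have "(\<lambda>p. (if even i then fst else snd) (a (i div 2) (fst p) (paired (i div 2) (snd p)))) \<in> ?M \<rightarrow>\<^sub>M arms X"
    by (cases "even i") (simp_all add: measurable_compose[OF _ measurable_fst] measurable_compose[OF _ measurable_snd])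
  then show "(\<lambda>(\<omega>, v). full_of_double a i \<omega> v) \<in> ?M \<rightarrow>\<^sub>M count_space UNIV \<Otimes>\<^sub>M arms X"
    unfolding full_of_double_def case_prod_beta' by (intro measurable_Pair measurable_const) simp_all
qed

lemma full_of_double_run:
  "fst (full_run (full_of_double a) \<omega> \<phi> (2 * t)) = t \<and>
   paired t (snd (full_run (full_of_double a) \<omega> \<phi> (2 * t))) = double_run a \<omega> \<phi> t"
proof (induction t)
  case 0
  show ?case by (simp add: paired_def restrict_def)
next
  case (Suc t)
  let ?run = "full_run (full_of_double a) \<omega> \<phi>"
  let ?v = "snd (?run (2 * t))"
  have p: "paired t (?v(2 * t := c)) = paired t ?v" for c
    by (auto simp: paired_def restrict_def)
  have 1: "fst (?run (Suc (2 * t))) = Suc t"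
    "snd (?run (Suc (2 * t))) = ?v(2 * t := \<phi> t (fst (a t \<omega> (double_run a \<omega> \<phi> t))))"
    using Suc by (simp_all add: full_run_Suc full_of_double_sel)
  have 2: "fst (?run (Suc (Suc (2 * t)))) = Suc t"
    "snd (?run (Suc (Suc (2 * t)))) = ?v(2 * t := \<phi> t (fst (a t \<omega> (double_run a \<omega> \<phi> t))),
      Suc (2 * t) := \<phi> t (snd (a t \<omega> (double_run a \<omega> \<phi> t))))"
    using Suc by (simp_all add: full_run_Suc(1)[of _ _ _ "Suc (2 * t)"] full_run_Suc(2)[of _ _ _ "Suc (2 * t)"] 1 p full_of_double_sel)
  have "paired (Suc t) (snd (?run (Suc (Suc (2 * t))))) =
      (paired t ?v)(t := (\<phi> t (fst (a t \<omega> (double_run a \<omega> \<phi> t))), \<phi> t (snd (a t \<omega> (double_run a \<omega> \<phi> t)))))"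
    unfolding 2 by (auto simp: paired_def restrict_def fun_eq_iff)
  with 2(1) Suc show ?case
    by (simp add: Let_def case_prod_beta)
qed

lemma full_pick_full_of_double: "full_pick (full_of_double a) = double_pick a"
proof (intro ext)
  fix t \<omega> \<phi>
  let ?run = "full_run (full_of_double a) \<omega> \<phi>"
  have "(LEAST i. fst (?run (Suc i)) = Suc t) = 2 * t"
  proof (rule Least_equality)
    show "fst (?run (Suc (2 * t))) = Suc t"
      using full_of_double_run[of a \<omega> \<phi> t] by (simp add: full_run_Suc(1) full_of_double_sel)
    fix j assume j: "fst (?run (Suc j)) = Suc t"
    show "2 * t \<le> j"
    proof (rule ccontr)
      assume "\<not> 2 * t \<le> j"
      then have "fst (?run (Suc j)) \<le> fst (?run (2 * t))" by (intro full_count_mono) simp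
      then show False using j full_of_double_run[of a \<omega> \<phi> t] by simp
    qed
  qed
  then show "full_pick (full_of_double a) t \<omega> \<phi> = double_pick a t \<omega> \<phi>"
    using full_of_double_run[of a \<omega> \<phi> t] by (simp add: full_pick_def double_pick_def full_of_double_sel)
qed

text \<open>The two alternatives for experts concern different kinds of feedback and different
  classes of instances; this monotonicity makes them exclude each other.\<close>

lemma double_tractable_imp_full_tractable_uniform:
  assumes "double_tractable X f"
  shows "full_tractable_uniform X f"
proof -
  obtain Q a where "double_algorithm X Q a"
    "\<forall>P. expert_instance X P \<longrightarrow> (\<exists>C. \<forall>t\<ge>1. expert_regret X Q (double_pick a) P t \<le> C * f t)"
    using assms unfolding double_tractable_def by blast
  then show ?thesis
    unfolding full_tractable_uniform_def
    by (intro exI[of _ Q] exI[of _ "full_of_double a"]) (simp add: full_of_double_algorithm full_pick_full_of_double)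
qed

theorem theorem7p1:
  fixes X :: "'a::metric_space set"
  assumes "compact X" and "X \<noteq> {}" and "diameter X \<le> 1"
  defines "mab_easy \<equiv>
      (\<forall>f::nat \<Rightarrow> real. (\<forall>t\<ge>1. f t > 0) \<and> filterlim (\<lambda>t. f t / ln (real t)) at_top sequentially
         \<longrightarrow> mab_tractable X f)"
    and "mab_hard \<equiv>
      (\<forall>g::nat \<Rightarrow> real. (\<lambda>t. g t / sqrt (real t)) \<longlonglongrightarrow> 0 \<longrightarrow> \<not> mab_tractable X g)"
    and "experts_easy \<equiv> double_tractable X (\<lambda>_. 1)"
    and "experts_hard \<equiv>
      (\<forall>g::nat \<Rightarrow> real. (\<lambda>t. g t / sqrt (real t)) \<longlonglongrightarrow> 0 \<longrightarrow> \<not> full_tractable_uniform X g)"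
  shows "(mab_easy \<or> mab_hard) \<and> \<not> (mab_easy \<and> mab_hard) \<and> (mab_easy \<longleftrightarrow> countable X) \<and>
         (experts_easy \<or> experts_hard) \<and> \<not> (experts_easy \<and> experts_hard) \<and>
         (experts_easy \<longleftrightarrow> countable X)"
proof -
  have mab_excl: "\<not> (mab_easy \<and> mab_hard)"
  proof
    assume both: "mab_easy \<and> mab_hard"
    \<comment> \<open>Any rate strictly between \<open>ln t\<close> and \<open>sqrt t\<close>
      refutes the conjunction, since both alternatives apply to it.\<close>
    define f where "f t = real t powr (1/4)" for t
    have "\<forall>t\<ge>1. f t > 0" by (simp add: f_def)
    moreover have "filterlim (\<lambda>t. f t / ln (real t)) at_top sequentially"
      unfolding f_def by real_asymp
    moreover have "(\<lambda>t. f t / sqrt (real t)) \<longlonglongrightarrow> 0"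
      unfolding f_def by real_asymp
    ultimately show False
      using both unfolding mab_easy_def mab_hard_def by blast
  qed
  have experts_excl: "\<not> (experts_easy \<and> experts_hard)"
  proof
    assume both: "experts_easy \<and> experts_hard"
    have "(\<lambda>t. 1 / sqrt (real t)) \<longlonglongrightarrow> 0" by real_asymp
    then have "\<not> full_tractable_uniform X (\<lambda>_. 1)"
      using both unfolding experts_hard_def by (auto dest: spec[of _ "\<lambda>_. 1"])
    then show False
      using both double_tractable_imp_full_tractable_uniform unfolding experts_easy_def by blast
  qed
  have easy: "mab_easy \<and> experts_easy" if "countable X"
    unfolding mab_easy_def experts_easy_def
    using countable_imp_mab_tractable[OF assms(1,2) that] countable_imp_double_tractable[OF assms(1,2) that]
    by blast
  have hard: "mab_hard \<and> experts_hard" if "uncountable X"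
    unfolding mab_hard_def experts_hard_def
    using uncountable_imp_not_mab_tractable[OF assms(1) that]
      uncountable_imp_not_full_tractable_uniform[OF assms(1) that] by blast
  show ?thesis
    using mab_excl experts_excl easy hard by blast
qed

end
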